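(* There exists a distribution over sequences of $O(n)$ updates and queries for the dynamic connectivity problem on $n$ vertices such that the following holds. For any randomized cell-probe data structure $D$ with word size $w=\Theta(\log n)$ which, on an input drawn from this distribution, with probability $p$ both answers at least a $(\frac12+\delta)$-fraction of the queries correctly and spends at most $\epsilon n\log n$ total running time, we must have $p\le\exp(-\delta^2 n)$, as long as $\delta^2\gg 1/\log(1/\epsilon)$, $\epsilon\ge\Omega(1/\log n)$, and $n$ is sufficiently large. Moreover, in every sequence in the support of the distribution, the graph is a forest throughout the sequence of updates.
   Context: Dynamic connectivity problem: maintain an undirected graph $G=(V,E)$ on $n$ vertices under the operations insert$(u,v)$ (add edge $(u,v)$ to $E$), delete$(u,v)$ (remove edge $(u,v)$ from $E$), and query$(u,v)$ (return whether there is currently a path between $u$ and $v$). The setting is the cell-probe model: memory consists of cells of $w$ bits, and running time is the number of cells probed. Notation: $\exp(f(n))$ means $2^{\Theta(f(n))}$; logarithms are base 2. *)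

theory Defs
  imports "HOL-Probability.Probability"
begin

section \<open>Dynamic connectivity\<close>

text \<open>A graph on the vertices \<open>0, \<dots>, n - 1\<close> is given by its edge set; the undirected edge
  between \<open>u\<close> and \<open>v\<close> is the set \<open>{u, v}\<close>.\<close>

type_synonym graph = "nat set set"

datatype operation = Insert nat nat | Delete nat nat | Query nat nat

text \<open>Self-loops are not permitted, but inserting a present edge or deleting an absent one is
  (and has no effect).\<close>

fun operation_on :: "nat \<Rightarrow> operation \<Rightarrow> bool" where
  "operation_on n (Insert u v) \<longleftrightarrow> u < n \<and> v < n \<and> u \<noteq> v"
| "operation_on n (Delete u v) \<longleftrightarrow> u < n \<and> v < n \<and> u \<noteq> v"
| "operation_on n (Query u v) \<longleftrightarrow> u < n \<and> v < n"

fun apply_operation :: "operation \<Rightarrow> graph \<Rightarrow> graph" where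
  "apply_operation (Insert u v) E = insert {u, v} E"
| "apply_operation (Delete u v) E = E - {{u, v}}"
| "apply_operation (Query u v) E = E"

definition graph_after :: "operation list \<Rightarrow> graph" where
  "graph_after ops = fold apply_operation ops {}"

definition path_between :: "graph \<Rightarrow> nat \<Rightarrow> nat \<Rightarrow> bool" where
  "path_between E u v \<longleftrightarrow> (u, v) \<in> {(x, y). {x, y} \<in> E}\<^sup>*"

definition is_cycle :: "graph \<Rightarrow> nat list \<Rightarrow> bool" where
  "is_cycle E vs \<longleftrightarrow> 3 \<le> length vs \<and> distinct vs \<and>
     (\<forall>i<length vs. {vs ! i, vs ! ((i + 1) mod length vs)} \<in> E)"

definition is_forest :: "graph \<Rightarrow> bool" where
  "is_forest E \<longleftrightarrow> (\<forall>e\<in>E. card e = 2) \<and> (\<nexists>vs. is_cycle E vs)"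

definition forest_throughout :: "operation list \<Rightarrow> bool" where
  "forest_throughout ops \<longleftrightarrow> (\<forall>k\<le>length ops. is_forest (graph_after (take k ops)))"

section \<open>The cell-probe model\<close>

text \<open>A \<open>w\<close>-bit word is a natural number below \<open>2 ^ w\<close>; memory cells hold \<open>w\<close>-bit words and have
  \<open>w\<close>-bit addresses. An operation is carried out by an adaptive decision tree: each read or write
  of a cell is one probe, the next step depends arbitrarily on everything read so far during this
  operation, and computation is free. Between operations, only the memory contents persist.\<close>

type_synonym memory = "nat \<Rightarrow> nat"

datatype probe_tree = Return bool | Read nat "nat \<Rightarrow> probe_tree" | Write nat nat probe_tree

primrec word_bounded :: "nat \<Rightarrow> probe_tree \<Rightarrow> bool" where
  "word_bounded w (Return b) \<longleftrightarrow> True"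
| "word_bounded w (Read a k) \<longleftrightarrow> a < 2 ^ w \<and> (\<forall>x<2 ^ w. word_bounded w (k x))"
| "word_bounded w (Write a x t) \<longleftrightarrow> a < 2 ^ w \<and> x < 2 ^ w \<and> word_bounded w t"

text \<open>The result consists of the returned bit, the new memory and the number of probes.\<close>

primrec exec :: "probe_tree \<Rightarrow> memory \<Rightarrow> bool \<times> memory \<times> nat" where
  "exec (Return b) m = (b, m, 0)"
| "exec (Read a k) m = (case exec (k (m a)) m of (b, m', s) \<Rightarrow> (b, m', Suc s))"
| "exec (Write a x t) m = (case exec t (m(a := x)) of (b, m', s) \<Rightarrow> (b, m', Suc s))"

text \<open>The initial memory is arbitrary, so preprocessing the empty graph costs nothing.\<close>

record data_structure =
  initial_memory :: memory
  procedure :: "operation \<Rightarrow> probe_tree"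

definition cell_probe_ds :: "nat \<Rightarrow> nat \<Rightarrow> data_structure \<Rightarrow> bool" where
  "cell_probe_ds n w D \<longleftrightarrow>
     (\<forall>a<2 ^ w. initial_memory D a < 2 ^ w) \<and>
     (\<forall>x. operation_on n x \<longrightarrow> word_bounded w (procedure D x))"

primrec run_from :: "data_structure \<Rightarrow> operation list \<Rightarrow> memory \<Rightarrow> bool list \<times> nat" where
  "run_from D [] m = ([], 0)"
| "run_from D (x # xs) m =
     (case exec (procedure D x) m of (b, m', s) \<Rightarrow>
        (case run_from D xs m' of (bs, s') \<Rightarrow> (b # bs, s + s')))"

text \<open>One returned bit per operation (those returned by updates are ignored), and the total
  number of probes.\<close>

definition run :: "data_structure \<Rightarrow> operation list \<Rightarrow> bool list \<times> nat" where
  "run D ops = run_from D ops (initial_memory D)"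

definition query_positions :: "operation list \<Rightarrow> nat set" where
  "query_positions ops = {i. i < length ops \<and> (\<exists>u v. ops ! i = Query u v)}"

definition correct_positions :: "operation list \<Rightarrow> bool list \<Rightarrow> nat set" where
  "correct_positions ops bs =
     {i. i < length ops \<and>
        (\<exists>u v. ops ! i = Query u v \<and> bs ! i = path_between (graph_after (take i ops)) u v)}"

definition succeeds :: "nat \<Rightarrow> real \<Rightarrow> real \<Rightarrow> operation list \<Rightarrow> data_structure \<Rightarrow> bool" where
  "succeeds n \<epsilon> \<delta> ops D \<longleftrightarrow> (case run D ops of (bs, s) \<Rightarrow>
     real (card (correct_positions ops bs)) \<ge> (1 / 2 + \<delta>) * real (card (query_positions ops)) \<and>
     real s \<le> \<epsilon> * real n * log 2 (real n))"

text \<open>A randomized data structure is a probability measure on deterministic ones: all random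
  choices, including an infinite random tape, may be fixed in advance. Measurability is asked for
  all operation sequences, even those not on \<open>n\<close> vertices; there the procedures are
  unconstrained, so this costs no generality.\<close>

definition randomized_ds :: "nat \<Rightarrow> nat \<Rightarrow> data_structure measure \<Rightarrow> bool" where
  "randomized_ds n w R \<longleftrightarrow> prob_space R \<and>
     (\<forall>D\<in>space R. cell_probe_ds n w D) \<and>
     (\<forall>ops. (\<lambda>D. run D ops) \<in> R \<rightarrow>\<^sub>M count_space UNIV)"

text \<open>The input is drawn independently of the randomness of the data structure.\<close>

definition success_prob ::
    "nat \<Rightarrow> real \<Rightarrow> real \<Rightarrow> operation list pmf \<Rightarrow> data_structure measure \<Rightarrow> real" where
  "success_prob n \<epsilon> \<delta> I R =
     measure (measure_pmf I \<Otimes>\<^sub>M R) {(ops, D). D \<in> space R \<and> succeeds n \<epsilon> \<delta> ops D}"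

lemma success_event_measurable:
  assumes "randomized_ds n w R"
  shows "{(ops, D). D \<in> space R \<and> succeeds n \<epsilon> \<delta> ops D} \<in> sets (measure_pmf I \<Otimes>\<^sub>M R)"
proof -
  let ?S = "\<lambda>ops. {D \<in> space R. succeeds n \<epsilon> \<delta> ops D}"
  have S: "?S ops \<in> sets R" for ops
  proof -
    have "(\<lambda>D. run D ops) \<in> R \<rightarrow>\<^sub>M count_space UNIV"
      using assms by (simp add: randomized_ds_def)
    from measurable_sets[OF this, of "{(bs, s).
        real (card (correct_positions ops bs)) \<ge> (1 / 2 + \<delta>) * real (card (query_positions ops)) \<and>
        real s \<le> \<epsilon> * real n * log 2 (real n)}"]
    show ?thesis
      by (simp add: succeeds_def vimage_def Int_def conj_commute case_prod_beta)
  qed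
  have "countable (UNIV :: operation list set)"
  proof -
    have "range (case_sum (case_prod Insert) (case_sum (case_prod Delete) (case_prod Query))) = UNIV"
    proof -
      have "x \<in> range (case_sum (case_prod Insert)
          (case_sum (case_prod Delete) (case_prod Query)))" for x
      proof (cases x)
        case (Insert u v)
        then show ?thesis by (intro image_eqI[of _ _ "Inl (u, v)"]) auto
      next
        case (Delete u v)
        then show ?thesis by (intro image_eqI[of _ _ "Inr (Inl (u, v))"]) auto
      next
        case (Query u v)
        then show ?thesis by (intro image_eqI[of _ _ "Inr (Inr (u, v))"]) auto
      qed
      then show ?thesis by blast
    qed
    then have "countable (UNIV :: operation set)"
      by (metis countable_image countableI_type)
    then have "countable (lists (UNIV :: operation set))"
      by (rule countable_lists)
    then show ?thesis by simp
  qed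
  then have "(\<Union>ops\<in>UNIV. {ops} \<times> ?S ops) \<in> sets (measure_pmf I \<Otimes>\<^sub>M R)"
    by (intro sets.countable_UN'' pair_measureI S) auto
  also have "(\<Union>ops\<in>UNIV. {ops} \<times> ?S ops) = {(ops, D). D \<in> space R \<and> succeeds n \<epsilon> \<delta> ops D}"
    by auto
  finally show ?thesis .
qed

end

theory Submission
  imports Defs "HOL-Combinatorics.Permutations" "HOL-Real_Asymp.Real_Asymp"
begin

text \<open>Take a grid of \<open>2 ^ L + 1\<close> columns of \<open>2 ^ L\<close> vertices in which consecutive columns are joined by
  permutations, initially the identity, and the last column carries a path. At each of \<open>2 ^ L\<close> times
  one permutation, chosen in bit-reversed order, is replaced by a random one, and then for each vertex
  of its left column the path edge below a cutpoint is removed, the vertex is tested for connection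
  to the start of the path, and the edge is put back. The cutpoint is chosen such that the
  answer is a random bit of the position \<open>y\<close> in which the vertex reaches the last column, while the
  cutpoint reveals the higher bits only.

  Consider a node of the binary tree over the times. Given everything else, the permutations of its
  left half are determined by the positions \<open>y\<close> queried in its right half. If the right half reads only few
  cells changed in the left half, most queries are answered as if the left half had changed
  nothing, hence from the higher bits of \<open>y\<close> alone, so that an advantage is only possible if \<open>y\<close> is far from
  uniform given what has been seen. This is made quantitative by a potential: for a
  set \<open>S\<close> of left halves that are consistent with what has been seen so far, the sum over \<open>S\<close> of the
  expected weight \<open>(1 + \<eta>) ^ correct * u ^ reads\<close> is bounded by a constant times
  \<open>card S powr (1 - 1 / L)\<close>. Both the splitting of \<open>S\<close> by a read and its splitting by \<open>y\<close> are
  instances of Hoelder's inequality. A read is charged at a single level of the tree, so a total of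
  \<open>\<epsilon> n log n\<close> probes means \<open>O(\<epsilon> n)\<close> reads at an average level, and Markov's inequality for the weights gives the theorem.\<close>

section \<open>Hoelder's inequality and prediction of bits\<close>

text \<open>The exponent \<open>1 - 1 / L\<close> reflects that a position \<open>y\<close> carries
  \<open>L\<close> bits of which a query asks for one. At first log2 (card S) is about
  \<open>L\<close> times the number of queries in the right half, so the missing
  \<open>card S powr (1 / L)\<close> is a factor 2 per query and turns 1 + exp \<eta> into (1 + exp
  \<eta>) / 2, the value for a fair coin. More than this has to be paid for by a shrinking
  \<open>S\<close>. A read that yields fresh content shrinks \<open>S\<close> by a factor of up to
  \<open>2 ^ w\<close>, worth \<open>2 powr (w / L)\<close>; for \<open>w = O(log n)\<close> this is
  a constant, so a read can help only O(1) queries.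

  The obstacle is that finding a cell unchanged is information as well. Such reads cannot be charged
  like the others, as the same read would then be charged in full at every level. They cost only
  \<open>2 powr (1 / L)\<close>, which over all \<open>L\<close> levels is again a constant.

  Bit reversal makes one sequence of updates hard at all levels simultaneously: in every node,
  before each column of the left half comes one of the right half, so that the queries there can
  single out each left permutation.\<close>

lemma Holder_sum_powr:
  fixes H s :: "'i \<Rightarrow> real"
  assumes fin: "finite I" and L: "0 < L"
    and H: "\<And>i. i \<in> I \<Longrightarrow> 0 \<le> H i" and s: "\<And>i. i \<in> I \<Longrightarrow> 0 \<le> s i"
    and B: "0 \<le> B" "(\<Sum>i\<in>I. H i ^ L) \<le> B ^ L"
  shows "(\<Sum>i\<in>I. H i * s i powr (1 - 1 / real L)) \<le> B * (\<Sum>i\<in>I. s i) powr (1 - 1 / real L)"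
proof -
  define \<beta> where "\<beta> = 1 - 1 / real L"
  define S where "S = (\<Sum>i\<in>I. s i)"
  have \<beta>: "0 \<le> \<beta>" "1 / real L + \<beta> = 1"
    using L by (auto simp: \<beta>_def)
  have S0: "0 \<le> S" unfolding S_def by (intro sum_nonneg s)
  have HB: "H i ^ L \<le> B ^ L" if "i \<in> I" for i
  proof -
    have "H i ^ L \<le> (\<Sum>i\<in>I. H i ^ L)"
      by (rule member_le_sum) (use that fin H in auto)
    with B show ?thesis by simp
  qed
  show ?thesis
  proof (cases "B = 0 \<or> S = 0")
    case True
    have "H i * s i powr \<beta> = 0" if i: "i \<in> I" for i
    proof (cases "B = 0")
      case True
      have "H i ^ L \<le> 0" using HB[OF i] True L by (simp add: power_0_left)
      then have "H i ^ L = 0" using H[OF i] by (intro antisym) auto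
      then show ?thesis by simp
    next
      case False
      with True have "S = 0" by simp
      then have "s i = 0" using sum_nonneg_eq_0_iff[OF fin, of s] s i unfolding S_def by blast
      \<comment> \<open>\<open>0 powr 0 = 0\<close>, so this covers \<open>L = 1\<close> as well,
        where the exponent \<beta> is 0.\<close>
      then show ?thesis by simp
    qed
    then have "(\<Sum>i\<in>I. H i * s i powr \<beta>) = 0" by (intro sum.neutral) blast
    then show ?thesis using B(1) unfolding \<beta>_def by simp
  next
    case False
    then have Bp: "0 < B" and Sp: "0 < S" using B(1) S0 by auto
    \<comment> \<open>Young's inequality with the weights 1 / L and \<beta>, after division by the
      totals \<open>B ^ L\<close> and \<open>S\<close>; the two normalised sums are then at most
      1.\<close>
    have young: "H i * s i powr \<beta> \<le> B * S powr \<beta> * (1 / real L * (H i ^ L / B ^ L) + \<beta> * (s i / S))"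
      if i: "i \<in> I" for i
    proof (cases "H i = 0 \<or> s i = 0")
      case True
      have "0 \<le> B * S powr \<beta> * (1 / real L * (H i ^ L / B ^ L) + \<beta> * (s i / S))"
        using Bp Sp \<beta> H[OF i] s[OF i] by (intro mult_nonneg_nonneg add_nonneg_nonneg) auto
      then show ?thesis using True by auto
    next
      case False
      then have p: "0 < H i" "0 < s i" using H[OF i] s[OF i] by auto
      have "(H i ^ L / B ^ L) powr (1 / real L) * (s i / S) powr \<beta>
          \<le> 1 / real L * (H i ^ L / B ^ L) + \<beta> * (s i / S)"
        by (rule Youngs_inequality_0) (use \<beta> p Bp Sp in auto)
      moreover have "(H i ^ L / B ^ L) powr (1 / real L) = H i / B"
      proof -
        have "(H i ^ L / B ^ L) powr (1 / real L) = ((H i / B) powr real L) powr (1 / real L)"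
          using p Bp by (simp add: powr_realpow power_divide)
        also have "\<dots> = H i / B" using p Bp L by (simp add: powr_powr)
        finally show ?thesis .
      qed
      moreover have "(s i / S) powr \<beta> = s i powr \<beta> / S powr \<beta>"
        using p Sp by (simp add: powr_divide)
      ultimately have "H i / B * (s i powr \<beta> / S powr \<beta>)
          \<le> 1 / real L * (H i ^ L / B ^ L) + \<beta> * (s i / S)" by simp
      then have "B * S powr \<beta> * (H i / B * (s i powr \<beta> / S powr \<beta>))
          \<le> B * S powr \<beta> * (1 / real L * (H i ^ L / B ^ L) + \<beta> * (s i / S))"
        by (intro mult_left_mono) (use Bp Sp in auto)
      then show ?thesis using Bp Sp by simp
    qed
    have "(\<Sum>i\<in>I. H i * s i powr \<beta>)
        \<le> (\<Sum>i\<in>I. B * S powr \<beta> * (1 / real L * (H i ^ L / B ^ L) + \<beta> * (s i / S)))"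
      by (intro sum_mono young)
    also have "\<dots> = B * S powr \<beta> * (1 / real L * ((\<Sum>i\<in>I. H i ^ L) / B ^ L) + \<beta> * ((\<Sum>i\<in>I. s i) / S))"
      by (simp only: sum_distrib_left[symmetric] sum.distrib sum_divide_distrib[symmetric])
    also have "\<dots> \<le> B * S powr \<beta> * (1 / real L * 1 + \<beta> * 1)"
      using B(2) Bp Sp \<beta> L
      by (intro mult_left_mono add_mono) (auto simp: S_def[symmetric])
    also have "\<dots> = B * S powr \<beta>" using \<beta>(2) by simp
    finally show ?thesis unfolding \<beta>_def S_def .
  qed
qed

text \<open>Midpoint of the dyadic interval of length \<open>2 ^ Suc e\<close> around \<open>y\<close>: comparing \<open>y\<close> with it reads
  bit \<open>e\<close> of \<open>y\<close>, while the midpoint itself only reveals the higher bits.\<close>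

definition cutpoint :: "nat \<Rightarrow> nat \<Rightarrow> nat" where
  "cutpoint e y = (y div 2 ^ Suc e) * 2 ^ Suc e + 2 ^ e"

lemma cutpoint_pos: "0 < cutpoint e y"
  by (simp add: cutpoint_def)

lemma cutpoint_less:
  assumes "e < L" "y < 2 ^ L"
  shows "cutpoint e y < 2 ^ L"
proof -
  have "(2::nat) ^ L = 2 ^ (L - Suc e) * 2 ^ Suc e"
    using assms(1) by (simp del: power_Suc flip: power_add)
  then have "y div 2 ^ Suc e < 2 ^ (L - Suc e)"
    using assms(2) by (simp add: less_mult_imp_div_less)
  then have "Suc (y div 2 ^ Suc e) * 2 ^ Suc e \<le> 2 ^ (L - Suc e) * 2 ^ Suc e"
    by (intro mult_right_mono) auto
  moreover have "(2::nat) ^ e < 2 ^ Suc e" by simp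
  ultimately show ?thesis
    using \<open>2 ^ L = _\<close> unfolding cutpoint_def by (simp only: mult_Suc)
qed

text \<open>All \<open>y\<close> in an aligned block of length \<open>2 ^ Suc L\<close> share the
  middle of the block as their topmost cutpoint, so the guess there is right on exactly one half,
  and both halves are again aligned blocks. The number of right guesses is therefore binomially
  distributed with parameter 1/2 for every \<open>g\<close>.\<close>

lemma sum_exp_prediction:
  fixes \<eta> :: real and g :: "nat \<Rightarrow> bool"
  assumes "2 ^ L dvd A"
  shows "(\<Sum>y<2 ^ L. exp (\<eta> * real (card {e. e < L \<and>
            g (cutpoint e (A + y)) = (A + y < cutpoint e (A + y))}))) = (1 + exp \<eta>) ^ L"
  using assms
proof (induction L arbitrary: A)
  case 0
  then show ?case by simp
next
  case (Suc L)
  let ?P = "\<lambda>y e. g (cutpoint e y) = (y < cutpoint e y)"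
  from Suc.prems have dvd: "2 ^ L dvd A" "2 ^ L dvd A + 2 ^ L"
    by (auto intro: dvd_trans[of _ "2 ^ Suc L"])
  have cut: "cutpoint L (A + y) = A + 2 ^ L" if "y < 2 ^ Suc L" for y
    using that Suc.prems by (auto simp: cutpoint_def elim!: dvdE)
  have card_split: "exp (\<eta> * real (card {e. e < Suc L \<and> ?P y e}))
      = exp (\<eta> * of_bool (?P y L)) * exp (\<eta> * real (card {e. e < L \<and> ?P y e}))" for y
  proof -
    have eq: "{e. e < Suc L \<and> ?P y e} = (if ?P y L then {L} else {}) \<union> {e. e < L \<and> ?P y e}"
      by (auto simp: less_Suc_eq)
    have "real (card {e. e < Suc L \<and> ?P y e}) = of_bool (?P y L) + real (card {e. e < L \<and> ?P y e})"
      unfolding eq by (subst card_Un_disjoint) auto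
    then show ?thesis by (simp add: distrib_left exp_add)
  qed
  have lo: "(\<Sum>y<2 ^ L. exp (\<eta> * real (card {e. e < Suc L \<and> ?P (A + y) e})))
      = exp (\<eta> * of_bool (g (A + 2 ^ L))) * (1 + exp \<eta>) ^ L"
  proof -
    have "?P (A + y) L = g (A + 2 ^ L)" if "y < 2 ^ L" for y
      using that cut[of y] by simp
    then show ?thesis
      unfolding card_split using Suc.IH[OF dvd(1)]
      by (simp add: sum_distrib_left[symmetric])
  qed
  have hi: "(\<Sum>y<2 ^ L. exp (\<eta> * real (card {e. e < Suc L \<and> ?P (A + 2 ^ L + y) e})))
      = exp (\<eta> * of_bool (\<not> g (A + 2 ^ L))) * (1 + exp \<eta>) ^ L"
  proof -
    have "?P (A + 2 ^ L + y) L = (\<not> g (A + 2 ^ L))" if "y < 2 ^ L" for y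
      using that cut[of "2 ^ L + y"] by (simp add: add.assoc)
    then show ?thesis
      unfolding card_split using Suc.IH[OF dvd(2)]
      by (simp add: sum_distrib_left[symmetric])
  qed
  have "(\<Sum>y<2 ^ Suc L. f y) = (\<Sum>y<2 ^ L. f y) + (\<Sum>y<2 ^ L. f (2 ^ L + y))" for f :: "nat \<Rightarrow> real"
  proof -
    have eq: "{..<2 ^ Suc L} = {..<2 ^ L} \<union> (\<lambda>y. 2 ^ L + y) ` {..<(2::nat) ^ L}"
    proof -
      have "x \<in> (\<lambda>y. 2 ^ L + y) ` {..<(2::nat) ^ L}" if "x < 2 * 2 ^ L" "\<not> x < 2 ^ L" for x
        using that by (intro image_eqI[of _ _ "x - 2 ^ L"]) auto
      then show ?thesis by auto
    qed
    show ?thesis unfolding eq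
      by (subst sum.union_disjoint) (auto simp: sum.reindex inj_on_def)
  qed
  from this[of "\<lambda>y. exp (\<eta> * real (card {e. e < Suc L \<and> ?P (A + y) e}))"]
  show ?case using lo hi by (cases "g (A + 2 ^ L)") (auto simp: algebra_simps)
qed

text \<open>A guess of bit \<open>e\<close> of \<open>y\<close> from the higher bits of \<open>y\<close>. The \<open>L\<close>-th power is the one that
  Hoelder's inequality with exponent \<open>1 - 1 / L\<close> asks for.\<close>

lemma sum_prediction:
  fixes \<eta> :: real and g :: "nat \<Rightarrow> bool"
  assumes L: "0 < L" and \<eta>: "0 \<le> \<eta>"
  shows "(\<Sum>y<2 ^ L. (\<Sum>e<L. if g (cutpoint e y) = (y < cutpoint e y) then 1 + \<eta> else 1) ^ L)
    \<le> (real L * (1 + exp \<eta>)) ^ L"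
proof -
  define K where "K y = real (card {e. e < L \<and> g (cutpoint e y) = (y < cutpoint e y)})" for y
  have "(\<Sum>e<L. if g (cutpoint e y) = (y < cutpoint e y) then 1 + \<eta> else 1) = real L + \<eta> * K y" for y
  proof -
    have "(\<Sum>e<L. if g (cutpoint e y) = (y < cutpoint e y) then 1 + \<eta> else 1)
        = (\<Sum>e<L. 1 + (if g (cutpoint e y) = (y < cutpoint e y) then \<eta> else 0))"
      by (intro sum.cong) auto
    also have "\<dots> = real L + (\<Sum>e\<in>{e. e < L \<and> g (cutpoint e y) = (y < cutpoint e y)}. \<eta>)"
      unfolding sum.distrib by (subst (2) sum.mono_neutral_cong_right[where S="{e. e < L \<and> g (cutpoint e y) = (y < cutpoint e y)}" and h="\<lambda>_. \<eta>"]) auto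
    finally show ?thesis by (simp add: K_def)
  qed
  \<comment> \<open>By \<open>1 + x \<le> exp x\<close>; this reduces the \<open>L\<close>-th power
    to the exponential moment of the number of right guesses, which is known exactly.\<close>
  moreover have "(real L + \<eta> * K y) ^ L \<le> real L ^ L * exp (\<eta> * K y)" for y
  proof -
    have K0: "0 \<le> K y" by (simp add: K_def)
    have "real L + \<eta> * K y = real L * (1 + \<eta> * K y / real L)"
      using L by (simp add: field_simps)
    also have "\<dots> \<le> real L * exp (\<eta> * K y / real L)"
      by (intro mult_left_mono exp_ge_add_one_self) auto
    finally have "(real L + \<eta> * K y) ^ L \<le> (real L * exp (\<eta> * K y / real L)) ^ L"
      by (intro power_mono add_nonneg_nonneg mult_nonneg_nonneg \<eta> K0) auto
    also have "\<dots> = real L ^ L * exp (\<eta> * K y)"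
      using L by (simp add: power_mult_distrib exp_of_nat_mult[symmetric])
    finally show ?thesis .
  qed
  ultimately have "(\<Sum>y<2 ^ L. (\<Sum>e<L. if g (cutpoint e y) = (y < cutpoint e y) then 1 + \<eta> else 1) ^ L)
      \<le> (\<Sum>y<2 ^ L. real L ^ L * exp (\<eta> * K y))"
    by (simp add: sum_mono)
  also have "\<dots> = (real L * (1 + exp \<eta>)) ^ L"
    using sum_exp_prediction[of L 0 \<eta> g]
    by (simp add: sum_distrib_left[symmetric] K_def power_mult_distrib)
  finally show ?thesis .
qed

section \<open>Stamped memory and the game at a node\<close>

text \<open>Every cell carries the time of its last write next to its content.\<close>

type_synonym stamped = "nat \<Rightarrow> nat \<times> nat"

primrec answer :: "probe_tree \<Rightarrow> stamped \<Rightarrow> nat \<Rightarrow> bool" where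
  "answer (Return b) s \<tau> = b"
| "answer (Read a k) s \<tau> = answer (k (fst (s a))) s \<tau>"
| "answer (Write a x t) s \<tau> = answer t (s(a := (x, \<tau>))) \<tau>"

primrec post :: "probe_tree \<Rightarrow> stamped \<Rightarrow> nat \<Rightarrow> stamped" where
  "post (Return b) s \<tau> = s"
| "post (Read a k) s \<tau> = post (k (fst (s a))) s \<tau>"
| "post (Write a x t) s \<tau> = post t (s(a := (x, \<tau>))) \<tau>"

text \<open>\<open>\<rho> \<tau> x\<close> is the factor charged at time \<tau> for reading a cell
  whose last write has the stamp \<open>x\<close>. Writes carry no factor, since they tell the data
  structure nothing new.\<close>

primrec weight :: "(nat \<Rightarrow> nat \<Rightarrow> real) \<Rightarrow> probe_tree \<Rightarrow> stamped \<Rightarrow> nat \<Rightarrow> real" where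
  "weight \<rho> (Return b) s \<tau> = 1"
| "weight \<rho> (Read a k) s \<tau> = \<rho> \<tau> (snd (s a)) * weight \<rho> (k (fst (s a))) s \<tau>"
| "weight \<rho> (Write a x t) s \<tau> = weight \<rho> t (s(a := (x, \<tau>))) \<tau>"

lemma exec_stamped:
  "answer t s \<tau> = fst (exec t (fst \<circ> s))" "fst \<circ> post t s \<tau> = fst (snd (exec t (fst \<circ> s)))"
proof (induction t arbitrary: s)
  case (Write a x t)
  have eq: "fst \<circ> s(a := (x, \<tau>)) = (fst \<circ> s)(a := x)" for s :: stamped by auto
  {
    case 1
    show ?case using Write.IH(1)[of "s(a := (x, \<tau>))"] unfolding eq
      by (simp only: exec.simps answer.simps post.simps case_prod_beta fst_conv snd_conv)
  next
    case 2
    show ?case using Write.IH(2)[of "s(a := (x, \<tau>))"] unfolding eq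
      by (simp only: exec.simps answer.simps post.simps case_prod_beta fst_conv snd_conv)
  }
qed (auto split: prod.splits)

lemma weight_nonneg: "(\<And>x. 0 \<le> \<rho> \<tau> x) \<Longrightarrow> 0 \<le> weight \<rho> t s \<tau>"
  by (induction t arbitrary: s) auto

lemma weight_le_1:
  "(\<And>x. 0 \<le> \<rho> \<tau> x) \<Longrightarrow> (\<And>x. \<rho> \<tau> x \<le> 1) \<Longrightarrow> weight \<rho> t s \<tau> \<le> 1"
  by (induction t arbitrary: s) (simp_all add: mult_le_one weight_nonneg)

definition word_memory :: "nat \<Rightarrow> memory \<Rightarrow> bool" where
  "word_memory w m \<longleftrightarrow> (\<forall>a<2 ^ w. m a < 2 ^ w)"

lemma word_memory_post:
  "word_bounded w t \<Longrightarrow> word_memory w (fst \<circ> s) \<Longrightarrow> word_memory w (fst \<circ> post t s \<tau>)"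
proof (induction t arbitrary: s)
  case (Write a x t)
  have "word_memory w (fst \<circ> s(a := (x, \<tau>)))"
    using Write.prems by (auto simp: word_memory_def)
  with Write.IH[of "s(a := (x, \<tau>))"] Write.prems(1) show ?case
    by (simp del: fun_upd_apply o_apply)
qed (auto simp: word_memory_def)

lemma post_stamp: "post t s \<tau> a = s a \<or> snd (post t s \<tau> a) = \<tau>"
proof (induction t arbitrary: s)
  case (Write b x t)
  have "(s(b := (x, \<tau>))) a = s a \<or> snd ((s(b := (x, \<tau>))) a) = \<tau>" by simp
  with Write.IH[of "s(b := (x, \<tau>))"] show ?case by (metis post.simps(3))
qed auto

text \<open>Joins several operations to one move of the game, such as a whole block of updates or a
  cut with its query. Nothing but the memory passes from the first tree to the second, and the bit
  returned is that of the second.\<close>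

primrec bind_tree :: "probe_tree \<Rightarrow> probe_tree \<Rightarrow> probe_tree" where
  "bind_tree (Return b) u = u"
| "bind_tree (Read a k) u = Read a (\<lambda>x. bind_tree (k x) u)"
| "bind_tree (Write a x t) u = Write a x (bind_tree t u)"

lemma exec_bind_tree:
  "exec (bind_tree t u) m = (case exec t m of (b, m', i) \<Rightarrow> case exec u m' of (b', m'', j) \<Rightarrow> (b', m'', i + j))"
  by (induction t arbitrary: m) (auto split: prod.splits)

lemma word_bounded_bind_tree:
  "word_bounded w t \<Longrightarrow> word_bounded w u \<Longrightarrow> word_bounded w (bind_tree t u)"
  by (induction t) auto

text \<open>In the game, \<open>P\<close> records at which vertices the positions \<open>y\<close>
  already agree on all of \<open>S\<close>; this has to survive every further splitting of
  \<open>S\<close>.\<close>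

definition hereditary :: "('a set \<Rightarrow> bool) \<Rightarrow> bool" where
  "hereditary P \<longleftrightarrow> (\<forall>S T. P S \<longrightarrow> T \<subseteq> S \<longrightarrow> P T)"

lemma hereditaryD: "hereditary P \<Longrightarrow> P S \<Longrightarrow> T \<subseteq> S \<Longrightarrow> P T"
  by (simp add: hereditary_def)

text \<open>The game at one node of the time tree. Alice's input \<open>\<alpha>\<close> (the left half) determines the memory
  \<open>base \<alpha>\<close> at the start of the right half; \<open>stale\<close> is the memory before the left half. Each read
  costs a factor \<open>2 powr (- 1 / L)\<close>, and one of a cell that Alice changed a further factor
  \<open>2 powr (- w / L) / (1 + \<eta>)\<close>.\<close>

locale game =
  fixes L w :: nat and \<eta> :: real and \<rho> :: "nat \<Rightarrow> nat \<Rightarrow> real" and times :: "nat set"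
    and U :: "'a set" and base :: "'a \<Rightarrow> stamped" and stale :: memory
  assumes L: "0 < L" and \<eta>: "0 \<le> \<eta>" and finite_U: "finite U"
    and \<rho>_nonneg: "\<And>\<tau> x. 0 \<le> \<rho> \<tau> x"
    and \<rho>_le: "\<And>\<tau> x. \<rho> \<tau> x \<le> 2 powr (- (1 / real L))"
    and \<rho>_hit: "\<And>\<alpha> a \<tau>. \<alpha> \<in> U \<Longrightarrow> fst (base \<alpha> a) \<noteq> stale a \<Longrightarrow> \<tau> \<in> times \<Longrightarrow>
      \<rho> \<tau> (snd (base \<alpha> a)) \<le> 2 powr (- (1 / real L)) * (2 powr (- (real w / real L)) / (1 + \<eta>))"
begin

definition size_of :: "'a set \<Rightarrow> real" where
  "size_of S = real (card S) powr (1 - 1 / real L)"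

text \<open>\<open>S\<close> is the set of Alice's inputs that are still possible for Bob, \<open>K\<close> the set of cells whose
  content he knows, and \<open>\<mu>\<close> the memory as it would be if Alice had changed no other cell.\<close>

definition consistent :: "'a set \<Rightarrow> ('a \<Rightarrow> stamped) \<Rightarrow> nat set \<Rightarrow> memory \<Rightarrow> bool" where
  "consistent S s K \<mu> \<longleftrightarrow> S \<subseteq> U \<and> (\<forall>a. a \<notin> K \<longrightarrow> \<mu> a = stale a) \<and>
     (\<forall>\<alpha>\<in>S. word_memory w (fst \<circ> s \<alpha>) \<and>
        (\<forall>a. if a \<in> K then fst (s \<alpha> a) = \<mu> a else s \<alpha> a = base \<alpha> a))"

text \<open>\<open>F\<close> is the weight of the remaining game as a function of the input and the
  memory. Since the bound holds for all \<open>s\<close>, \<open>K\<close> and \<mu> at once, moves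
  can be put in front of \<open>F\<close> one by one, and a branch of a read may go on with another
  \<mu>.\<close>

definition bounded_by :: "('a set \<Rightarrow> bool) \<Rightarrow> real \<Rightarrow> ('a \<Rightarrow> stamped \<Rightarrow> real) \<Rightarrow> bool" where
  "bounded_by P c F \<longleftrightarrow> (\<forall>\<alpha> s. 0 \<le> F \<alpha> s) \<and>
     (\<forall>S s K \<mu>. P S \<longrightarrow> consistent S s K \<mu> \<longrightarrow> (\<Sum>\<alpha>\<in>S. F \<alpha> (s \<alpha>)) \<le> c * size_of S)"

lemma bounded_byD:
  "bounded_by P c F \<Longrightarrow> P S \<Longrightarrow> consistent S s K \<mu> \<Longrightarrow> (\<Sum>\<alpha>\<in>S. F \<alpha> (s \<alpha>)) \<le> c * size_of S"
  unfolding bounded_by_def by blast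

lemma bounded_by_nonneg: "bounded_by P c F \<Longrightarrow> 0 \<le> F \<alpha> s"
  unfolding bounded_by_def by blast

lemma \<rho>_le_1: "\<rho> \<tau> x \<le> 1"
proof -
  have "2 powr (- (1 / real L)) \<le> (2::real) powr 0" by (intro powr_mono) auto
  then show ?thesis using \<rho>_le[of \<tau> x] by simp
qed

lemma size_of_nonneg: "0 \<le> size_of S"
  by (simp add: size_of_def)

lemma consistent_subset: "consistent S s K \<mu> \<Longrightarrow> T \<subseteq> S \<Longrightarrow> consistent T s K \<mu>"
  unfolding consistent_def by blast

lemma consistent_reveal:
  assumes "consistent S s K \<mu>" "T \<subseteq> S" "\<And>\<alpha>. \<alpha> \<in> T \<Longrightarrow> fst (s \<alpha> a) = v"
  shows "consistent T s (insert a K) (\<mu>(a := v))"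
  unfolding consistent_def
proof (intro conjI allI impI ballI)
  show "T \<subseteq> U" using assms unfolding consistent_def by blast
  show "(\<mu>(a := v)) b = stale b" if "b \<notin> insert a K" for b
    using assms(1) that unfolding consistent_def by simp
  fix \<alpha> assume \<alpha>: "\<alpha> \<in> T"
  then have \<alpha>S: "\<alpha> \<in> S" using assms(2) by blast
  then show "word_memory w (fst \<circ> s \<alpha>)" using assms(1) unfolding consistent_def by blast
  fix b
  have "if b \<in> K then fst (s \<alpha> b) = \<mu> b else s \<alpha> b = base \<alpha> b"
    using assms(1) \<alpha>S unfolding consistent_def by blast
  then show "if b \<in> insert a K then fst (s \<alpha> b) = (\<mu>(a := v)) b else s \<alpha> b = base \<alpha> b"
    using assms(3)[OF \<alpha>] by (cases "b = a") simp_all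
qed

text \<open>A read outside \<open>K\<close> splits \<open>S\<close> by the content found. The branch in which the content is the stale
  one keeps following the run on \<open>\<mu>\<close>; in all others even a free correct answer (a factor
  \<open>1 + \<eta>\<close>) is paid for by the cost of the read.\<close>

lemma tree_bound:
  assumes "hereditary P"
    and F: "\<And>b. bounded_by P (c b) (F b)"
    and c: "\<And>b. 0 \<le> c b" "\<And>b b'. c b \<le> (1 + \<eta>) * c b'"
    and \<tau>: "\<tau> \<in> times"
  shows "word_bounded w t \<Longrightarrow> P S \<Longrightarrow> consistent S s K \<mu> \<Longrightarrow>
    (\<Sum>\<alpha>\<in>S. weight \<rho> t (s \<alpha>) \<tau> * F (answer t (s \<alpha>) \<tau>) \<alpha> (post t (s \<alpha>) \<tau>))
      \<le> c (fst (exec t \<mu>)) * size_of S"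
proof (induction t arbitrary: S s K \<mu>)
  case (Return b)
  then show ?case using bounded_byD[OF F] by simp
next
  case (Write a x t)
  \<comment> \<open>All inputs in \<open>S\<close> follow the same tree, so Bob knows what is
    written; the write puts the cell into \<open>K\<close> without splitting
    \<open>S\<close>.\<close>
  have "consistent S (\<lambda>\<alpha>. (s \<alpha>)(a := (x, \<tau>))) (insert a K) (\<mu>(a := x))"
    using Write.prems unfolding consistent_def word_memory_def by auto
  from Write.IH[OF _ Write.prems(2) this] Write.prems(1)
  show ?case
    by (simp only: exec.simps weight.simps answer.simps post.simps word_bounded.simps case_prod_beta fst_conv)
next
  case (Read a k)
  define G where "G \<alpha> v = weight \<rho> (k v) (s \<alpha>) \<tau> * F (answer (k v) (s \<alpha>) \<tau>) \<alpha> (post (k v) (s \<alpha>) \<tau>)" for \<alpha> v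
  have G0: "0 \<le> G \<alpha> v" for \<alpha> v
    unfolding G_def by (intro mult_nonneg_nonneg weight_nonneg \<rho>_nonneg bounded_by_nonneg[OF F])
  have finS: "finite S" using Read.prems(3) finite_U finite_subset unfolding consistent_def by blast
  have a: "a < 2 ^ w" using Read.prems(1) by simp
  have val: "fst (s \<alpha> a) < 2 ^ w" if "\<alpha> \<in> S" for \<alpha>
    using Read.prems(3) that a unfolding consistent_def word_memory_def by auto
  have eq: "(\<Sum>\<alpha>\<in>S. weight \<rho> (Read a k) (s \<alpha>) \<tau> * F (answer (Read a k) (s \<alpha>) \<tau>) \<alpha> (post (Read a k) (s \<alpha>) \<tau>))
      = (\<Sum>\<alpha>\<in>S. \<rho> \<tau> (snd (s \<alpha> a)) * G \<alpha> (fst (s \<alpha> a)))"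
    by (simp add: G_def mult.assoc)
  have b: "fst (exec (Read a k) \<mu>) = fst (exec (k (\<mu> a)) \<mu>)"
    by (auto split: prod.splits)
  show ?case
  proof (cases "a \<in> K")
    case True
    then have \<mu>: "fst (s \<alpha> a) = \<mu> a" if "\<alpha> \<in> S" for \<alpha>
      using Read.prems(3) that unfolding consistent_def by metis
    have "(\<Sum>\<alpha>\<in>S. \<rho> \<tau> (snd (s \<alpha> a)) * G \<alpha> (fst (s \<alpha> a))) \<le> (\<Sum>\<alpha>\<in>S. G \<alpha> (\<mu> a))"
      using G0 \<rho>_le_1 \<mu> by (intro sum_mono) (simp add: \<rho>_nonneg mult_left_le_one_le)
    also have "\<dots> \<le> c (fst (exec (k (\<mu> a)) \<mu>)) * size_of S"
    \<comment> \<open>\<open>word_bounded\<close> speaks about \<open>k (\<mu> a)\<close> only if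
      \<open>\<mu> a\<close> is a word, and this is known from a member of \<open>S\<close> that
      reads it.\<close>
    proof (cases "S = {}")
      case False
      then have "\<mu> a < 2 ^ w" using \<mu> val by fastforce
      then show ?thesis unfolding G_def using Read.prems by (intro Read.IH[of _ S s K \<mu>]) auto
    qed (simp add: size_of_def)
    finally show ?thesis unfolding eq b .
  next
    case False
    define \<kappa> :: real where "\<kappa> = 2 powr (- (1 / real L))"
    define u :: real where "u = 2 powr (- (real w / real L))"
    define S' where "S' v = {\<alpha> \<in> S. fst (s \<alpha> a) = v}" for v
    \<comment> \<open>The stale content is inserted because \<open>stale\<close> is an arbitrary
      function; the contents found by members of \<open>S\<close> are words.\<close>
    define V where "V = insert (\<mu> a) {..<2 ^ w}"
    define c0 where "c0 = c (fst (exec (k (\<mu> a)) \<mu>))"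
    have c0: "0 \<le> c0" unfolding c0_def by (rule c)
    have \<mu>a: "\<mu> a = stale a" using False Read.prems(3) unfolding consistent_def by blast
    have sb: "s \<alpha> a = base \<alpha> a" if "\<alpha> \<in> S" for \<alpha>
      using Read.prems(3) that False unfolding consistent_def by metis
    have P': "P (S' v)" for v
      by (rule hereditaryD[OF assms(1) Read.prems(2)]) (auto simp: S'_def)
    have cons: "consistent (S' v) s (insert a K) (\<mu>(a := v))" for v
      by (rule consistent_reveal[OF Read.prems(3)]) (auto simp: S'_def)
    have part: "(\<Sum>\<alpha>\<in>S' v. \<rho> \<tau> (snd (s \<alpha> a)) * G \<alpha> (fst (s \<alpha> a)))
        \<le> \<kappa> * c0 * ((if v = \<mu> a then 1 else u) * size_of (S' v))" if v: "v \<in> V" for v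
    proof (cases "S' v = {}")
      case True
      then show ?thesis by (simp add: size_of_def)
    next
      case ne: False
      then have v2: "v < 2 ^ w" using val unfolding S'_def by auto
      have IH: "(\<Sum>\<alpha>\<in>S' v. G \<alpha> v) \<le> c (fst (exec (k v) (\<mu>(a := v)))) * size_of (S' v)"
        unfolding G_def using Read.prems(1) v2 by (intro Read.IH[OF _ _ P' cons]) auto
      show ?thesis
      proof (cases "v = \<mu> a")
        case True
        then have "\<mu>(a := v) = \<mu>" by simp
        with IH True have IH': "(\<Sum>\<alpha>\<in>S' v. G \<alpha> v) \<le> c0 * size_of (S' v)" by (simp add: c0_def)
        have "(\<Sum>\<alpha>\<in>S' v. \<rho> \<tau> (snd (s \<alpha> a)) * G \<alpha> (fst (s \<alpha> a))) \<le> (\<Sum>\<alpha>\<in>S' v. \<kappa> * G \<alpha> v)"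
          unfolding \<kappa>_def S'_def using G0 \<rho>_le by (intro sum_mono) (auto intro!: mult_right_mono)
        also have "\<dots> \<le> \<kappa> * (c0 * size_of (S' v))"
          unfolding sum_distrib_left[symmetric] by (intro mult_left_mono IH') (simp add: \<kappa>_def)
        finally show ?thesis using True by (simp add: mult.assoc)
      next
        \<comment> \<open>\<open>\<rho>_hit\<close> supplies two factors: \<open>u\<close> pays for
          the splitting, and 1 / (1 + \<eta>) for the possibility that the tree now returns another
          bit than on \<mu>.\<close>
        case vne: False
        have "(\<Sum>\<alpha>\<in>S' v. \<rho> \<tau> (snd (s \<alpha> a)) * G \<alpha> (fst (s \<alpha> a))) \<le> (\<Sum>\<alpha>\<in>S' v. \<kappa> * (u / (1 + \<eta>)) * G \<alpha> v)"
        proof (rule sum_mono)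
          fix \<alpha> assume \<alpha>: "\<alpha> \<in> S' v"
          then have "\<alpha> \<in> S" "fst (s \<alpha> a) = v" by (auto simp: S'_def)
          moreover from this have "\<alpha> \<in> U" using Read.prems(3) unfolding consistent_def by blast
          ultimately have "\<rho> \<tau> (snd (s \<alpha> a)) \<le> \<kappa> * (u / (1 + \<eta>))"
            using sb[of \<alpha>] vne \<mu>a \<rho>_hit[of \<alpha> a \<tau>] \<tau> unfolding \<kappa>_def u_def by simp
          then show "\<rho> \<tau> (snd (s \<alpha> a)) * G \<alpha> (fst (s \<alpha> a)) \<le> \<kappa> * (u / (1 + \<eta>)) * G \<alpha> v"
            unfolding \<open>fst (s \<alpha> a) = v\<close> by (intro mult_right_mono G0)
        qed
        also have "\<dots> \<le> \<kappa> * (u / (1 + \<eta>)) * (((1 + \<eta>) * c0) * size_of (S' v))"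
        proof -
          have "c (fst (exec (k v) (\<mu>(a := v)))) * size_of (S' v) \<le> ((1 + \<eta>) * c0) * size_of (S' v)"
            unfolding c0_def by (intro mult_right_mono c size_of_nonneg)
          with IH have "(\<Sum>\<alpha>\<in>S' v. G \<alpha> v) \<le> ((1 + \<eta>) * c0) * size_of (S' v)"
            by (rule order_trans)
          then show ?thesis
            unfolding sum_distrib_left[symmetric] using \<eta>
            by (intro mult_left_mono) (auto simp: \<kappa>_def u_def)
        qed
        also have "\<dots> = \<kappa> * c0 * (u * size_of (S' v))"
          using \<eta> by (simp add: field_simps)
        finally show ?thesis using vne by simp
      qed
    qed
    have finV: "finite V" by (simp add: V_def)
    have split: "(\<Sum>\<alpha>\<in>S. f \<alpha>) = (\<Sum>v\<in>V. \<Sum>\<alpha>\<in>S' v. f \<alpha>)" for f :: "'a \<Rightarrow> real"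
      unfolding S'_def using val
      by (subst sum.group[OF finS finV]) (auto simp: V_def)
    have cards: "(\<Sum>v\<in>V. real (card (S' v))) = real (card S)"
      using split[of "\<lambda>_. 1"] by simp
    \<comment> \<open>The \<open>L\<close>-th powers of the weights sum to at most 2: there are at
      most \<open>2 ^ w\<close> fresh contents with \<open>u ^ L = 1 / 2 ^ w\<close> each, and the
      stale one counts 1. The root \<open>2 powr (1 / L)\<close> is what the factor \<kappa> on
      every read cancels.\<close>
    have "(\<Sum>v\<in>V. (if v = \<mu> a then 1 else u) * real (card (S' v)) powr (1 - 1 / real L))
        \<le> 2 powr (1 / real L) * (\<Sum>v\<in>V. real (card (S' v))) powr (1 - 1 / real L)"
    proof (rule Holder_sum_powr[OF finV L])
      have "u ^ L = 2 powr (- real w)"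
        unfolding u_def using L by (simp add: powr_realpow[symmetric] powr_powr)
      then have uL: "u ^ L = 1 / 2 ^ w" by (simp add: powr_minus powr_realpow divide_inverse)
      have "(\<Sum>v\<in>V. (if v = \<mu> a then 1 else u) ^ L) = 1 + (\<Sum>v\<in>V - {\<mu> a}. u ^ L)"
        using finV by (subst sum.remove[of _ "\<mu> a"]) (auto simp: V_def intro!: sum.cong)
      also have "\<dots> \<le> 1 + (\<Sum>v\<in>{..<2 ^ w::nat}. u ^ L)"
        by (intro add_left_mono sum_mono2) (auto simp: V_def u_def)
      also have "\<dots> = 2" by (simp add: uL)
      also have "\<dots> = (2 powr (1 / real L)) ^ L"
        using L by (simp add: powr_realpow[symmetric] powr_powr)
      finally show "(\<Sum>v\<in>V. (if v = \<mu> a then 1 else u) ^ L) \<le> (2 powr (1 / real L)) ^ L" .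
    qed (auto simp: u_def)
    then have main: "(\<Sum>v\<in>V. (if v = \<mu> a then 1 else u) * size_of (S' v)) \<le> 2 powr (1 / real L) * size_of S"
      unfolding cards size_of_def .
    have "(\<Sum>\<alpha>\<in>S. \<rho> \<tau> (snd (s \<alpha> a)) * G \<alpha> (fst (s \<alpha> a)))
        \<le> (\<Sum>v\<in>V. \<kappa> * c0 * ((if v = \<mu> a then 1 else u) * size_of (S' v)))"
      unfolding split by (intro sum_mono part)
    also have "\<dots> \<le> \<kappa> * c0 * (2 powr (1 / real L) * size_of S)"
      unfolding sum_distrib_left[symmetric] using c0
      by (intro mult_left_mono main) (simp add: \<kappa>_def)
    also have "\<dots> = c0 * size_of S"
      by (simp add: \<kappa>_def powr_minus)
    finally show ?thesis unfolding eq b c0_def .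
  qed
qed

text \<open>For moves whose returned bit earns nothing: updates and relinking.\<close>

lemma bounded_by_tree:
  assumes "hereditary P" "bounded_by P c F" "0 \<le> c" "\<tau> \<in> times" "word_bounded w t"
  shows "bounded_by P c (\<lambda>\<alpha> s. weight \<rho> t s \<tau> * F \<alpha> (post t s \<tau>))"
  unfolding bounded_by_def
proof (intro conjI allI impI)
  fix \<alpha> s show "0 \<le> weight \<rho> t s \<tau> * F \<alpha> (post t s \<tau>)"
    using assms(2) by (intro mult_nonneg_nonneg weight_nonneg \<rho>_nonneg bounded_by_nonneg)
next
  fix S s K \<mu> assume "P S" "consistent S s K \<mu>"
  then show "(\<Sum>\<alpha>\<in>S. weight \<rho> t (s \<alpha>) \<tau> * F \<alpha> (post t (s \<alpha>) \<tau>)) \<le> c * size_of S"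
    using tree_bound[of P "\<lambda>_. c" "\<lambda>_. F" \<tau> t S s K \<mu>] assms \<eta>
    by (simp add: mult_le_cancel_right1 algebra_simps)
qed

lemma bounded_by_scale:
  assumes F: "bounded_by P c F" and k: "0 \<le> k"
  shows "bounded_by P (c * k) (\<lambda>\<alpha> s. k * F \<alpha> s)"
  unfolding bounded_by_def
proof (intro conjI allI impI)
  show "0 \<le> k * F \<alpha> s" for \<alpha> s
    by (intro mult_nonneg_nonneg k bounded_by_nonneg[OF F])
  fix S s K \<mu> assume "P S" "consistent S s K \<mu>"
  from mult_left_mono[OF bounded_byD[OF F this] k]
  show "(\<Sum>\<alpha>\<in>S. k * F \<alpha> (s \<alpha>)) \<le> c * k * size_of S"
    by (simp only: sum_distrib_left mult.assoc mult.left_commute)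
qed

text \<open>The answer on the stale memory depends on Alice's input only through the cutpoint \<open>z\<close>, so it is
  a guess of bit \<open>e\<close> of \<open>y \<alpha>\<close> from the higher bits.\<close>

lemma bounded_by_query:
  fixes y :: "'a \<Rightarrow> nat" and T R :: "nat \<Rightarrow> probe_tree"
  assumes her: "hereditary P"
    and F: "bounded_by (\<lambda>S. P S \<and> (\<forall>\<alpha>\<in>S. \<forall>\<beta>\<in>S. y \<alpha> = y \<beta>)) c F"
    and c: "0 \<le> c" and \<tau>: "\<tau> \<in> times"
    and T: "\<And>z. 0 < z \<Longrightarrow> z < 2 ^ L \<Longrightarrow> word_bounded w (T z) \<and> word_bounded w (R z)"
    and y: "\<And>\<alpha>. \<alpha> \<in> U \<Longrightarrow> y \<alpha> < 2 ^ L"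
  shows "bounded_by P (c * (real L * (1 + exp \<eta>))) (\<lambda>\<alpha> s. \<Sum>e<L. let z = cutpoint e (y \<alpha>) in
      weight \<rho> (T z) s \<tau> * (if answer (T z) s \<tau> = (y \<alpha> < z) then 1 + \<eta> else 1)
      * (weight \<rho> (R z) (post (T z) s \<tau>) \<tau> * F \<alpha> (post (R z) (post (T z) s \<tau>) \<tau>)))"
    (is "bounded_by P _ ?F")
  unfolding bounded_by_def
proof (intro conjI allI impI)
  fix \<alpha> s
  show "0 \<le> ?F \<alpha> s"
    unfolding Let_def using F \<eta>
    by (intro sum_nonneg mult_nonneg_nonneg weight_nonneg \<rho>_nonneg bounded_by_nonneg[OF F]) auto
next
  fix S s K \<mu> assume PS: "P S" and cons: "consistent S s K \<mu>"
  define Q where "Q \<alpha> z s = weight \<rho> (T z) s \<tau> * (if answer (T z) s \<tau> = (y \<alpha> < z) then 1 + \<eta> else 1)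
      * (weight \<rho> (R z) (post (T z) s \<tau>) \<tau> * F \<alpha> (post (R z) (post (T z) s \<tau>) \<tau>))" for \<alpha> z s
  define S' where "S' v = {\<alpha> \<in> S. y \<alpha> = v}" for v
  define g where "g z = fst (exec (T z) \<mu>)" for z
  have SU: "S \<subseteq> U" using cons unfolding consistent_def by blast
  then have finS: "finite S" using finite_U finite_subset by blast
  have ltL: "0 < cutpoint e v \<and> cutpoint e v < 2 ^ L" if "e < L" "v < 2 ^ L" for e v
    using that cutpoint_less cutpoint_pos by blast
  let ?P = "\<lambda>S. P S \<and> (\<forall>\<alpha>\<in>S. \<forall>\<beta>\<in>S. y \<alpha> = y \<beta>)"
  have her': "hereditary ?P"
    unfolding hereditary_def using hereditaryD[OF her] by (metis subsetD)
  \<comment> \<open>Once \<open>y\<close> is fixed to \<open>v\<close> the cutpoint is too, so all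
    of \<open>S' v\<close> runs one tree. The constants \<open>c\<close> and
    \<open>c * (1 + \<eta>)\<close> for a wrong and a right answer differ by no more than
    \<open>tree_bound\<close> allows.\<close>
  have part: "(\<Sum>\<alpha>\<in>S' v. Q \<alpha> (cutpoint e v) (s \<alpha>))
      \<le> c * ((if g (cutpoint e v) = (v < cutpoint e v) then 1 + \<eta> else 1) * size_of (S' v))"
    if e: "e < L" and v: "v < 2 ^ L" for e v
  proof -
    let ?z = "cutpoint e v"
    let ?c = "\<lambda>b. c * (if b = (v < ?z) then 1 + \<eta> else 1)"
    let ?F = "\<lambda>b \<alpha> s. (if b = (v < ?z) then 1 + \<eta> else 1) * (weight \<rho> (R ?z) s \<tau> * F \<alpha> (post (R ?z) s \<tau>))"
    have FR: "bounded_by ?P c (\<lambda>\<alpha> s. weight \<rho> (R ?z) s \<tau> * F \<alpha> (post (R ?z) s \<tau>))"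
      by (rule bounded_by_tree[OF her' F c \<tau>]) (use T ltL[OF e v] in simp)
    have FR': "bounded_by ?P (?c b) (?F b)" for b
      using \<eta> by (intro bounded_by_scale FR) simp
    have c': "0 \<le> ?c b" "?c b \<le> (1 + \<eta>) * ?c b'" for b b'
      using c \<eta> by (auto simp: algebra_simps)
    have P': "?P (S' v)"
      using hereditaryD[OF her PS, of "S' v"] unfolding S'_def by blast
    have cons': "consistent (S' v) s K \<mu>"
      by (rule consistent_subset[OF cons]) (simp add: S'_def)
    have wb: "word_bounded w (T ?z)" using T ltL[OF e v] by simp
    have le: "(\<Sum>\<alpha>\<in>S' v. weight \<rho> (T ?z) (s \<alpha>) \<tau> * ?F (answer (T ?z) (s \<alpha>) \<tau>) \<alpha> (post (T ?z) (s \<alpha>) \<tau>))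
      \<le> ?c (fst (exec (T ?z) \<mu>)) * size_of (S' v)"
      by (rule tree_bound[where P="?P" and c="?c" and F="?F", OF her' FR' c' \<tau> wb P' cons'])
    have "(\<Sum>\<alpha>\<in>S' v. weight \<rho> (T ?z) (s \<alpha>) \<tau> * ?F (answer (T ?z) (s \<alpha>) \<tau>) \<alpha> (post (T ?z) (s \<alpha>) \<tau>))
       = (\<Sum>\<alpha>\<in>S' v. Q \<alpha> ?z (s \<alpha>))"
      by (rule sum.cong) (simp_all add: Q_def S'_def mult.assoc)
    with le show ?thesis unfolding g_def by (simp only: mult.assoc)
  qed
  have split: "(\<Sum>\<alpha>\<in>S. f \<alpha>) = (\<Sum>v<2 ^ L. \<Sum>\<alpha>\<in>S' v. f \<alpha>)" for f :: "'a \<Rightarrow> real"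
    unfolding S'_def using y SU
    by (subst sum.group[OF finS]) auto
  have cards: "(\<Sum>v<2 ^ L. real (card (S' v))) = real (card S)"
    using split[of "\<lambda>_. 1"] by simp
  define H where "H v = (\<Sum>e<L. if g (cutpoint e v) = (v < cutpoint e v) then 1 + \<eta> else 1)" for v
  have "(\<Sum>\<alpha>\<in>S. \<Sum>e<L. Q \<alpha> (cutpoint e (y \<alpha>)) (s \<alpha>)) = (\<Sum>v<2 ^ L. \<Sum>\<alpha>\<in>S' v. \<Sum>e<L. Q \<alpha> (cutpoint e v) (s \<alpha>))"
    unfolding split by (intro sum.cong) (auto simp: S'_def)
  also have "\<dots> = (\<Sum>v<2 ^ L. \<Sum>e<L. \<Sum>\<alpha>\<in>S' v. Q \<alpha> (cutpoint e v) (s \<alpha>))"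
    by (intro sum.cong sum.swap) auto
  also have "\<dots> \<le> (\<Sum>v<2 ^ L. \<Sum>e<L. c * ((if g (cutpoint e v) = (v < cutpoint e v) then 1 + \<eta> else 1) * size_of (S' v)))"
    by (intro sum_mono part) auto
  also have "\<dots> = c * (\<Sum>v<2 ^ L. H v * size_of (S' v))"
    unfolding H_def by (simp only: sum_distrib_left sum_distrib_right)
  also have "\<dots> \<le> c * (real L * (1 + exp \<eta>) * size_of S)"
  proof (intro mult_left_mono c)
    have "(\<Sum>v<2 ^ L. H v * real (card (S' v)) powr (1 - 1 / real L))
      \<le> real L * (1 + exp \<eta>) * (\<Sum>v<2 ^ L. real (card (S' v))) powr (1 - 1 / real L)"
    proof (rule Holder_sum_powr[OF _ L])
      show "(\<Sum>v<2 ^ L. H v ^ L) \<le> (real L * (1 + exp \<eta>)) ^ L"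
        unfolding H_def by (rule sum_prediction[OF L \<eta>])
      show "0 \<le> H v" for v unfolding H_def using \<eta> by (intro sum_nonneg) auto
      show "0 \<le> real L * (1 + exp \<eta>)" by (intro mult_nonneg_nonneg add_nonneg_nonneg) auto
    qed auto
    then show "(\<Sum>v<2 ^ L. H v * size_of (S' v)) \<le> real L * (1 + exp \<eta>) * size_of S"
      unfolding size_of_def cards .
  qed
  finally show "(\<Sum>\<alpha>\<in>S. ?F \<alpha> (s \<alpha>)) \<le> c * (real L * (1 + exp \<eta>)) * size_of S"
    unfolding Let_def Q_def by (simp add: mult.assoc)
qed

end

section \<open>Bit reversal and permutations\<close>

definition words :: "nat \<Rightarrow> 'a set \<Rightarrow> 'a list set" where
  "words n A = {xs. set xs \<subseteq> A \<and> length xs = n}"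

lemma words_0 [simp]: "words 0 A = {[]}"
  by (auto simp: words_def)

lemma wordsD: "xs \<in> words n A \<Longrightarrow> set xs \<subseteq> A" "xs \<in> words n A \<Longrightarrow> length xs = n"
  by (simp_all add: words_def)

lemma set_zip_subset:
  assumes "set xs \<subseteq> A" "set ys \<subseteq> B"
  shows "set (zip xs ys) \<subseteq> A \<times> B"
proof
  fix a assume "a \<in> set (zip xs ys)"
  then have "fst a \<in> set xs" "snd a \<in> set ys"
    by (metis prod.collapse set_zip_leftD, metis prod.collapse set_zip_rightD)
  then show "a \<in> A \<times> B" using assms by (auto simp: mem_Times_iff)
qed

lemma finite_words: "finite A \<Longrightarrow> finite (words n A)"
  unfolding words_def by (rule finite_lists_length_eq)

lemma card_words: "finite A \<Longrightarrow> card (words n A) = card A ^ n"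
  unfolding words_def by (rule card_lists_length_eq)

lemma sum_words_Suc:
  fixes f :: "'a list \<Rightarrow> real"
  shows "(\<Sum>xs\<in>words (Suc n) A. f xs) = (\<Sum>x\<in>A. \<Sum>xs\<in>words n A. f (x # xs))"
proof -
  have "bij_betw (\<lambda>(x, xs). x # xs) (A \<times> words n A) (words (Suc n) A)"
    by (rule bij_betwI[where g="\<lambda>xs. (hd xs, tl xs)"])
      (auto simp: words_def length_Suc_conv)
  from sum.reindex_bij_betw[OF this, of f]
  show ?thesis by (simp add: sum.cartesian_product case_prod_beta)
qed

lemma sum_words_append:
  fixes f :: "'a list \<Rightarrow> real"
  shows "(\<Sum>xs\<in>words (n + k) A. f xs) = (\<Sum>xs\<in>words n A. \<Sum>ys\<in>words k A. f (xs @ ys))"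
proof (induction n arbitrary: f)
  case (Suc n)
  then show ?case by (simp add: sum_words_Suc)
qed simp

text \<open>The column set at time \<open>t\<close>: the \<open>r\<close> bits of \<open>t\<close>, reversed and complemented.\<close>

fun rev_pos :: "nat \<Rightarrow> nat \<Rightarrow> nat" where
  "rev_pos 0 t = 0"
| "rev_pos (Suc r) t = (if even t then 2 ^ r else 0) + rev_pos r (t div 2)"

lemma rev_pos_less: "rev_pos r t < 2 ^ r"
proof (induction r arbitrary: t)
  case (Suc r)
  from Suc[of "t div 2"] show ?case by auto
qed simp

text \<open>The low bits of the time become the high bits of the column. Hence the
  \<open>2 ^ l\<close> consecutive times of a block, with \<open>q\<close> fixed, occupy an
  arithmetic progression of columns with difference \<open>2 ^ r\<close>, spread over the whole
  grid.\<close>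

lemma rev_pos_split:
  "i < 2 ^ l \<Longrightarrow> rev_pos (l + r) (i + 2 ^ l * q) = rev_pos l i * 2 ^ r + rev_pos r q"
proof (induction l arbitrary: i)
  case (Suc l)
  have "(i + 2 ^ Suc l * q) div 2 = i div 2 + 2 ^ l * q" "even (i + 2 ^ Suc l * q) = even i" by auto
  then have "rev_pos (Suc l + r) (i + 2 ^ Suc l * q)
      = (if even i then 2 ^ (l + r) else 0) + rev_pos (l + r) (i div 2 + 2 ^ l * q)"
    by (simp only: add_Suc rev_pos.simps)
  also have "rev_pos (l + r) (i div 2 + 2 ^ l * q) = rev_pos l (i div 2) * 2 ^ r + rev_pos r q"
    using Suc.prems by (intro Suc.IH) simp
  finally show ?case by (simp add: power_add add_mult_distrib)
qed simp

lemma rev_pos_inj: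
  "t < 2 ^ r \<Longrightarrow> t' < 2 ^ r \<Longrightarrow> rev_pos r t = rev_pos r t' \<Longrightarrow> t = t'"
proof (induction r arbitrary: t t')
  case (Suc r)
  have "even t = even t' \<and> a = b"
    if "(if even t then 2 ^ r else 0) + a = (if even t' then 2 ^ r else 0) + b" "a < 2 ^ r" "b < 2 ^ r"
    for a b :: nat
    using that by (cases "even t"; cases "even t'") auto
  from this[OF Suc.prems(3)[unfolded rev_pos.simps] rev_pos_less rev_pos_less]
  have par: "even t = even t'" and eq: "rev_pos r (t div 2) = rev_pos r (t' div 2)" by blast+
  have "t div 2 < 2 ^ r" "t' div 2 < 2 ^ r"
    using Suc.prems(1,2) by (simp_all add: less_mult_imp_div_less mult.commute)
  from Suc.IH[OF this eq] have "t div 2 = t' div 2" .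
  with par show ?case by (metis bit_eq_rec)
qed simp

lemma fold_permutes:
  "(\<And>p. p \<in> set ps \<Longrightarrow> \<sigma> p permutes A) \<Longrightarrow> fold \<sigma> ps permutes A"
proof (induction ps)
  case (Cons p ps)
  then have "fold \<sigma> ps \<circ> \<sigma> p permutes A" by (intro permutes_compose) auto
  then show ?case by (simp only: fold.simps)
qed (simp add: permutes_id)

fun config :: "nat \<Rightarrow> nat \<Rightarrow> (nat \<Rightarrow> nat \<Rightarrow> nat) \<Rightarrow> (nat \<Rightarrow> nat) list \<Rightarrow> nat \<Rightarrow> nat \<Rightarrow> nat" where
  "config L \<tau> \<sigma> [] = \<sigma>"
| "config L \<tau> \<sigma> (\<pi> # ps) = config L (Suc \<tau>) (\<sigma>(rev_pos L \<tau> := \<pi>)) ps"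

lemma config_other:
  "(\<And>i. i < length ps \<Longrightarrow> p \<noteq> rev_pos L (\<tau> + i)) \<Longrightarrow> config L \<tau> \<sigma> ps p = \<sigma> p"
proof (induction ps arbitrary: \<tau> \<sigma>)
  case (Cons \<pi> ps)
  have "config L (Suc \<tau>) (\<sigma>(rev_pos L \<tau> := \<pi>)) ps p = (\<sigma>(rev_pos L \<tau> := \<pi>)) p"
    using Cons.prems[of "Suc _"] by (intro Cons.IH) simp
  then show ?case using Cons.prems[of 0] by simp
qed simp

lemma config_at:
  "i < length ps \<Longrightarrow> \<tau> + length ps \<le> 2 ^ L \<Longrightarrow> config L \<tau> \<sigma> ps (rev_pos L (\<tau> + i)) = ps ! i"
proof (induction ps arbitrary: \<tau> \<sigma> i)
  case (Cons \<pi> ps)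
  show ?case
  proof (cases i)
    case 0
    have "config L (Suc \<tau>) (\<sigma>(rev_pos L \<tau> := \<pi>)) ps (rev_pos L \<tau>) = (\<sigma>(rev_pos L \<tau> := \<pi>)) (rev_pos L \<tau>)"
    proof (rule config_other)
      fix j assume "j < length ps"
      then show "rev_pos L \<tau> \<noteq> rev_pos L (Suc \<tau> + j)"
        using rev_pos_inj[of \<tau> L "Suc \<tau> + j"] Cons.prems(2) by auto
    qed
    then show ?thesis using 0 by simp
  next
    case (Suc j)
    then show ?thesis using Cons.IH[of j "Suc \<tau>"] Cons.prems by simp
  qed
qed simp

lemma config_permutes:
  "(\<And>p. \<sigma> p permutes A) \<Longrightarrow> (\<And>\<pi>. \<pi> \<in> set ps \<Longrightarrow> \<pi> permutes A) \<Longrightarrow> config L \<tau> \<sigma> ps p permutes A"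
  by (induction ps arbitrary: \<tau> \<sigma>) auto

text \<open>Takes a row of column \<open>p\<close> to the row in which the path from there enters
  the last column.\<close>

definition suffix_map :: "nat \<Rightarrow> (nat \<Rightarrow> nat \<Rightarrow> nat) \<Rightarrow> nat \<Rightarrow> nat \<Rightarrow> nat" where
  "suffix_map L \<sigma> p = fold \<sigma> [p..<2 ^ L]"

lemma suffix_map_permutes: "(\<And>p. \<sigma> p permutes A) \<Longrightarrow> suffix_map L \<sigma> p permutes A"
  unfolding suffix_map_def by (intro fold_permutes)

text \<open>\<open>Suc j\<close> because the queries at a time come after the update made at the
  same time.\<close>

definition arrival :: "nat \<Rightarrow> nat \<Rightarrow> (nat \<Rightarrow> nat \<Rightarrow> nat) \<Rightarrow> (nat \<Rightarrow> nat) list \<Rightarrow> nat \<Rightarrow> nat \<Rightarrow> nat" where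
  "arrival L \<tau> \<sigma> ps j = suffix_map L (config L \<tau> \<sigma> (take (Suc j) ps)) (rev_pos L (\<tau> + j))"

text \<open>At level \<open>l\<close> the columns set in the left and in the right half of a node interleave, the
  columns of the left half being the larger ones.\<close>

lemma left_half_determined:
  fixes A :: "nat set"
  assumes L: "L = Suc (l + r)" and q: "q < 2 ^ r"
    and \<tau>: "\<tau> = 2 ^ Suc l * q"
    and len: "length \<alpha> = 2 ^ l" "length \<alpha>' = 2 ^ l" "length \<beta> = 2 ^ l"
    and perm: "\<And>p. \<sigma> p permutes A" "\<And>\<pi>. \<pi> \<in> set \<alpha> \<Longrightarrow> \<pi> permutes A"
      "\<And>\<pi>. \<pi> \<in> set \<alpha>' \<Longrightarrow> \<pi> permutes A" "\<And>\<pi>. \<pi> \<in> set \<beta> \<Longrightarrow> \<pi> permutes A"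
    and agree: "\<And>j x. j < 2 ^ l \<Longrightarrow> x \<in> A \<Longrightarrow>
      arrival L (\<tau> + 2 ^ l) (config L \<tau> \<sigma> \<alpha>) \<beta> j x
      = arrival L (\<tau> + 2 ^ l) (config L \<tau> \<sigma> \<alpha>') \<beta> j x"
  shows "\<alpha> = \<alpha>'"
proof (rule ccontr)
  assume "\<alpha> \<noteq> \<alpha>'"
  \<comment> \<open>Among the differing permutations, the one in the largest column
    \<open>a i\<close> is isolated by the queries at time \<open>\<tau> + 2 ^ l + i\<close>. They
    start from column \<open>b i\<close>, which is \<open>2 ^ r\<close> columns below
    \<open>a i\<close>, and every other permutation that they pass is the same in both runs.\<close>
  define D where "D = {i. i < 2 ^ l \<and> \<alpha> ! i \<noteq> \<alpha>' ! i}"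
  have "D \<noteq> {}" using \<open>\<alpha> \<noteq> \<alpha>'\<close> len nth_equalityI[of \<alpha> \<alpha>'] unfolding D_def by auto
  moreover have "finite D" unfolding D_def by simp
  ultimately obtain i where i: "i \<in> D" and max: "\<And>i'. i' \<in> D \<Longrightarrow> rev_pos l i' \<le> rev_pos l i"
    using arg_min_if_finite(1)[of D "\<lambda>i. - int (rev_pos l i)"]
      arg_min_least[of D _ "\<lambda>i. - int (rev_pos l i)"] by (metis neg_le_iff_le of_nat_le_iff)
  have i2: "i < 2 ^ l" "\<alpha> ! i \<noteq> \<alpha>' ! i" using i unfolding D_def by auto
  have bound: "\<tau> + 2 ^ Suc l \<le> 2 ^ L"
  proof -
    have "2 ^ Suc l * Suc q \<le> 2 ^ Suc l * (2::nat) ^ r" using q by (intro mult_left_mono) auto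
    then show ?thesis unfolding \<tau> L by (simp add: power_add algebra_simps)
  qed
  define a where "a j = rev_pos L (\<tau> + j)" for j
  define b where "b j = rev_pos L (\<tau> + 2 ^ l + j)" for j
  have a: "a j = rev_pos l j * 2 ^ Suc r + (2 ^ r + rev_pos r q)" if "j < 2 ^ l" for j
  proof -
    have "a j = rev_pos (l + Suc r) (j + 2 ^ l * (2 * q))"
      unfolding a_def \<tau> L by (simp add: algebra_simps)
    then show ?thesis using rev_pos_split[OF that, of "Suc r" "2 * q"] by simp
  qed
  have b: "b j = rev_pos l j * 2 ^ Suc r + rev_pos r q" if "j < 2 ^ l" for j
  proof -
    have "b j = rev_pos (l + Suc r) (j + 2 ^ l * (2 * q + 1))"
      unfolding b_def \<tau> L by (simp add: algebra_simps)
    then show ?thesis using rev_pos_split[OF that, of "Suc r" "2 * q + 1"] by simp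
  qed
  have ab: "b i < a i" using a b i2(1) by simp
  have aL: "a i < 2 ^ L" unfolding a_def by (rule rev_pos_less)
  have after: "i' \<notin> D" if i': "i' < 2 ^ l" "i' \<noteq> i" "b i \<le> a i'" for i'
  proof
    assume "i' \<in> D"
    then have "rev_pos l i' \<le> rev_pos l i" by (rule max)
    moreover have "rev_pos l i' \<noteq> rev_pos l i" using rev_pos_inj[of i' l i] i' i2 by auto
    ultimately have "Suc (rev_pos l i') * 2 ^ Suc r \<le> rev_pos l i * 2 ^ Suc r"
      by (intro mult_right_mono) auto
    moreover have "2 ^ r + rev_pos r q < 2 ^ Suc r" using rev_pos_less[of r q] by simp
    ultimately show False using i'(3) a[OF i'(1)] b[OF i2(1)] by (simp only: mult_Suc)
  qed
  define c where "c \<gamma> = config L (\<tau> + 2 ^ l) (config L \<tau> \<sigma> \<gamma>) (take (Suc i) \<beta>)" for \<gamma>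
  have cb: "c \<gamma> (b j) = \<beta> ! j" if "j \<le> i" for j \<gamma>
  proof -
    have "c \<gamma> (b j) = take (Suc i) \<beta> ! j"
      unfolding c_def b_def using that i2 len bound by (intro config_at) auto
    then show ?thesis using that by simp
  qed
  have cn: "c \<gamma> p = config L \<tau> \<sigma> \<gamma> p" if "\<And>j. j \<le> i \<Longrightarrow> p \<noteq> b j" for p \<gamma>
    unfolding c_def using that i2 len by (intro config_other) (auto simp: b_def)
  have ba: "a j \<noteq> b j'" if "j < 2 ^ l" "j' < 2 ^ l" for j j'
    unfolding a_def b_def using rev_pos_inj[of "\<tau> + j" L "\<tau> + 2 ^ l + j'"] that bound by auto
  have ca: "c \<gamma> (a j) = \<gamma> ! j" if "j < 2 ^ l" "length \<gamma> = 2 ^ l" for j \<gamma>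
  proof -
    have "c \<gamma> (a j) = config L \<tau> \<sigma> \<gamma> (a j)" using ba that i2 by (intro cn) auto
    then show ?thesis unfolding a_def using config_at[of j \<gamma> \<tau> L \<sigma>] that bound by simp
  qed
  have same: "c \<alpha> p = c \<alpha>' p" if p: "b i \<le> p" "p \<noteq> a i" for p
  proof -
    consider j where "j \<le> i" "p = b j" | j where "j < 2 ^ l" "p = a j"
      | "\<And>j. j \<le> i \<Longrightarrow> p \<noteq> b j" "\<And>j. j < 2 ^ l \<Longrightarrow> p \<noteq> a j" by blast
    then show ?thesis
    proof cases
      case 1
      then show ?thesis using cb by simp
    next
      case 2
      then have "j \<notin> D" using after[of j] p by auto
      then show ?thesis using ca 2 len unfolding D_def by simp
    next
      case 3
      then show ?thesis using cn[of p] len by (simp add: config_other a_def)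
    qed
  qed
  \<comment> \<open>The outer factors are common to both runs and are permutations, so equality of
    the products can be cancelled down to the factor at \<open>a i\<close>.\<close>
  have split: "suffix_map L (c \<gamma>) (b i) = fold (c \<gamma>) [Suc (a i)..<2 ^ L] \<circ> c \<gamma> (a i) \<circ> fold (c \<gamma>) [b i..<a i]" for \<gamma>
  proof -
    have "[b i..<2 ^ L] = [b i..<a i] @ a i # [Suc (a i)..<2 ^ L]"
      using ab aL by (metis upt_conv_Cons upt_add_eq_append less_imp_le_nat le_add_diff_inverse)
    then show ?thesis unfolding suffix_map_def by (simp add: comp_assoc)
  qed
  have permc: "c \<alpha> p permutes A" for p
    unfolding c_def using perm by (intro config_permutes) (auto dest: in_set_takeD)
  define G where "G = fold (c \<alpha>) [Suc (a i)..<2 ^ L]"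
  define H where "H = fold (c \<alpha>) [b i..<a i]"
  have G': "fold (c \<alpha>') [Suc (a i)..<2 ^ L] = G" and H': "fold (c \<alpha>') [b i..<a i] = H"
    unfolding G_def H_def using ab same by (auto intro!: fold_cong)
  have GA: "G permutes A" and HA: "H permutes A"
    unfolding G_def H_def using permc by (auto intro!: fold_permutes)
  have "\<alpha> ! i = \<alpha>' ! i"
  proof (rule ext)
    fix x
    have pa: "\<alpha> ! i permutes A" "\<alpha>' ! i permutes A" using perm len i2 by auto
    show "(\<alpha> ! i) x = (\<alpha>' ! i) x"
    proof (cases "x \<in> A")
      case True
      then obtain x' where x': "x' \<in> A" "x = H x'" using permutes_image[OF HA] by blast
      have "suffix_map L (c \<alpha>) (b i) x' = suffix_map L (c \<alpha>') (b i) x'"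
        using agree[OF i2(1) x'(1)] unfolding arrival_def c_def b_def .
      then have "G ((\<alpha> ! i) x) = G ((\<alpha>' ! i) x)"
        unfolding split G' H' G_def[symmetric] H_def[symmetric] using ca i2 len x' by simp
      then show ?thesis using permutes_inj[OF GA] by (auto dest: injD)
    next
      case False
      then show ?thesis using pa by (simp add: permutes_not_in)
    qed
  qed
  with i2 show False by simp
qed

section \<open>Runs on the grid\<close>

definition vertex :: "nat \<Rightarrow> nat \<Rightarrow> nat \<Rightarrow> nat" where
  "vertex L i x = i * 2 ^ L + x"

lemma vertex_less: "i \<le> 2 ^ L \<Longrightarrow> x < 2 ^ L \<Longrightarrow> vertex L i x < (2 ^ L + 1) * 2 ^ L"
proof -
  assume "i \<le> 2 ^ L" "x < 2 ^ L"
  then have "i * 2 ^ L \<le> 2 ^ L * 2 ^ L" by (intro mult_right_mono) auto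
  with \<open>x < 2 ^ L\<close> show ?thesis unfolding vertex_def by (simp only: distrib_right mult_1)
qed

text \<open>Only identity edges have to be deleted, because every column is updated once.\<close>

definition update_ops :: "nat \<Rightarrow> nat \<Rightarrow> (nat \<Rightarrow> nat) \<Rightarrow> operation list" where
  "update_ops L p \<pi> =
     map (\<lambda>x. Delete (vertex L p x) (vertex L (Suc p) x)) [0..<2 ^ L] @
     map (\<lambda>x. Insert (vertex L p x) (vertex L (Suc p) (\<pi> x))) [0..<2 ^ L]"

definition cut_op :: "nat \<Rightarrow> nat \<Rightarrow> operation" where
  "cut_op L z = Delete (vertex L (2 ^ L) (z - 1)) (vertex L (2 ^ L) z)"

definition link_op :: "nat \<Rightarrow> nat \<Rightarrow> operation" where
  "link_op L z = Insert (vertex L (2 ^ L) (z - 1)) (vertex L (2 ^ L) z)"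

definition query_op :: "nat \<Rightarrow> nat \<Rightarrow> nat \<Rightarrow> operation" where
  "query_op L p x = Query (vertex L p x) (vertex L (2 ^ L) 0)"

lemma update_ops_on:
  "p < 2 ^ L \<Longrightarrow> (\<And>x. x < 2 ^ L \<Longrightarrow> \<pi> x < 2 ^ L) \<Longrightarrow> o' \<in> set (update_ops L p \<pi>) \<Longrightarrow>
    operation_on ((2 ^ L + 1) * 2 ^ L) o'"
  unfolding update_ops_def using vertex_less[of p L] vertex_less[of "Suc p" L]
  by (auto simp: vertex_def)

lemma cut_op_on: "0 < z \<Longrightarrow> z < 2 ^ L \<Longrightarrow> operation_on ((2 ^ L + 1) * 2 ^ L) (cut_op L z)"
  and link_op_on: "0 < z \<Longrightarrow> z < 2 ^ L \<Longrightarrow> operation_on ((2 ^ L + 1) * 2 ^ L) (link_op L z)"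
  unfolding cut_op_def link_op_def using vertex_less[of "2 ^ L" L z] vertex_less[of "2 ^ L" L "z - 1"]
  by (auto simp: vertex_def)

lemma query_op_on: "p < 2 ^ L \<Longrightarrow> x < 2 ^ L \<Longrightarrow> operation_on ((2 ^ L + 1) * 2 ^ L) (query_op L p x)"
  unfolding query_op_def using vertex_less[of p L x] vertex_less[of "2 ^ L" L 0] by auto

primrec tree_of :: "(operation \<Rightarrow> probe_tree) \<Rightarrow> operation list \<Rightarrow> probe_tree" where
  "tree_of P [] = Return False"
| "tree_of P (x # xs) = bind_tree (P x) (tree_of P xs)"

lemma word_bounded_tree_of:
  "(\<And>x. x \<in> set xs \<Longrightarrow> word_bounded w (P x)) \<Longrightarrow> word_bounded w (tree_of P xs)"
  by (induction xs) (auto intro: word_bounded_bind_tree)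

locale process =
  fixes L w :: nat and P :: "operation \<Rightarrow> probe_tree"
  assumes L: "0 < L"
    and P: "\<And>x. operation_on ((2 ^ L + 1) * 2 ^ L) x \<Longrightarrow> word_bounded w (P x)"
begin

definition update_tree :: "nat \<Rightarrow> (nat \<Rightarrow> nat) \<Rightarrow> probe_tree" where
  "update_tree p \<pi> = tree_of P (update_ops L p \<pi>)"

definition query_tree :: "nat \<Rightarrow> nat \<Rightarrow> nat \<Rightarrow> probe_tree" where
  "query_tree p x z = bind_tree (P (cut_op L z)) (P (query_op L p x))"

definition link_tree :: "nat \<Rightarrow> probe_tree" where
  "link_tree z = P (link_op L z)"

fun qpost :: "nat \<Rightarrow> nat \<Rightarrow> (nat \<Rightarrow> nat) \<Rightarrow> (nat \<times> nat) list \<Rightarrow> stamped \<Rightarrow> stamped" where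
  "qpost \<tau> p y [] s = s"
| "qpost \<tau> p y ((x, e) # xs) s = qpost \<tau> p y xs
     (post (link_tree (cutpoint e (y x))) (post (query_tree p x (cutpoint e (y x))) s \<tau>) \<tau>)"

text \<open>\<open>g \<tau>\<close> is the reward of a right answer at time \<tau>. The answer is
  compared with the intended \<open>y x < z\<close>; that this is connectivity in the graph at that
  moment is the content of \<open>query_answer\<close>.\<close>

fun qweight :: "(nat \<Rightarrow> nat \<Rightarrow> real) \<Rightarrow> (nat \<Rightarrow> real) \<Rightarrow> nat \<Rightarrow> nat \<Rightarrow> (nat \<Rightarrow> nat) \<Rightarrow> (nat \<times> nat) list
    \<Rightarrow> stamped \<Rightarrow> real" where
  "qweight \<rho> g \<tau> p y [] s = 1"
| "qweight \<rho> g \<tau> p y ((x, e) # xs) s =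
     weight \<rho> (query_tree p x (cutpoint e (y x))) s \<tau> *
     (if answer (query_tree p x (cutpoint e (y x))) s \<tau> = (y x < cutpoint e (y x)) then 1 + g \<tau> else 1) *
     (weight \<rho> (link_tree (cutpoint e (y x))) (post (query_tree p x (cutpoint e (y x))) s \<tau>) \<tau> *
     qweight \<rho> g \<tau> p y xs
       (post (link_tree (cutpoint e (y x))) (post (query_tree p x (cutpoint e (y x))) s \<tau>) \<tau>))"

abbreviation column :: "nat \<Rightarrow> nat" where "column \<tau> \<equiv> rev_pos L \<tau>"

definition target :: "nat \<Rightarrow> (nat \<Rightarrow> nat \<Rightarrow> nat) \<Rightarrow> (nat \<Rightarrow> nat) \<Rightarrow> nat \<Rightarrow> nat" where
  "target \<tau> \<sigma> \<pi> = suffix_map L (\<sigma>(column \<tau> := \<pi>)) (column \<tau>)"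

definition mpost :: "nat \<Rightarrow> (nat \<Rightarrow> nat \<Rightarrow> nat) \<Rightarrow> (nat \<Rightarrow> nat) \<Rightarrow> nat list \<Rightarrow> stamped \<Rightarrow> stamped" where
  "mpost \<tau> \<sigma> \<pi> \<delta> s = qpost \<tau> (column \<tau>) (target \<tau> \<sigma> \<pi>) (zip [0..<2 ^ L] \<delta>)
     (post (update_tree (column \<tau>) \<pi>) s \<tau>)"

definition mweight :: "(nat \<Rightarrow> nat \<Rightarrow> real) \<Rightarrow> (nat \<Rightarrow> real) \<Rightarrow> nat \<Rightarrow> (nat \<Rightarrow> nat \<Rightarrow> nat) \<Rightarrow> (nat \<Rightarrow> nat)
    \<Rightarrow> nat list \<Rightarrow> stamped \<Rightarrow> real" where
  "mweight \<rho> g \<tau> \<sigma> \<pi> \<delta> s = weight \<rho> (update_tree (column \<tau>) \<pi>) s \<tau> *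
     qweight \<rho> g \<tau> (column \<tau>) (target \<tau> \<sigma> \<pi>) (zip [0..<2 ^ L] \<delta>)
       (post (update_tree (column \<tau>) \<pi>) s \<tau>)"

fun rpost :: "nat \<Rightarrow> (nat \<Rightarrow> nat \<Rightarrow> nat) \<Rightarrow> ((nat \<Rightarrow> nat) \<times> nat list) list \<Rightarrow> stamped \<Rightarrow> stamped" where
  "rpost \<tau> \<sigma> [] s = s"
| "rpost \<tau> \<sigma> ((\<pi>, \<delta>) # r) s = rpost (Suc \<tau>) (\<sigma>(column \<tau> := \<pi>)) r (mpost \<tau> \<sigma> \<pi> \<delta> s)"

fun rweight :: "(nat \<Rightarrow> nat \<Rightarrow> real) \<Rightarrow> (nat \<Rightarrow> real) \<Rightarrow> nat \<Rightarrow> (nat \<Rightarrow> nat \<Rightarrow> nat)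
    \<Rightarrow> ((nat \<Rightarrow> nat) \<times> nat list) list \<Rightarrow> stamped \<Rightarrow> real" where
  "rweight \<rho> g \<tau> \<sigma> [] s = 1"
| "rweight \<rho> g \<tau> \<sigma> ((\<pi>, \<delta>) # r) s = mweight \<rho> g \<tau> \<sigma> \<pi> \<delta> s *
     rweight \<rho> g (Suc \<tau>) (\<sigma>(column \<tau> := \<pi>)) r (mpost \<tau> \<sigma> \<pi> \<delta> s)"

lemma rweight_append:
  "rweight \<rho> g \<tau> \<sigma> (xs @ ys) s = rweight \<rho> g \<tau> \<sigma> xs s *
     rweight \<rho> g (\<tau> + length xs) (config L \<tau> \<sigma> (map fst xs)) ys (rpost \<tau> \<sigma> xs s)"
  by (induction xs arbitrary: \<tau> \<sigma> s) auto

lemma qweight_nonneg: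
  assumes "\<And>\<tau> x. 0 \<le> \<rho> \<tau> x" "\<And>\<tau>. 0 \<le> g \<tau>"
  shows "0 \<le> qweight \<rho> g \<tau> p y xs s"
proof (induction xs arbitrary: s)
  case (Cons a xs)
  have "0 \<le> (if c then 1 + g \<tau> else 1)" for c using assms(2)[of \<tau>] by simp
  then show ?case
    by (cases a) (simp only: qweight.simps mult_nonneg_nonneg weight_nonneg assms Cons.IH)
qed simp

lemma mweight_nonneg:
  assumes "\<And>\<tau> x. 0 \<le> \<rho> \<tau> x" "\<And>\<tau>. 0 \<le> g \<tau>"
  shows "0 \<le> mweight \<rho> g \<tau> \<sigma> \<pi> \<delta> s"
  unfolding mweight_def by (intro mult_nonneg_nonneg qweight_nonneg weight_nonneg assms)

lemma rweight_nonneg: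
  assumes "\<And>\<tau> x. 0 \<le> \<rho> \<tau> x" "\<And>\<tau>. 0 \<le> g \<tau>"
  shows "0 \<le> rweight \<rho> g \<tau> \<sigma> r s"
proof (induction r arbitrary: \<tau> \<sigma> s)
  case (Cons a r)
  then show ?case
    by (cases a) (simp only: rweight.simps mult_nonneg_nonneg mweight_nonneg assms)
qed simp

lemma qweight_le_1:
  assumes "\<And>\<tau> x. 0 \<le> \<rho> \<tau> x" "\<And>\<tau> x. \<rho> \<tau> x \<le> 1" "\<And>\<tau>. 0 \<le> g \<tau>" and g: "g \<tau> = 0"
  shows "qweight \<rho> g \<tau> p y xs s \<le> 1"
proof (induction xs arbitrary: s)
  case (Cons a xs)
  obtain x e where a: "a = (x, e)" by (cases a)
  have 1: "(if c then 1 + g \<tau> else 1) = 1" for c using g by simp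
  show ?case unfolding a qweight.simps 1 mult_1_right
    by (intro mult_le_one weight_le_1 Cons.IH mult_nonneg_nonneg weight_nonneg qweight_nonneg assms)
qed simp

lemma rweight_le_1:
  assumes "\<And>\<tau> x. 0 \<le> \<rho> \<tau> x" "\<And>\<tau> x. \<rho> \<tau> x \<le> 1" and g: "\<And>\<tau>. 0 \<le> g \<tau>"
  shows "(\<And>i. i < length r \<Longrightarrow> g (\<tau> + i) = 0) \<Longrightarrow> rweight \<rho> g \<tau> \<sigma> r s \<le> 1"
proof (induction r arbitrary: \<tau> \<sigma> s)
  case (Cons a r)
  obtain \<pi> \<delta> where a: "a = (\<pi>, \<delta>)" by (cases a)
  have "g \<tau> = 0" using Cons.prems[of 0] by simp
  then have "mweight \<rho> g \<tau> \<sigma> \<pi> \<delta> s \<le> 1"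
    unfolding mweight_def
    by (intro mult_le_one weight_le_1 qweight_le_1 qweight_nonneg assms)
  moreover have "rweight \<rho> g (Suc \<tau>) \<sigma>' r s' \<le> 1" for \<sigma>' s'
    using Cons.prems[of "Suc _"] by (intro Cons.IH) simp
  ultimately show ?case unfolding a rweight.simps
    by (intro mult_le_one rweight_nonneg assms)
qed simp

lemma qpost_stamp: "qpost \<tau> p y xs s a = s a \<or> snd (qpost \<tau> p y xs s a) = \<tau>"
proof (induction \<tau> p y xs s rule: qpost.induct)
  case (2 \<tau> p y x e xs s)
  then show ?case unfolding qpost.simps by (metis post_stamp)
qed simp

lemma mpost_stamp: "mpost \<tau> \<sigma> \<pi> \<delta> s a = s a \<or> snd (mpost \<tau> \<sigma> \<pi> \<delta> s a) = \<tau>"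
  unfolding mpost_def by (metis qpost_stamp post_stamp)

text \<open>Makes changed contents visible in the stamps: a cell that differs from before the run
  was last written during it. This is how \<open>\<rho>_hit\<close> comes about for the left half of
  a node.\<close>

lemma rpost_stamp:
  "rpost \<tau> \<sigma> r s a = s a \<or> snd (rpost \<tau> \<sigma> r s a) \<in> {\<tau>..<\<tau> + length r}"
proof (induction \<tau> \<sigma> r s rule: rpost.induct)
  case (2 \<tau> \<sigma> \<pi> \<delta> r s)
  have "mpost \<tau> \<sigma> \<pi> \<delta> s a = s a \<or> snd (mpost \<tau> \<sigma> \<pi> \<delta> s a) = \<tau>" by (rule mpost_stamp)
  moreover have "rpost (Suc \<tau>) (\<sigma>(column \<tau> := \<pi>)) r (mpost \<tau> \<sigma> \<pi> \<delta> s) a = mpost \<tau> \<sigma> \<pi> \<delta> s a \<or>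
    snd (rpost (Suc \<tau>) (\<sigma>(column \<tau> := \<pi>)) r (mpost \<tau> \<sigma> \<pi> \<delta> s) a) \<in> {Suc \<tau>..<Suc \<tau> + length r}"
    by (rule 2)
  ultimately show ?case by (auto simp only: rpost.simps list.size atLeastLessThan_iff)
qed simp

lemma word_bounded_update_tree:
  "p < 2 ^ L \<Longrightarrow> (\<And>x. x < 2 ^ L \<Longrightarrow> \<pi> x < 2 ^ L) \<Longrightarrow> word_bounded w (update_tree p \<pi>)"
  unfolding update_tree_def by (intro word_bounded_tree_of P update_ops_on)

lemma word_bounded_query_tree:
  "p < 2 ^ L \<Longrightarrow> x < 2 ^ L \<Longrightarrow> 0 < z \<Longrightarrow> z < 2 ^ L \<Longrightarrow> word_bounded w (query_tree p x z)"
  unfolding query_tree_def by (intro word_bounded_bind_tree P cut_op_on query_op_on)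

lemma word_bounded_link_tree: "0 < z \<Longrightarrow> z < 2 ^ L \<Longrightarrow> word_bounded w (link_tree z)"
  unfolding link_tree_def by (intro P link_op_on)

definition perms :: "(nat \<Rightarrow> nat) set" where
  "perms = {\<pi>. \<pi> permutes {..<2 ^ L}}"

abbreviation depths :: "nat list set" where
  "depths \<equiv> words (2 ^ L) {..<L}"

lemma permD: "\<pi> \<in> perms \<Longrightarrow> x < 2 ^ L \<Longrightarrow> \<pi> x < 2 ^ L"
  unfolding perms_def using permutes_in_image[of \<pi> "{..<2 ^ L}" x] by simp

lemma finite_perms: "finite perms" and card_perms: "card perms = fact (2 ^ L)"
  unfolding perms_def by (simp_all add: finite_permutations card_permutations)

lemma target_less:
  assumes "\<And>p. \<sigma> p \<in> perms" "\<pi> \<in> perms" "x < 2 ^ L"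
  shows "target \<tau> \<sigma> \<pi> x < 2 ^ L"
proof -
  have "target \<tau> \<sigma> \<pi> \<in> perms"
    using assms unfolding target_def perms_def by (auto intro!: suffix_map_permutes)
  then show ?thesis using assms(3) by (rule permD)
qed

lemma word_memory_qpost:
  assumes "p < 2 ^ L" "\<And>x. x < 2 ^ L \<Longrightarrow> y x < 2 ^ L"
  shows "set xs \<subseteq> {..<2 ^ L} \<times> {..<L} \<Longrightarrow> word_memory w (fst \<circ> s) \<Longrightarrow> word_memory w (fst \<circ> qpost \<tau> p y xs s)"
proof (induction xs arbitrary: s)
  case (Cons a xs)
  obtain x e where a: "a = (x, e)" by (cases a)
  with Cons.prems have xe: "x < 2 ^ L" "e < L" by auto
  then have z: "0 < cutpoint e (y x)" "cutpoint e (y x) < 2 ^ L"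
    using assms(2) cutpoint_less cutpoint_pos by auto
  have xs: "set xs \<subseteq> {..<2 ^ L} \<times> {..<L}" using Cons.prems(1) by simp
  show ?case unfolding a qpost.simps
    by (intro Cons.IH xs word_memory_post word_bounded_query_tree word_bounded_link_tree
        Cons.prems(2) z xe assms(1))
qed simp

lemma zip_depths:
  assumes "\<delta> \<in> depths"
  shows "set (zip [0..<2 ^ L] \<delta>) \<subseteq> {..<2 ^ L} \<times> {..<L}" "length (zip [0..<2 ^ L] \<delta>) = 2 ^ L"
proof -
  show "set (zip [0..<2 ^ L] \<delta>) \<subseteq> {..<2 ^ L} \<times> {..<L}"
    by (rule set_zip_subset[OF _ wordsD(1)[OF assms]]) auto
  show "length (zip [0..<2 ^ L] \<delta>) = 2 ^ L" by (simp add: wordsD(2)[OF assms])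
qed

lemma word_memory_mpost:
  assumes "\<tau> < 2 ^ L" "\<And>p. \<sigma> p \<in> perms" "\<pi> \<in> perms" "\<delta> \<in> depths" "word_memory w (fst \<circ> s)"
  shows "word_memory w (fst \<circ> mpost \<tau> \<sigma> \<pi> \<delta> s)"
  unfolding mpost_def
proof (rule word_memory_qpost)
  show "set (zip [0..<2 ^ L] \<delta>) \<subseteq> {..<2 ^ L} \<times> {..<L}"
    by (rule zip_depths[OF assms(4)])
  show "word_memory w (fst \<circ> post (update_tree (column \<tau>) \<pi>) s \<tau>)"
    by (rule word_memory_post[OF word_bounded_update_tree[OF rev_pos_less permD[OF assms(3)]] assms(5)])
  show "target \<tau> \<sigma> \<pi> x < 2 ^ L" if "x < 2 ^ L" for x
    by (rule target_less[OF assms(2,3) that])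
qed (rule rev_pos_less)

lemma config_perms:
  "(\<And>p. \<sigma> p \<in> perms) \<Longrightarrow> set ps \<subseteq> perms \<Longrightarrow> config L \<tau> \<sigma> ps p \<in> perms"
  unfolding perms_def using config_permutes[of \<sigma> "{..<2 ^ L}" ps L \<tau> p] by auto

lemma word_memory_rpost:
  "\<tau> + length r \<le> 2 ^ L \<Longrightarrow> (\<And>p. \<sigma> p \<in> perms) \<Longrightarrow> set r \<subseteq> perms \<times> depths \<Longrightarrow>
    word_memory w (fst \<circ> s) \<Longrightarrow> word_memory w (fst \<circ> rpost \<tau> \<sigma> r s)"
proof (induction r arbitrary: \<tau> \<sigma> s)
  case (Cons a r)
  obtain \<pi> \<delta> where a: "a = (\<pi>, \<delta>)" by (cases a)
  have \<pi>: "\<pi> \<in> perms" and \<delta>: "\<delta> \<in> depths" and r: "set r \<subseteq> perms \<times> depths"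
    using Cons.prems(3) unfolding a by auto
  have \<sigma>: "(\<sigma>(column \<tau> := \<pi>)) p \<in> perms" for p using Cons.prems(2) \<pi> by simp
  have \<tau>: "\<tau> < 2 ^ L" "Suc \<tau> + length r \<le> 2 ^ L" using Cons.prems(1) by auto
  show ?case unfolding a rpost.simps
    by (intro Cons.IH word_memory_mpost \<tau> \<sigma> \<pi> \<delta> r Cons.prems(2,4))
qed simp

end

section \<open>The game over a whole right half\<close>

locale node = process L w P + game L w \<eta> \<rho> times U base stale
  for L w P \<eta> \<rho> times and U :: "'a set" and base stale +
  fixes g :: "nat \<Rightarrow> real"
  assumes g: "\<And>\<tau>. \<tau> \<in> times \<Longrightarrow> g \<tau> = \<eta>"
begin

lemma bounded_by_weaken:
  assumes "bounded_by Q c F" "\<And>S. S \<subseteq> U \<Longrightarrow> P' S \<Longrightarrow> Q S"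
  shows "bounded_by P' c F"
  unfolding bounded_by_def
proof (intro conjI allI impI)
  show "0 \<le> F \<alpha> s" for \<alpha> s by (rule bounded_by_nonneg[OF assms(1)])
  fix S s K \<mu> assume S: "P' S" "consistent S s K \<mu>"
  then have "S \<subseteq> U" unfolding consistent_def by blast
  then show "(\<Sum>\<alpha>\<in>S. F \<alpha> (s \<alpha>)) \<le> c * size_of S"
    using S assms(2) by (intro bounded_byD[OF assms(1)]) auto
qed

lemma hereditary_agree:
  assumes "hereditary Q"
  shows "hereditary (\<lambda>S. Q S \<and> (\<forall>\<alpha>\<in>S. \<forall>\<beta>\<in>S. y \<alpha> = y \<beta>))"
  unfolding hereditary_def
proof (intro allI impI)
  fix S T assume *: "Q S \<and> (\<forall>\<alpha>\<in>S. \<forall>\<beta>\<in>S. y \<alpha> = y \<beta>)" "T \<subseteq> S"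
  have QS: "Q S" by (rule conjunct1[OF *(1)])
  have "Q T" by (rule hereditaryD[OF assms QS *(2)])
  moreover have "\<forall>\<alpha>\<in>T. \<forall>\<beta>\<in>T. y \<alpha> = y \<beta>" using * by fast
  ultimately show "Q T \<and> (\<forall>\<alpha>\<in>T. \<forall>\<beta>\<in>T. y \<alpha> = y \<beta>)" ..
qed

text \<open>Backward induction over the queries of one time. Each of them multiplies the constant by
  \<open>L * (1 + exp \<eta>)\<close>, the \<open>L\<close> coming from the sum over the depths, and
  passes on a set on which \<open>y\<close> is constant at one more vertex; so \<open>F\<close> has
  to be bounded only where all these positions agree.\<close>

lemma bounded_by_queries:
  fixes y :: "'a \<Rightarrow> nat \<Rightarrow> nat"
  assumes her: "hereditary Q"
    and c: "0 \<le> c" and \<tau>: "\<tau> \<in> times" and p: "p < 2 ^ L"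
    and y: "\<And>\<alpha> x. \<alpha> \<in> U \<Longrightarrow> x < 2 ^ L \<Longrightarrow> y \<alpha> x < 2 ^ L"
  shows "set xs \<subseteq> {..<2 ^ L} \<Longrightarrow>
    bounded_by (\<lambda>S. Q S \<and> (\<forall>x\<in>set xs. \<forall>\<alpha>\<in>S. \<forall>\<beta>\<in>S. y \<alpha> x = y \<beta> x)) c F \<Longrightarrow>
    bounded_by Q (c * (real L * (1 + exp \<eta>)) ^ length xs)
      (\<lambda>\<alpha> s. \<Sum>\<delta>\<in>words (length xs) {..<L}. qweight \<rho> g \<tau> p (y \<alpha>) (zip xs \<delta>) s
         * F \<alpha> (qpost \<tau> p (y \<alpha>) (zip xs \<delta>) s))"
  using her
proof (induction xs arbitrary: Q)
  case Nil
  have "bounded_by Q c F" by (rule bounded_by_weaken[OF Nil(2)]) simp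
  then show ?case by simp
next
  case (Cons x xs)
  let ?C = "real L * (1 + exp \<eta>)"
  let ?Q = "\<lambda>S. Q S \<and> (\<forall>\<alpha>\<in>S. \<forall>\<beta>\<in>S. y \<alpha> x = y \<beta> x)"
  define G where "G \<alpha> s = (\<Sum>\<delta>\<in>words (length xs) {..<L}. qweight \<rho> g \<tau> p (y \<alpha>) (zip xs \<delta>) s
         * F \<alpha> (qpost \<tau> p (y \<alpha>) (zip xs \<delta>) s))" for \<alpha> s
  have C: "0 \<le> ?C" by (intro mult_nonneg_nonneg add_nonneg_nonneg) auto
  have x: "x < 2 ^ L" using Cons.prems(1) by simp
  have G: "bounded_by ?Q (c * ?C ^ length xs) G"
    unfolding G_def
  proof (rule Cons.IH)
    show "set xs \<subseteq> {..<2 ^ L}" using Cons.prems(1) by simp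
    show "hereditary ?Q" by (rule hereditary_agree[OF Cons.prems(3)])
    show "bounded_by (\<lambda>S. ?Q S \<and> (\<forall>x\<in>set xs. \<forall>\<alpha>\<in>S. \<forall>\<beta>\<in>S. y \<alpha> x = y \<beta> x)) c F"
      by (rule bounded_by_weaken[OF Cons.prems(2)]) (unfold list.set(2), blast)
  qed
  have "bounded_by Q (c * ?C ^ length xs * ?C) (\<lambda>\<alpha> s. \<Sum>e<L. let z = cutpoint e (y \<alpha> x) in
      weight \<rho> (query_tree p x z) s \<tau> * (if answer (query_tree p x z) s \<tau> = (y \<alpha> x < z) then 1 + \<eta> else 1)
      * (weight \<rho> (link_tree z) (post (query_tree p x z) s \<tau>) \<tau> * G \<alpha> (post (link_tree z) (post (query_tree p x z) s \<tau>) \<tau>)))"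
    (is "bounded_by Q _ ?F")
  proof (rule bounded_by_query[OF Cons.prems(3) G _ \<tau>])
    show "0 \<le> c * ?C ^ length xs" by (intro mult_nonneg_nonneg c zero_le_power C)
    show "word_bounded w (query_tree p x z) \<and> word_bounded w (link_tree z)" if "0 < z" "z < 2 ^ L" for z
      using word_bounded_query_tree[OF p x that] word_bounded_link_tree[OF that] by simp
    show "y \<alpha> x < 2 ^ L" if "\<alpha> \<in> U" for \<alpha> by (rule y[OF that x])
  qed
  moreover have "?F = (\<lambda>\<alpha> s. \<Sum>\<delta>\<in>words (length (x # xs)) {..<L}. qweight \<rho> g \<tau> p (y \<alpha>) (zip (x # xs) \<delta>) s
         * F \<alpha> (qpost \<tau> p (y \<alpha>) (zip (x # xs) \<delta>) s))"
    unfolding list.size add_Suc_right add_0_right sum_words_Suc zip_Cons_Cons qweight.simps qpost.simps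
      G_def Let_def g[OF \<tau>] sum_distrib_left
    by (simp only: mult.assoc)
  ultimately show ?case by (simp only: list.size add_Suc_right add_0_right power_Suc mult_ac)
qed

text \<open>The backward induction over the times starts after the last query, when all arrivals
  agree on \<open>S\<close>. By then \<open>S\<close> has at most one element, so that
  \<open>size_of S\<close> equals its cardinality and the exponent below 1 costs nothing.\<close>

lemma bounded_by_run:
  assumes her: "hereditary Q"
    and times: "{\<tau>..<\<tau> + length ps} \<subseteq> times"
    and perms: "set ps \<subseteq> perms" "\<And>\<alpha> p. \<alpha> \<in> U \<Longrightarrow> \<sigma> \<alpha> p \<in> perms"
    and Q: "\<And>S. S \<subseteq> U \<Longrightarrow> Q S \<Longrightarrow> (\<And>j x \<alpha> \<beta>. j < length ps \<Longrightarrow> x < 2 ^ L \<Longrightarrow> \<alpha> \<in> S \<Longrightarrow> \<beta> \<in> S \<Longrightarrow>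
        arrival L \<tau> (\<sigma> \<alpha>) ps j x
        = arrival L \<tau> (\<sigma> \<beta>) ps j x) \<Longrightarrow> card S \<le> 1"
  shows "bounded_by Q ((real L * (1 + exp \<eta>)) ^ (2 ^ L * length ps))
      (\<lambda>\<alpha> s. \<Sum>ds\<in>words (length ps) depths. rweight \<rho> g \<tau> (\<sigma> \<alpha>) (zip ps ds) s)"
  using assms
proof (induction ps arbitrary: \<tau> \<sigma> Q)
  case Nil
  show ?case
    unfolding bounded_by_def
  proof (intro conjI allI impI)
    fix S s K \<mu> assume S: "Q S" "consistent S s K \<mu>"
    then have SU: "S \<subseteq> U" unfolding consistent_def by blast
    have "card S \<le> 1" by (rule Nil.prems(5)[OF SU S(1)]) simp
    then have "real (card S) \<le> size_of S"
      unfolding size_of_def by (cases "card S = 0") (auto simp: le_Suc_eq)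
    then show "(\<Sum>\<alpha>\<in>S. \<Sum>ds\<in>words (length []) depths. rweight \<rho> g \<tau> (\<sigma> \<alpha>) (zip [] ds) (s \<alpha>))
        \<le> (real L * (1 + exp \<eta>)) ^ (2 ^ L * length []) * size_of S" by simp
  qed simp
next
  case (Cons \<pi> ps)
  let ?C = "real L * (1 + exp \<eta>)"
  have C: "0 \<le> ?C" by (intro mult_nonneg_nonneg add_nonneg_nonneg) auto
  define \<sigma>' where "\<sigma>' \<alpha> = (\<sigma> \<alpha>)(column \<tau> := \<pi>)" for \<alpha>
  define y where "y \<alpha> = target \<tau> (\<sigma> \<alpha>) \<pi>" for \<alpha>
  define F where "F \<alpha> s = (\<Sum>ds\<in>words (length ps) depths. rweight \<rho> g (Suc \<tau>) (\<sigma>' \<alpha>) (zip ps ds) s)" for \<alpha> s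
  have \<pi>: "\<pi> \<in> perms" using Cons.prems(3) by simp
  have \<tau>: "\<tau> \<in> times" using Cons.prems(2) by auto
  let ?Q = "\<lambda>S. Q S \<and> (\<forall>x\<in>set [0..<2 ^ L]. \<forall>\<alpha>\<in>S. \<forall>\<beta>\<in>S. y \<alpha> x = y \<beta> x)"
  have F: "bounded_by ?Q (?C ^ (2 ^ L * length ps)) F"
    unfolding F_def
  proof (rule Cons.IH)
    show "hereditary ?Q"
      unfolding hereditary_def
    proof (intro allI impI)
      fix S T assume *: "?Q S" "T \<subseteq> S"
      have QS: "Q S" by (rule conjunct1[OF *(1)])
      have "Q T" by (rule hereditaryD[OF Cons.prems(1) QS *(2)])
      moreover have "\<forall>x\<in>set [0..<2 ^ L]. \<forall>\<alpha>\<in>T. \<forall>\<beta>\<in>T. y \<alpha> x = y \<beta> x" using * by fast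
      ultimately show "?Q T" ..
    qed
    show "{Suc \<tau>..<Suc \<tau> + length ps} \<subseteq> times" using Cons.prems(2) by auto
    show "set ps \<subseteq> perms" using Cons.prems(3) by simp
    show "\<sigma>' \<alpha> p \<in> perms" if "\<alpha> \<in> U" for \<alpha> p
      using Cons.prems(4)[OF that] \<pi> by (simp add: \<sigma>'_def)
    fix S assume S: "S \<subseteq> U" "?Q S"
      and ag: "\<And>j x \<alpha> \<beta>. j < length ps \<Longrightarrow> x < 2 ^ L \<Longrightarrow> \<alpha> \<in> S \<Longrightarrow> \<beta> \<in> S \<Longrightarrow>
        arrival L (Suc \<tau>) (\<sigma>' \<alpha>) ps j x
        = arrival L (Suc \<tau>) (\<sigma>' \<beta>) ps j x"
    show "card S \<le> 1"
    proof (rule Cons.prems(5)[OF S(1)])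
      show "Q S" by (rule conjunct1[OF S(2)])
      fix j x :: nat and \<alpha> \<beta> assume j: "j < length (\<pi> # ps)" and x: "x < 2 ^ L" and \<alpha>\<beta>: "\<alpha> \<in> S" "\<beta> \<in> S"
      show "arrival L \<tau> (\<sigma> \<alpha>) (\<pi> # ps) j x
        = arrival L \<tau> (\<sigma> \<beta>) (\<pi> # ps) j x"
      proof (cases j)
        case 0
        have "x \<in> set [0..<2 ^ L]" using x by simp
        with S(2) \<alpha>\<beta> have "y \<alpha> x = y \<beta> x" by blast
        then show ?thesis using 0 by (simp add: arrival_def y_def target_def)
      next
        case (Suc i)
        then show ?thesis using ag[of i x \<alpha> \<beta>] j x \<alpha>\<beta> by (simp add: arrival_def \<sigma>'_def)
      qed
    qed
  qed
  have CC: "0 \<le> ?C ^ (2 ^ L * length ps)" by (intro zero_le_power C)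
  have yl: "y \<alpha> x < 2 ^ L" if "\<alpha> \<in> U" "x < 2 ^ L" for \<alpha> x
    unfolding y_def by (rule target_less[OF Cons.prems(4)[OF that(1)] \<pi> that(2)])
  have q: "bounded_by Q (?C ^ (2 ^ L * length ps) * ?C ^ length [0..<2 ^ L])
      (\<lambda>\<alpha> s. \<Sum>\<delta>\<in>words (length [0..<2 ^ L]) {..<L}. qweight \<rho> g \<tau> (column \<tau>) (y \<alpha>) (zip [0..<2 ^ L] \<delta>) s
         * F \<alpha> (qpost \<tau> (column \<tau>) (y \<alpha>) (zip [0..<2 ^ L] \<delta>) s))"
    by (rule bounded_by_queries[OF Cons.prems(1) CC \<tau> rev_pos_less yl _ F]) auto
  have wb: "word_bounded w (update_tree (column \<tau>) \<pi>)"
    by (rule word_bounded_update_tree[OF rev_pos_less permD[OF \<pi>]])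
  have len: "length [0..<2 ^ L] = 2 ^ L" by simp
  have "bounded_by Q (?C ^ (2 ^ L * length ps) * ?C ^ 2 ^ L)
      (\<lambda>\<alpha> s. weight \<rho> (update_tree (column \<tau>) \<pi>) s \<tau> *
        (\<Sum>\<delta>\<in>depths. qweight \<rho> g \<tau> (column \<tau>) (y \<alpha>) (zip [0..<2 ^ L] \<delta>) (post (update_tree (column \<tau>) \<pi>) s \<tau>)
         * F \<alpha> (qpost \<tau> (column \<tau>) (y \<alpha>) (zip [0..<2 ^ L] \<delta>) (post (update_tree (column \<tau>) \<pi>) s \<tau>))))"
    (is "bounded_by Q _ ?F")
    by (rule bounded_by_tree[OF Cons.prems(1) q[unfolded len] _ \<tau> wb])
      (intro mult_nonneg_nonneg CC zero_le_power C)
  moreover have "?F = (\<lambda>\<alpha> s. \<Sum>ds\<in>words (length (\<pi> # ps)) depths. rweight \<rho> g \<tau> (\<sigma> \<alpha>) (zip (\<pi> # ps) ds) s)"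
    unfolding list.size add_Suc_right add_0_right sum_words_Suc zip_Cons_Cons rweight.simps mweight_def mpost_def
      F_def \<sigma>'_def y_def sum_distrib_left
    by (simp only: mult.assoc)
  moreover have "?C ^ (2 ^ L * length ps) * ?C ^ 2 ^ L = ?C ^ (2 ^ L * length (\<pi> # ps))"
    by (simp add: power_add)
  ultimately show ?case by (simp only:)
qed

end

section \<open>Expected weight at a level\<close>

lemma fact_ge_power: "(real n / exp 1) ^ n \<le> fact n"
proof -
  \<comment> \<open>A single term of the exponential series.\<close>
  have "real n ^ n /\<^sub>R fact n \<le> exp (real n)"
    unfolding exp_def using summable_exp_generic[of "real n"]
    by (intro sum_le_suminf[of _ "{n}", simplified]) auto
  then have "real n ^ n \<le> exp 1 ^ n * fact n"
    by (simp add: field_simps exp_of_nat_mult[symmetric])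
  then show ?thesis by (simp add: power_divide field_simps)
qed

text \<open>The times \<open>s\<close> and \<open>t\<close> lie in the left and right half of the same node of level \<open>l\<close>. A read at
  time \<open>t\<close> of a cell last written at time \<open>s\<close> is thus charged at one level at most.\<close>

definition crossing :: "nat \<Rightarrow> nat \<Rightarrow> nat \<Rightarrow> bool" where
  "crossing l s t \<longleftrightarrow> even (s div 2 ^ l) \<and> odd (t div 2 ^ l) \<and> s div 2 ^ Suc l = t div 2 ^ Suc l"

context process
begin

text \<open>The base price is paid at all levels and multiplies up to 1 / 2; the large one is paid
  only at the level where the read crosses from a left to a right half. Over all levels a read thus
  costs a constant if \<open>w = O(L)\<close>.\<close>

definition level_read :: "real \<Rightarrow> nat \<Rightarrow> nat \<Rightarrow> nat \<Rightarrow> real" where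
  "level_read \<eta> l t s = 2 powr (- (1 / real L)) *
     (if crossing l s t then 2 powr (- (real w / real L)) / (1 + \<eta>) else 1)"

definition level_gain :: "real \<Rightarrow> nat \<Rightarrow> nat \<Rightarrow> real" where
  "level_gain \<eta> l t = (if odd (t div 2 ^ l) then \<eta> else 0)"

abbreviation lweight where
  "lweight \<eta> l \<equiv> rweight (level_read \<eta> l) (level_gain \<eta> l)"

abbreviation lmweight where
  "lmweight \<eta> l \<equiv> mweight (level_read \<eta> l) (level_gain \<eta> l)"

abbreviation lqweight where
  "lqweight \<eta> l \<equiv> qweight (level_read \<eta> l) (level_gain \<eta> l)"

text \<open>The game with \<open>U\<close> the set of left halves \<alpha>. The depths \<delta> of
  the left half and the permutations \<beta> of the right half are fixed, as Bob is to know
  everything except \<alpha>; only the right depths are summed over along with \<alpha>.\<close>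

lemma right_half_sum:
  assumes \<eta>: "0 \<le> \<eta>" and Llr: "L = Suc (l + r)" and q: "q < 2 ^ r" and \<tau>: "\<tau> = 2 ^ Suc l * q"
    and \<sigma>: "\<And>p. \<sigma> p \<in> perms" and s: "word_memory w (fst \<circ> s)"
    and \<beta>: "\<beta> \<in> words (2 ^ l) perms" and \<delta>: "\<delta> \<in> words (2 ^ l) depths"
  shows "(\<Sum>\<alpha>\<in>words (2 ^ l) perms. \<Sum>\<delta>'\<in>words (2 ^ l) depths.
      lweight \<eta> l (\<tau> + 2 ^ l) (config L \<tau> \<sigma> \<alpha>) (zip \<beta> \<delta>') (rpost \<tau> \<sigma> (zip \<alpha> \<delta>) s))
    \<le> (real L * (1 + exp \<eta>)) ^ (2 ^ L * 2 ^ l) * (fact (2 ^ L) ^ 2 ^ l) powr (1 - 1 / real L)"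
proof -
  define base where "base \<alpha> = rpost \<tau> \<sigma> (zip \<alpha> \<delta>) s" for \<alpha>
  define U where "U = words (2 ^ l) perms"
  define times where "times = {\<tau> + 2 ^ l..<\<tau> + 2 ^ l + 2 ^ l}"
  have bound: "\<tau> + 2 ^ l + 2 ^ l \<le> 2 ^ L"
  proof -
    have "2 ^ Suc l * Suc q \<le> 2 ^ Suc l * (2::nat) ^ r" using q by (intro mult_left_mono) auto
    then show ?thesis unfolding \<tau> Llr by (simp add: power_add algebra_simps)
  qed
  have len: "length \<alpha> = 2 ^ l" "set \<alpha> \<subseteq> perms" if "\<alpha> \<in> U" for \<alpha>
    using that unfolding U_def words_def by auto
  have \<beta>': "length \<beta> = 2 ^ l" "set \<beta> \<subseteq> perms" using \<beta> unfolding words_def by auto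
  have \<delta>': "length \<delta> = 2 ^ l" "set \<delta> \<subseteq> depths" using \<delta> unfolding words_def by auto
  have cross: "crossing l x t" if "x \<in> {\<tau>..<\<tau> + 2 ^ l}" "t \<in> times" for x t
  proof -
    have x: "x div 2 ^ l = 2 * q"
      using that(1) unfolding \<tau> by (intro div_nat_eqI) (auto simp: algebra_simps)
    have t: "t div 2 ^ l = 2 * q + 1"
      using that(2) unfolding \<tau> times_def by (intro div_nat_eqI) (auto simp: algebra_simps)
    show ?thesis
      unfolding crossing_def power_Suc2 div_mult2_eq x t by simp
  qed
  interpret node L w P \<eta> "level_read \<eta> l" times U base "fst \<circ> s" "level_gain \<eta> l"
  proof unfold_locales
    show "finite U" unfolding U_def by (intro finite_words finite_perms)
    show "0 \<le> level_read \<eta> l t x" for t x using \<eta> by (simp add: level_read_def)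
    have "2 powr (- (real w / real L)) / (1 + \<eta>) \<le> 1"
    proof -
      have "2 powr (- (real w / real L)) \<le> (2::real) powr 0" by (intro powr_mono) auto
      then show ?thesis using \<eta> by simp
    qed
    then show "level_read \<eta> l t x \<le> 2 powr (- (1 / real L))" for t x
      unfolding level_read_def by (intro mult_left_le) auto
    show "level_read \<eta> l t (snd (base \<alpha> a)) \<le> 2 powr (- (1 / real L)) * (2 powr (- (real w / real L)) / (1 + \<eta>))"
      if "\<alpha> \<in> U" "fst (base \<alpha> a) \<noteq> (fst \<circ> s) a" "t \<in> times" for \<alpha> a t
    proof -
      have "snd (base \<alpha> a) \<in> {\<tau>..<\<tau> + length (zip \<alpha> \<delta>)}"
        using rpost_stamp[of \<tau> \<sigma> "zip \<alpha> \<delta>" s a] that(2) unfolding base_def by auto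
      then have "crossing l (snd (base \<alpha> a)) t"
        using len[OF that(1)] \<delta>' by (intro cross that(3)) simp
      then show ?thesis by (simp add: level_read_def)
    qed
    show "level_gain \<eta> l t = \<eta>" if "t \<in> times" for t
      using cross[of \<tau> t] that unfolding crossing_def level_gain_def by simp
  qed (use L \<eta> in auto)
  have "bounded_by (\<lambda>_. True) ((real L * (1 + exp \<eta>)) ^ (2 ^ L * length \<beta>))
      (\<lambda>\<alpha> s. \<Sum>ds\<in>words (length \<beta>) depths. lweight \<eta> l (\<tau> + 2 ^ l) (config L \<tau> \<sigma> \<alpha>) (zip \<beta> ds) s)"
  proof (rule bounded_by_run)
    show "hereditary (\<lambda>_. True)" by (simp add: hereditary_def)
    show "{\<tau> + 2 ^ l..<\<tau> + 2 ^ l + length \<beta>} \<subseteq> times" unfolding times_def \<beta>' by simp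
    show "set \<beta> \<subseteq> perms" by (rule \<beta>')
    show "config L \<tau> \<sigma> \<alpha> p \<in> perms" if "\<alpha> \<in> U" for \<alpha> p
      by (rule config_perms[OF \<sigma> len(2)[OF that]])
    fix S assume S: "S \<subseteq> U" and ag: "\<And>j x \<alpha> \<alpha>'. j < length \<beta> \<Longrightarrow> x < 2 ^ L \<Longrightarrow> \<alpha> \<in> S \<Longrightarrow> \<alpha>' \<in> S \<Longrightarrow>
       arrival L (\<tau> + 2 ^ l) (config L \<tau> \<sigma> \<alpha>) \<beta> j x
        = arrival L (\<tau> + 2 ^ l) (config L \<tau> \<sigma> \<alpha>') \<beta> j x"
    have "\<alpha> = \<alpha>'" if "\<alpha> \<in> S" "\<alpha>' \<in> S" for \<alpha> \<alpha>'
    proof (rule left_half_determined[OF Llr q \<tau>])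
      have U: "\<alpha> \<in> U" "\<alpha>' \<in> U" using that S by auto
      show "length \<alpha> = 2 ^ l" "length \<alpha>' = 2 ^ l" "length \<beta> = 2 ^ l" using len U \<beta>' by auto
      show "\<sigma> p permutes {..<2 ^ L}" for p using \<sigma>[of p] unfolding perms_def by simp
      show "\<pi> permutes {..<2 ^ L}" if "\<pi> \<in> set \<alpha>" for \<pi> using that len(2)[OF U(1)] unfolding perms_def by blast
      show "\<pi> permutes {..<2 ^ L}" if "\<pi> \<in> set \<alpha>'" for \<pi> using that len(2)[OF U(2)] unfolding perms_def by blast
      show "\<pi> permutes {..<2 ^ L}" if "\<pi> \<in> set \<beta>" for \<pi> using that \<beta>'(2) unfolding perms_def by blast
      fix j x :: nat assume "j < 2 ^ l" "x \<in> {..<2 ^ L :: nat}"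
      then show "arrival L (\<tau> + 2 ^ l) (config L \<tau> \<sigma> \<alpha>) \<beta> j x
        = arrival L (\<tau> + 2 ^ l) (config L \<tau> \<sigma> \<alpha>') \<beta> j x"
        using that \<beta>'(1) by (intro ag) simp_all
    qed
    moreover have "finite S" by (rule finite_subset[OF S finite_U])
    ultimately show "card S \<le> 1" unfolding One_nat_def by (subst card_le_Suc0_iff_eq) blast+
  qed
  \<comment> \<open>At the start Bob knows no cell, and \<mu> is the memory before the left
    half.\<close>
  moreover have "consistent U base {} (fst \<circ> s)"
    unfolding consistent_def
  proof (intro conjI allI ballI impI)
    fix \<alpha> assume \<alpha>: "\<alpha> \<in> U"
    show "word_memory w (fst \<circ> base \<alpha>)"
      unfolding base_def
    proof (rule word_memory_rpost[OF _ \<sigma> _ s])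
      show "\<tau> + length (zip \<alpha> \<delta>) \<le> 2 ^ L" using bound len(1)[OF \<alpha>] \<delta>' by simp
      show "set (zip \<alpha> \<delta>) \<subseteq> perms \<times> depths"
        by (rule set_zip_subset[OF len(2)[OF \<alpha>] \<delta>'(2)])
    qed
  qed auto
  ultimately have "(\<Sum>\<alpha>\<in>U. \<Sum>ds\<in>words (length \<beta>) depths. lweight \<eta> l (\<tau> + 2 ^ l) (config L \<tau> \<sigma> \<alpha>) (zip \<beta> ds) (base \<alpha>))
      \<le> (real L * (1 + exp \<eta>)) ^ (2 ^ L * length \<beta>) * size_of U"
    by (intro bounded_byD[of "\<lambda>_. True"]) auto
  then show ?thesis
    unfolding U_def base_def \<beta>' size_of_def by (simp add: card_words finite_perms card_perms)
qed

text \<open>The first factor counts what is fixed in the game, the right permutations and the left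
  depths; the second bounds the sum over the rest.\<close>

definition node_bound :: "real \<Rightarrow> nat \<Rightarrow> real" where
  "node_bound \<eta> l = (fact (2 ^ L) ^ 2 ^ l * (real L ^ 2 ^ L) ^ 2 ^ l) *
     ((real L * (1 + exp \<eta>)) ^ (2 ^ L * 2 ^ l) * (fact (2 ^ L) ^ 2 ^ l) powr (1 - 1 / real L))"

lemma node_bound_nonneg: "0 \<le> node_bound \<eta> l"
  unfolding node_bound_def by (intro mult_nonneg_nonneg zero_le_power add_nonneg_nonneg) auto

lemma card_depths: "card depths = L ^ 2 ^ L" "finite depths"
  by (simp_all add: card_words finite_words)

lemma level_read_nonneg: "0 \<le> \<eta> \<Longrightarrow> 0 \<le> level_read \<eta> l t x"
  by (simp add: level_read_def)

lemma level_read_le_1: "0 \<le> \<eta> \<Longrightarrow> level_read \<eta> l t x \<le> 1"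
proof -
  assume \<eta>: "0 \<le> \<eta>"
  have "2 powr (- (real w / real L)) \<le> (2::real) powr 0" "2 powr (- (1 / real L)) \<le> (2::real) powr 0"
    by (intro powr_mono; simp)+
  then show ?thesis unfolding level_read_def using \<eta> by (intro mult_le_one) auto
qed

lemma level_gain_nonneg: "0 \<le> \<eta> \<Longrightarrow> 0 \<le> level_gain \<eta> l t"
  by (simp add: level_gain_def)

text \<open>No answer is rewarded in the left half, so its weight is at most 1 and may be dropped.
  The sum over the left permutations can then be moved inside, next to the right depths.\<close>

lemma node_sum:
  assumes \<eta>: "0 \<le> \<eta>" and Llr: "L = Suc (l + r)" and q: "q < 2 ^ r" and \<tau>: "\<tau> = 2 ^ Suc l * q"
    and \<sigma>: "\<And>p. \<sigma> p \<in> perms" and s: "word_memory w (fst \<circ> s)"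
  shows "(\<Sum>ps\<in>words (2 ^ Suc l) perms. \<Sum>ds\<in>words (2 ^ Suc l) depths.
      lweight \<eta> l \<tau> \<sigma> (zip ps ds) s) \<le> node_bound \<eta> l"
proof -
  let ?k = "2 ^ l :: nat"
  let ?B = "(real L * (1 + exp \<eta>)) ^ (2 ^ L * 2 ^ l) * (fact (2 ^ L) ^ 2 ^ l) powr (1 - 1 / real L)"
  let ?W = "\<lambda>\<alpha> \<beta> \<delta> \<delta>'. lweight \<eta> l (\<tau> + ?k) (config L \<tau> \<sigma> \<alpha>) (zip \<beta> \<delta>') (rpost \<tau> \<sigma> (zip \<alpha> \<delta>) s)"
  have k: "(2::nat) ^ Suc l = ?k + ?k" by simp
  have le: "lweight \<eta> l \<tau> \<sigma> (zip (\<alpha> @ \<beta>) (\<delta> @ \<delta>')) s \<le> ?W \<alpha> \<beta> \<delta> \<delta>'"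
    if "\<alpha> \<in> words ?k perms" "\<delta> \<in> words ?k depths" for \<alpha> \<beta> \<delta> \<delta>'
  proof -
    have len: "length \<alpha> = ?k" "length \<delta> = ?k" using that unfolding words_def by auto
    have "level_gain \<eta> l (\<tau> + i) = 0" if "i < length (zip \<alpha> \<delta>)" for i
    proof -
      have "(\<tau> + i) div 2 ^ l = 2 * q"
        using that len unfolding \<tau> by (intro div_nat_eqI) (auto simp: algebra_simps)
      then show ?thesis by (simp add: level_gain_def)
    qed
    then have "lweight \<eta> l \<tau> \<sigma> (zip \<alpha> \<delta>) s \<le> 1"
      by (intro rweight_le_1 level_read_nonneg level_read_le_1 level_gain_nonneg \<eta>)
    moreover have "0 \<le> ?W \<alpha> \<beta> \<delta> \<delta>'"
      by (intro rweight_nonneg level_read_nonneg level_gain_nonneg \<eta>)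
    ultimately have "lweight \<eta> l \<tau> \<sigma> (zip \<alpha> \<delta>) s * ?W \<alpha> \<beta> \<delta> \<delta>' \<le> 1 * ?W \<alpha> \<beta> \<delta> \<delta>'"
      by (intro mult_right_mono)
    then show ?thesis using len by (simp add: rweight_append)
  qed
  have "(\<Sum>ps\<in>words (2 ^ Suc l) perms. \<Sum>ds\<in>words (2 ^ Suc l) depths. lweight \<eta> l \<tau> \<sigma> (zip ps ds) s)
    = (\<Sum>\<alpha>\<in>words ?k perms. \<Sum>\<beta>\<in>words ?k perms. \<Sum>\<delta>\<in>words ?k depths. \<Sum>\<delta>'\<in>words ?k depths.
        lweight \<eta> l \<tau> \<sigma> (zip (\<alpha> @ \<beta>) (\<delta> @ \<delta>')) s)"
    unfolding k sum_words_append ..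
  also have "\<dots> \<le> (\<Sum>\<alpha>\<in>words ?k perms. \<Sum>\<beta>\<in>words ?k perms. \<Sum>\<delta>\<in>words ?k depths. \<Sum>\<delta>'\<in>words ?k depths. ?W \<alpha> \<beta> \<delta> \<delta>')"
    by (intro sum_mono le)
  also have "\<dots> = (\<Sum>\<beta>\<in>words ?k perms. \<Sum>\<delta>\<in>words ?k depths. \<Sum>\<alpha>\<in>words ?k perms. \<Sum>\<delta>'\<in>words ?k depths. ?W \<alpha> \<beta> \<delta> \<delta>')"
    by (subst sum.swap, rule sum.cong[OF refl], rule sum.swap)
  also have "\<dots> \<le> (\<Sum>\<beta>\<in>words ?k perms. \<Sum>\<delta>\<in>words ?k depths. ?B)"
    by (intro sum_mono right_half_sum[OF \<eta> Llr q \<tau> \<sigma> s])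
  also have "\<dots> = node_bound \<eta> l"
    unfolding node_bound_def by (simp add: card_words finite_perms card_perms card_depths)
  finally show ?thesis .
qed

text \<open>The bound for one node holds for every configuration and memory at its start, so the
  bounds for the nodes of a level multiply although each node depends on the preceding ones.\<close>

lemma nodes_sum:
  assumes \<eta>: "0 \<le> \<eta>" and Llr: "L = Suc (l + r)"
    and \<sigma>: "\<And>p. \<sigma> p \<in> perms" and s: "word_memory w (fst \<circ> s)"
  shows "j \<le> 2 ^ r \<Longrightarrow> (\<Sum>ps\<in>words (2 ^ Suc l * j) perms. \<Sum>ds\<in>words (2 ^ Suc l * j) depths.
      lweight \<eta> l 0 \<sigma> (zip ps ds) s) \<le> node_bound \<eta> l ^ j"
proof (induction j)
  case (Suc j)
  let ?k = "2 ^ Suc l :: nat"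
  let ?n = "?k * j"
  let ?W = "\<lambda>ps ds. lweight \<eta> l 0 \<sigma> (zip ps ds) s"
  let ?V = "\<lambda>ps ds ps' ds'. lweight \<eta> l ?n (config L 0 \<sigma> ps) (zip ps' ds') (rpost 0 \<sigma> (zip ps ds) s)"
  have j: "j < 2 ^ r" using Suc.prems by simp
  have n: "?k * Suc j = ?n + ?k" by simp
  have bound: "?n \<le> 2 ^ L"
  proof -
    have "?k * j \<le> ?k * 2 ^ r" using j by (intro mult_left_mono) auto
    then show ?thesis unfolding Llr by (simp add: power_add)
  qed
  have eq: "?W (ps @ ps') (ds @ ds') = ?W ps ds * ?V ps ds ps' ds'"
    if "ps \<in> words ?n perms" "ds \<in> words ?n depths" for ps ds ps' ds'
  proof -
    have "length ps = ?n" "length ds = ?n" using that unfolding words_def by auto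
    then show ?thesis by (simp add: rweight_append del: power_Suc)
  qed
  have inner: "(\<Sum>ps'\<in>words ?k perms. \<Sum>ds'\<in>words ?k depths. ?V ps ds ps' ds') \<le> node_bound \<eta> l"
    if "ps \<in> words ?n perms" "ds \<in> words ?n depths" for ps ds
  proof (rule node_sum[OF \<eta> Llr j refl])
    have len: "length ps = ?n" "length ds = ?n" "set ps \<subseteq> perms" "set ds \<subseteq> depths"
      using that unfolding words_def by auto
    show "config L 0 \<sigma> ps p \<in> perms" for p by (rule config_perms[OF \<sigma> len(3)])
    show "word_memory w (fst \<circ> rpost 0 \<sigma> (zip ps ds) s)"
    proof (rule word_memory_rpost[OF _ \<sigma> _ s])
      show "0 + length (zip ps ds) \<le> 2 ^ L" using bound len by simp
      show "set (zip ps ds) \<subseteq> perms \<times> depths" by (rule set_zip_subset[OF len(3,4)])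
    qed
  qed
  have "(\<Sum>ps\<in>words (?n + ?k) perms. \<Sum>ds\<in>words (?n + ?k) depths. ?W ps ds)
    = (\<Sum>ps\<in>words ?n perms. \<Sum>ps'\<in>words ?k perms. \<Sum>ds\<in>words ?n depths. \<Sum>ds'\<in>words ?k depths.
        ?W (ps @ ps') (ds @ ds'))"
    unfolding sum_words_append ..
  also have "\<dots> = (\<Sum>ps\<in>words ?n perms. \<Sum>ds\<in>words ?n depths. \<Sum>ps'\<in>words ?k perms. \<Sum>ds'\<in>words ?k depths.
        ?W (ps @ ps') (ds @ ds'))"
    by (rule sum.cong[OF refl], rule sum.swap)
  also have "\<dots> = (\<Sum>ps\<in>words ?n perms. \<Sum>ds\<in>words ?n depths. ?W ps ds *
      (\<Sum>ps'\<in>words ?k perms. \<Sum>ds'\<in>words ?k depths. ?V ps ds ps' ds'))"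
    unfolding sum_distrib_left by (intro sum.cong refl eq)
  also have "\<dots> \<le> (\<Sum>ps\<in>words ?n perms. \<Sum>ds\<in>words ?n depths. ?W ps ds * node_bound \<eta> l)"
    by (intro sum_mono mult_left_mono inner rweight_nonneg level_read_nonneg level_gain_nonneg \<eta>)
  also have "\<dots> = (\<Sum>ps\<in>words ?n perms. \<Sum>ds\<in>words ?n depths. ?W ps ds) * node_bound \<eta> l"
    by (simp only: sum_distrib_right)
  also have "\<dots> \<le> node_bound \<eta> l ^ j * node_bound \<eta> l"
    using Suc.IH j by (intro mult_right_mono node_bound_nonneg) simp
  finally show ?case unfolding n by (simp only: power_Suc2)
qed simp

text \<open>Relative to the number of all choices, a factor
  \<open>fact (2 ^ L) powr (- 1 / L)\<close> is left over per time of the right half. As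
  \<open>(2 ^ L) powr (1 / L) = 2\<close>, the estimate \<open>n! \<ge> (n / e) ^ n\<close> makes
  this 1 / 2 per query up to \<open>exp (1 / L)\<close>, which turns 1 + exp \<eta> into the moment
  of a fair guess.\<close>

lemma node_bound_le:
  "node_bound \<eta> l \<le> (fact (2 ^ L) * real L ^ 2 ^ L) ^ 2 ^ Suc l
     * ((1 + exp \<eta>) / 2 * exp (1 / real L)) ^ (2 ^ L * 2 ^ l)"
proof -
  define F :: real where "F = fact (2 ^ L)"
  have F: "0 < F" unfolding F_def by simp
  have e: "(2 * exp (- (1 / real L))) ^ 2 ^ L \<le> F powr (1 / real L)"
  proof -
    have "((real (2 ^ L) / exp 1) ^ 2 ^ L) powr (1 / real L) \<le> F powr (1 / real L)"
      unfolding F_def by (intro powr_mono2 fact_ge_power) auto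
    moreover have "((real (2 ^ L) / exp 1) ^ 2 ^ L) powr (1 / real L)
        = ((real (2 ^ L) / exp 1) powr (1 / real L)) ^ 2 ^ L"
      by (simp add: powr_realpow[symmetric] powr_powr mult.commute)
    moreover have "(real (2 ^ L) / exp 1) powr (1 / real L) = 2 * exp (- (1 / real L))"
      using L by (simp add: powr_divide powr_powr powr_realpow[symmetric] exp_powr_real exp_minus field_simps)
    ultimately show ?thesis by simp
  qed
  have inv: "F powr (- (1 / real L)) \<le> (1 / 2 * exp (1 / real L)) ^ 2 ^ L"
  proof -
    have "inverse (F powr (1 / real L)) \<le> inverse ((2 * exp (- (1 / real L))) ^ 2 ^ L)"
      by (rule le_imp_inverse_le[OF e]) simp
    also have "\<dots> = inverse (2 * exp (- (1 / real L))) ^ 2 ^ L"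
      by (rule power_inverse[symmetric])
    also have "inverse (2 * exp (- (1 / real L))) = 1 / 2 * exp (1 / real L)"
      by (simp add: exp_minus)
    finally show ?thesis unfolding powr_minus .
  qed
  have "(F ^ 2 ^ l) powr (1 - 1 / real L) = F ^ 2 ^ l * (F powr (- (1 / real L))) ^ 2 ^ l"
  proof -
    have "(F ^ 2 ^ l) powr (1 - 1 / real L) = (F powr (1 - 1 / real L)) ^ 2 ^ l"
      using F by (simp add: powr_realpow[symmetric] powr_powr mult.commute)
    also have "F powr (1 - 1 / real L) = F * F powr (- (1 / real L))"
      using F by (simp add: powr_diff powr_minus divide_inverse)
    finally show ?thesis by (simp add: power_mult_distrib)
  qed
  also have "\<dots> \<le> F ^ 2 ^ l * ((1 / 2 * exp (1 / real L)) ^ 2 ^ L) ^ 2 ^ l"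
    using F by (intro mult_left_mono power_mono inv) auto
  finally have "node_bound \<eta> l \<le> (F ^ 2 ^ l * (real L ^ 2 ^ L) ^ 2 ^ l) * ((real L * (1 + exp \<eta>)) ^ (2 ^ L * 2 ^ l) *
      (F ^ 2 ^ l * ((1 / 2 * exp (1 / real L)) ^ 2 ^ L) ^ 2 ^ l))"
    unfolding node_bound_def F_def[symmetric] using F
    by (intro mult_left_mono mult_nonneg_nonneg zero_le_power add_nonneg_nonneg) auto
  also have "\<dots> = (F * real L ^ 2 ^ L) ^ 2 ^ Suc l
     * ((1 + exp \<eta>) / 2 * exp (1 / real L)) ^ (2 ^ L * 2 ^ l)"
  proof -
    have "(x ^ 2 ^ L) ^ 2 ^ l = x ^ (2 ^ L * 2 ^ l)" for x :: real
      by (simp add: power_mult)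
    moreover have "x ^ 2 ^ Suc l = x ^ 2 ^ l * x ^ 2 ^ l" for x :: real
      by (simp add: power_add[symmetric] mult_2)
    ultimately show ?thesis by (simp add: power_mult_distrib power_divide del: power_Suc)
  qed
  finally show ?thesis unfolding F_def .
qed

text \<open>The square root appears because only half of the \<open>4 ^ L\<close> queries lie in
  right halves of level \<open>l\<close>.\<close>

lemma level_sum:
  assumes \<eta>: "0 \<le> \<eta>" and l: "l < L"
    and \<sigma>: "\<And>p. \<sigma> p \<in> perms" and s: "word_memory w (fst \<circ> s)"
  shows "(\<Sum>ps\<in>words (2 ^ L) perms. \<Sum>ds\<in>words (2 ^ L) depths. lweight \<eta> l 0 \<sigma> (zip ps ds) s)
    \<le> (fact (2 ^ L) * real L ^ 2 ^ L) ^ 2 ^ L * sqrt ((1 + exp \<eta>) / 2 * exp (1 / real L)) ^ 4 ^ L"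
proof -
  define r where "r = L - Suc l"
  have Llr: "L = Suc (l + r)" using l unfolding r_def by simp
  have k: "2 ^ Suc l * 2 ^ r = (2::nat) ^ L" unfolding Llr by (simp add: power_add)
  define V where "V = (1 + exp \<eta>) / 2 * exp (1 / real L)"
  have V: "0 \<le> V" unfolding V_def by (intro mult_nonneg_nonneg) (auto simp: add_nonneg_nonneg)
  have "(\<Sum>ps\<in>words (2 ^ L) perms. \<Sum>ds\<in>words (2 ^ L) depths. lweight \<eta> l 0 \<sigma> (zip ps ds) s)
      \<le> node_bound \<eta> l ^ 2 ^ r"
    using nodes_sum[OF \<eta> Llr \<sigma> s, of "2 ^ r"] unfolding k by simp
  also have "\<dots> \<le> ((fact (2 ^ L) * real L ^ 2 ^ L) ^ 2 ^ Suc l * V ^ (2 ^ L * 2 ^ l)) ^ 2 ^ r"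
    unfolding V_def by (intro power_mono node_bound_le node_bound_nonneg)
  also have "\<dots> = (fact (2 ^ L) * real L ^ 2 ^ L) ^ (2 ^ Suc l * 2 ^ r) * V ^ (2 ^ L * (2 ^ l * 2 ^ r))"
    by (simp only: power_mult_distrib power_mult[symmetric] mult.assoc)
  also have "V ^ (2 ^ L * (2 ^ l * 2 ^ r)) = sqrt V ^ 4 ^ L"
  proof -
    have "V ^ (2 ^ L * (2 ^ l * 2 ^ r)) = (sqrt V ^ 2) ^ (2 ^ L * (2 ^ l * 2 ^ r))" using V by simp
    also have "\<dots> = sqrt V ^ (2 * (2 ^ L * (2 ^ l * 2 ^ r)))" by (simp only: power_mult)
    also have "2 * (2 ^ L * (2 ^ l * 2 ^ r)) = (2::nat) ^ L * 2 ^ L"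
      unfolding k[symmetric] by simp
    also have "(2::nat) ^ L * 2 ^ L = 4 ^ L" by (simp add: power_mult_distrib[symmetric])
    finally show ?thesis .
  qed
  finally show ?thesis unfolding k V_def .
qed

end

section \<open>The graphs\<close>

text \<open>On a cycle the least vertex has two distinct neighbours, both larger; but its only
  larger neighbour is its image under \<open>f\<close>.\<close>

lemma forest_if_parent_greater:
  fixes f :: "nat \<Rightarrow> nat"
  assumes f: "\<And>u. u \<in> A \<Longrightarrow> u < f u"
  shows "is_forest ((\<lambda>u. {u, f u}) ` A)"
proof -
  let ?E = "(\<lambda>u. {u, f u}) ` A"
  have False if "is_cycle ?E vs" for vs
  proof -
    define n where "n = length vs"
    have n: "3 \<le> n" and dist: "distinct vs"
      and edge: "\<And>i. i < n \<Longrightarrow> {vs ! i, vs ! ((i + 1) mod n)} \<in> ?E"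
      using that unfolding is_cycle_def n_def by auto
    have "Min (set vs) \<in> set vs" using n unfolding n_def by (intro Min_in) auto
    then obtain i where i: "i < n" "vs ! i = Min (set vs)" unfolding n_def by (auto simp: in_set_conv_nth)
    have nbr: "vs ! j = f (vs ! i)" if e: "{vs ! i, vs ! j} \<in> ?E" and j: "j < n" "j \<noteq> i" for j
    proof -
      have "vs ! i \<le> vs ! j" using i j(1) unfolding n_def by simp
      moreover have "vs ! i \<noteq> vs ! j" using dist i(1) j unfolding n_def by (simp add: nth_eq_iff_index_eq)
      moreover obtain u where "u \<in> A" "{vs ! i, vs ! j} = {u, f u}" using e by auto
      ultimately show ?thesis using f[of u] by (auto simp: doubleton_eq_iff)
    qed
    define j where "j = (i + 1) mod n"
    define k where "k = (if i = 0 then n - 1 else i - 1)"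
    have j: "j < n" "j \<noteq> i" "j = (if i = n - 1 then 0 else i + 1)"
      unfolding j_def using n i by (auto simp: mod_Suc)
    have k: "k < n" "k \<noteq> i" "(k + 1) mod n = i" unfolding k_def using n i by auto
    have jk: "j \<noteq> k" unfolding j(3) k_def using n i by auto
    have "vs ! j = f (vs ! i)" using edge[OF i(1)] j nbr unfolding j_def by simp
    moreover have "vs ! k = f (vs ! i)"
      using edge[OF k(1)] k nbr by (simp add: insert_commute)
    ultimately have "vs ! j = vs ! k" by simp
    then show False using dist j(1) k(1) jk nth_eq_iff_index_eq unfolding n_def by blast
  qed
  moreover have "card e = 2" if "e \<in> ?E" for e
  proof -
    from that obtain u where "u \<in> A" "e = {u, f u}" by blast
    then show ?thesis using less_imp_neq[OF f] by simp
  qed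
  ultimately show ?thesis unfolding is_forest_def by blast
qed

text \<open>Column \<open>i\<close> consists of the vertices \<open>vertex L i x\<close>; its edges to the next column form the
  permutation \<open>\<sigma> i\<close>, and the last column carries a path. Each edge is identified with its lower
  end, so every graph that occurs is \<open>edges L \<sigma> A\<close> for some set \<open>A\<close> of lower ends.\<close>

definition parent :: "nat \<Rightarrow> (nat \<Rightarrow> nat \<Rightarrow> nat) \<Rightarrow> nat \<Rightarrow> nat" where
  "parent L \<sigma> u = (if u < 2 ^ L * 2 ^ L then vertex L (Suc (u div 2 ^ L)) (\<sigma> (u div 2 ^ L) (u mod 2 ^ L))
     else Suc u)"

definition edges :: "nat \<Rightarrow> (nat \<Rightarrow> nat \<Rightarrow> nat) \<Rightarrow> nat set \<Rightarrow> graph" where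
  "edges L \<sigma> A = (\<lambda>u. {u, parent L \<sigma> u}) ` A"

lemma parent_vertex: "i < 2 ^ L \<Longrightarrow> x < 2 ^ L \<Longrightarrow> parent L \<sigma> (vertex L i x) = vertex L (Suc i) (\<sigma> i x)"
proof -
  assume i: "i < 2 ^ L" and x: "x < 2 ^ L"
  have "Suc i * 2 ^ L \<le> 2 ^ L * 2 ^ L" using i by (intro mult_right_mono) auto
  then have "vertex L i x < 2 ^ L * 2 ^ L" using x unfolding vertex_def by simp
  moreover have "vertex L i x div 2 ^ L = i" "vertex L i x mod 2 ^ L = x"
    using x unfolding vertex_def by auto
  ultimately show ?thesis unfolding parent_def by simp
qed

lemma parent_last: "parent L \<sigma> (vertex L (2 ^ L) y) = Suc (vertex L (2 ^ L) y)"
  by (simp add: parent_def vertex_def)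

lemma parent_gt: "u < parent L \<sigma> u"
proof (cases "u < 2 ^ L * 2 ^ L")
  case True
  have "u div 2 ^ L * 2 ^ L + u mod 2 ^ L = u" by (rule div_mult_mod_eq)
  moreover have "u mod 2 ^ L < 2 ^ L" by simp
  ultimately have "u < Suc (u div 2 ^ L) * 2 ^ L" by (simp only: mult_Suc)
  then show ?thesis using True unfolding parent_def vertex_def by simp
qed (simp add: parent_def)

lemma forest_edges: "is_forest (edges L \<sigma> A)"
  unfolding edges_def by (intro forest_if_parent_greater parent_gt)

lemma edge_eq: "{u, parent L \<sigma> u} = {v, parent L \<sigma> v} \<Longrightarrow> u = v"
  using parent_gt[of u L \<sigma>] parent_gt[of v L \<sigma>] by (auto simp: doubleton_eq_iff)

lemma edges_delete: "edges L \<sigma> A - {{u, parent L \<sigma> u}} = edges L \<sigma> (A - {u})"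
  unfolding edges_def using edge_eq by auto

lemma edges_insert: "insert {u, parent L \<sigma> u} (edges L \<sigma> A) = edges L \<sigma> (insert u A)"
  unfolding edges_def by simp

text \<open>\<open>forest_throughout\<close> with an arbitrary initial graph, as needed for
  induction and concatenation.\<close>

definition forests :: "graph \<Rightarrow> operation list \<Rightarrow> bool" where
  "forests E ops \<longleftrightarrow> (\<forall>k\<le>length ops. is_forest (fold apply_operation (take k ops) E))"

lemma forests_Nil [simp]: "forests E [] \<longleftrightarrow> is_forest E"
  by (simp add: forests_def)

lemma forests_Cons [simp]: "forests E (x # xs) \<longleftrightarrow> is_forest E \<and> forests (apply_operation x E) xs"
  unfolding forests_def
proof (intro iffI conjI allI impI)
  assume *: "\<forall>k\<le>length (x # xs). is_forest (fold apply_operation (take k (x # xs)) E)"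
  from *[rule_format, of 0] show "is_forest E" by simp
  fix k assume "k \<le> length xs"
  then show "is_forest (fold apply_operation (take k xs) (apply_operation x E))"
    using *[rule_format, of "Suc k"] by simp
next
  fix k
  assume *: "is_forest E \<and> (\<forall>k\<le>length xs. is_forest (fold apply_operation (take k xs) (apply_operation x E)))"
    and k: "k \<le> length (x # xs)"
  then show "is_forest (fold apply_operation (take k (x # xs)) E)" by (cases k) auto
qed

lemma forests_append:
  "forests E xs \<Longrightarrow> forests (fold apply_operation xs E) ys \<Longrightarrow> forests E (xs @ ys)"
  by (induction xs arbitrary: E) auto

lemma delete_edges:
  "fold apply_operation (map (\<lambda>u. Delete u (parent L \<sigma> u)) us) (edges L \<sigma> A) = edges L \<sigma> (A - set us) \<and>
   forests (edges L \<sigma> A) (map (\<lambda>u. Delete u (parent L \<sigma> u)) us)"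
proof (induction us arbitrary: A)
  case (Cons u us)
  have "A - {u} - set us = A - set (u # us)" by auto
  with Cons[of "A - {u}"] show ?case by (simp add: edges_delete forest_edges)
qed (simp add: forest_edges)

lemma insert_edges:
  "fold apply_operation (map (\<lambda>u. Insert u (parent L \<sigma> u)) us) (edges L \<sigma> A) = edges L \<sigma> (A \<union> set us) \<and>
   forests (edges L \<sigma> A) (map (\<lambda>u. Insert u (parent L \<sigma> u)) us)"
proof (induction us arbitrary: A)
  case (Cons u us)
  have "insert u A \<union> set us = A \<union> set (u # us)" by auto
  with Cons[of "insert u A"] show ?case by (simp add: edges_insert forest_edges)
qed (simp add: forest_edges)

text \<open>All vertices except the far end of the path, whose \<open>parent\<close> lies outside
  the grid.\<close>

definition lower_ends :: "nat \<Rightarrow> nat set" where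
  "lower_ends L = {..<vertex L (2 ^ L) (2 ^ L - 1)}"

lemma vertex_in_lower_ends: "i < 2 ^ L \<Longrightarrow> x < 2 ^ L \<Longrightarrow> vertex L i x \<in> lower_ends L"
proof -
  assume i: "i < 2 ^ L" and x: "x < 2 ^ L"
  have "Suc i * 2 ^ L \<le> 2 ^ L * 2 ^ L" using i by (intro mult_right_mono) auto
  then show ?thesis using x unfolding vertex_def lower_ends_def by simp
qed

lemma update_ops_graph:
  assumes p: "p < 2 ^ L" and id: "\<sigma> p = (\<lambda>x. x)"
  shows "fold apply_operation (update_ops L p \<pi>) (edges L \<sigma> (lower_ends L)) = edges L (\<sigma>(p := \<pi>)) (lower_ends L)"
    and "forests (edges L \<sigma> (lower_ends L)) (update_ops L p \<pi>)"
proof -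
  let ?us = "map (vertex L p) [0..<2 ^ L]"
  let ?A = "lower_ends L - set ?us"
  have ops: "update_ops L p \<pi> = map (\<lambda>u. Delete u (parent L \<sigma> u)) ?us @ map (\<lambda>u. Insert u (parent L (\<sigma>(p := \<pi>)) u)) ?us"
    unfolding update_ops_def using p id by (auto simp: parent_vertex)
  \<comment> \<open>Halfway through, no edge with its lower end in column \<open>p\<close> is
    present, so the graph does not depend on the permutation there.\<close>
  have eq: "edges L \<sigma> ?A = edges L (\<sigma>(p := \<pi>)) ?A"
  proof -
    have "parent L \<sigma> u = parent L (\<sigma>(p := \<pi>)) u" if "u \<in> ?A" for u
    proof (cases "u < 2 ^ L * 2 ^ L \<and> u div 2 ^ L = p")
      case True
      then have "u = vertex L p (u mod 2 ^ L)" unfolding vertex_def by (metis div_mult_mod_eq)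
      moreover have "u mod 2 ^ L \<in> set [0..<2 ^ L]" by simp
      ultimately have "u \<in> set ?us" unfolding set_map by blast
      then show ?thesis using that by blast
    next
      case False
      then show ?thesis by (auto simp: parent_def)
    qed
    then show ?thesis unfolding edges_def by (intro image_cong) auto
  qed
  have "?A \<union> set ?us = lower_ends L" using p vertex_in_lower_ends[of p L] by auto
  then show "fold apply_operation (update_ops L p \<pi>) (edges L \<sigma> (lower_ends L)) = edges L (\<sigma>(p := \<pi>)) (lower_ends L)"
    unfolding ops fold_append comp_apply using eq
    by (simp only: delete_edges insert_edges)
  show "forests (edges L \<sigma> (lower_ends L)) (update_ops L p \<pi>)"
    unfolding ops using eq by (intro forests_append) (simp_all only: delete_edges insert_edges)
qed

definition cut_graph :: "nat \<Rightarrow> (nat \<Rightarrow> nat \<Rightarrow> nat) \<Rightarrow> nat \<Rightarrow> graph" where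
  "cut_graph L \<sigma> z = edges L \<sigma> (lower_ends L - {vertex L (2 ^ L) (z - 1)})"

lemma cut_link_graph:
  assumes z: "0 < z" "z < 2 ^ L"
  shows "apply_operation (cut_op L z) (edges L \<sigma> (lower_ends L)) = cut_graph L \<sigma> z"
    and "apply_operation (link_op L z) (cut_graph L \<sigma> z) = edges L \<sigma> (lower_ends L)"
proof -
  let ?u = "vertex L (2 ^ L) (z - 1)"
  have p: "parent L \<sigma> ?u = vertex L (2 ^ L) z" using z by (simp add: parent_last) (simp add: vertex_def)
  have u: "?u \<in> lower_ends L" using z by (simp add: lower_ends_def vertex_def)
  show "apply_operation (cut_op L z) (edges L \<sigma> (lower_ends L)) = cut_graph L \<sigma> z"
    unfolding cut_op_def cut_graph_def by (simp add: edges_delete p[symmetric])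
  show "apply_operation (link_op L z) (cut_graph L \<sigma> z) = edges L \<sigma> (lower_ends L)"
    unfolding link_op_def cut_graph_def using u by (simp add: edges_insert p[symmetric] insert_absorb)
qed

text \<open>The row in which the path upwards from \<open>u\<close> enters the last column; for
  \<open>u\<close> in the last column, its own row. Its comparison with \<open>z\<close> is the
  invariant that separates the two sides of the cut.\<close>

definition last_row :: "nat \<Rightarrow> (nat \<Rightarrow> nat \<Rightarrow> nat) \<Rightarrow> nat \<Rightarrow> nat" where
  "last_row L \<sigma> u = (if u < 2 ^ L * 2 ^ L then suffix_map L \<sigma> (u div 2 ^ L) (u mod 2 ^ L) else u - 2 ^ L * 2 ^ L)"

lemma last_row_parent:
  assumes \<sigma>: "\<And>p x. x < 2 ^ L \<Longrightarrow> \<sigma> p x < 2 ^ L" and u: "u < 2 ^ L * 2 ^ L"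
  shows "last_row L \<sigma> (parent L \<sigma> u) = last_row L \<sigma> u"
proof -
  define i where "i = u div 2 ^ L"
  define x where "x = u mod 2 ^ L"
  have i: "i < 2 ^ L" using u unfolding i_def by (rule less_mult_imp_div_less)
  have x: "x < 2 ^ L" unfolding x_def by simp
  define x' where "x' = \<sigma> i x"
  have x': "x' < 2 ^ L" unfolding x'_def by (rule \<sigma>[OF x])
  have p: "parent L \<sigma> u = vertex L (Suc i) x'" using u unfolding parent_def i_def x_def x'_def by simp
  have step: "last_row L \<sigma> u = fold \<sigma> [Suc i..<2 ^ L] x'"
    using u i unfolding last_row_def suffix_map_def i_def[symmetric] x_def[symmetric] x'_def
    by (simp add: upt_conv_Cons)
  show ?thesis
  proof (cases "Suc i < 2 ^ L")
    case True
    have "Suc (Suc i) * 2 ^ L \<le> 2 ^ L * 2 ^ L" using True by (intro mult_right_mono) auto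
    then have "vertex L (Suc i) x' < 2 ^ L * 2 ^ L" using x' unfolding vertex_def by simp
    moreover have "vertex L (Suc i) x' div 2 ^ L = Suc i" "vertex L (Suc i) x' mod 2 ^ L = x'"
      using x' unfolding vertex_def by (simp_all del: mult_Suc)
    ultimately have "last_row L \<sigma> (vertex L (Suc i) x') = suffix_map L \<sigma> (Suc i) x'"
      unfolding last_row_def by simp
    then show ?thesis unfolding p step suffix_map_def .
  next
    case False
    then have "Suc i = 2 ^ L" using i by simp
    then have "last_row L \<sigma> (vertex L (Suc i) x') = x'" by (simp add: last_row_def vertex_def)
    then show ?thesis unfolding p step using \<open>Suc i = 2 ^ L\<close> by simp
  qed
qed

text \<open>Permutation edges keep \<open>last_row\<close>, and the one path edge that leads from
  row \<open>z - 1\<close> to row \<open>z\<close> has been removed, so no path changes sides.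
  Conversely, a vertex with last row below \<open>z\<close> climbs to the last column and then
  descends to row 0 without meeting the cut.\<close>

lemma query_answer:
  assumes \<sigma>: "\<And>p x. x < 2 ^ L \<Longrightarrow> \<sigma> p x < 2 ^ L" and p: "p < 2 ^ L" and x: "x < 2 ^ L"
    and z: "0 < z" "z < 2 ^ L"
  shows "path_between (cut_graph L \<sigma> z) (vertex L p x) (vertex L (2 ^ L) 0) \<longleftrightarrow> suffix_map L \<sigma> p x < z"
proof -
  let ?E = "cut_graph L \<sigma> z"
  let ?R = "{(x, y). {x, y} \<in> ?E}"
  let ?m = "2 ^ L * 2 ^ L :: nat"
  let ?row = "last_row L \<sigma>"
  define A where "A = lower_ends L - {vertex L (2 ^ L) (z - 1)}"
  have E: "?E = (\<lambda>u. {u, parent L \<sigma> u}) ` A" unfolding cut_graph_def edges_def A_def ..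
  have side: "(?row (parent L \<sigma> u) < z) = (?row u < z)" if "u \<in> A" for u
  proof (cases "u < ?m")
    case True
    then show ?thesis by (simp add: last_row_parent[OF \<sigma>])
  next
    case False
    then have "parent L \<sigma> u = Suc u" by (simp add: parent_def)
    moreover have "u \<noteq> ?m + (z - 1)" using that unfolding A_def vertex_def by simp
    ultimately show ?thesis using False z unfolding last_row_def by auto
  qed
  have inv: "(?row a < z) = (?row b < z)" if "(a, b) \<in> ?R\<^sup>*" for a b
    using that
  proof (induction rule: rtrancl_induct)
    case (step b c)
    then obtain u where "u \<in> A" "{b, c} = {u, parent L \<sigma> u}" unfolding E by auto
    then show ?case using step.IH side[of u] by (auto simp: doubleton_eq_iff)
  qed simp
  have step: "(u, parent L \<sigma> u) \<in> ?R" "(parent L \<sigma> u, u) \<in> ?R" if "u \<in> A" for u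
    using that unfolding E by (auto simp: insert_commute)
  have to_last: "(u, ?m + ?row u) \<in> ?R\<^sup>*" for u
  proof (induction "?m - u" arbitrary: u rule: less_induct)
    case less
    show ?case
    proof (cases "u < ?m")
      case True
      have "u \<noteq> ?m + (z - 1)" "u < ?m + (2 ^ L - 1)"
        by (rule less_imp_neq[OF trans_less_add1[OF True]], rule trans_less_add1[OF True])
      then have "u \<in> A" unfolding A_def lower_ends_def vertex_def by blast
      have "(parent L \<sigma> u, ?m + ?row (parent L \<sigma> u)) \<in> ?R\<^sup>*"
        using parent_gt[of u L \<sigma>] True by (intro less) simp
      from converse_rtrancl_into_rtrancl[OF step(1)[OF \<open>u \<in> A\<close>] this]
      show ?thesis by (simp only: last_row_parent[OF \<sigma> True])
    qed (simp add: last_row_def)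
  qed
  have down: "y < z \<Longrightarrow> (?m + y, ?m) \<in> ?R\<^sup>*" for y
  proof (induction y)
    case (Suc y)
    have "y < 2 ^ L - 1" "y \<noteq> z - 1" using Suc.prems z by auto
    then have "?m + y \<in> A" unfolding A_def lower_ends_def vertex_def
      by (simp only: Diff_iff lessThan_iff nat_add_left_cancel_less singleton_iff add_left_cancel
          not_False_eq_True simp_thms)
    moreover have "parent L \<sigma> (?m + y) = ?m + Suc y" by (simp add: parent_def)
    ultimately have "(?m + Suc y, ?m + y) \<in> ?R" using step(2)[of "?m + y"] by simp
    then show ?case using Suc by (meson Suc_lessD converse_rtrancl_into_rtrancl)
  qed simp
  have row: "?row (vertex L p x) = suffix_map L \<sigma> p x"
  proof -
    have "Suc p * 2 ^ L \<le> ?m" using p by (intro mult_right_mono) auto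
    then have "vertex L p x < ?m" using x unfolding vertex_def by simp
    moreover have "vertex L p x div 2 ^ L = p" "vertex L p x mod 2 ^ L = x"
      using x unfolding vertex_def by auto
    ultimately show ?thesis unfolding last_row_def by simp
  qed
  have last: "vertex L (2 ^ L) 0 = ?m" by (simp add: vertex_def)
  show ?thesis
    unfolding path_between_def last
  proof
    assume "(vertex L p x, ?m) \<in> ?R\<^sup>*"
    from inv[OF this] show "suffix_map L \<sigma> p x < z" using row z by (simp add: last_row_def)
  next
    assume "suffix_map L \<sigma> p x < z"
    from rtrancl_trans[OF to_last[of "vertex L p x", unfolded row] down[OF this]]
    show "(vertex L p x, ?m) \<in> ?R\<^sup>*" .
  qed
qed

section \<open>Correct answers and weights\<close>

text \<open>Recursive count of the correct answers with the current graph as a parameter, which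
  makes it additive under concatenation of runs.\<close>

primrec ncorrect :: "graph \<Rightarrow> operation list \<Rightarrow> bool list \<Rightarrow> nat" where
  "ncorrect E [] bs = 0"
| "ncorrect E (x # xs) bs = (case x of Query u v \<Rightarrow> of_bool (hd bs = path_between E u v) | _ \<Rightarrow> 0)
     + ncorrect (apply_operation x E) xs (tl bs)"

lemma card_less_Suc_split:
  "card {i. i < Suc n \<and> P i} = of_bool (P 0) + card {i. i < n \<and> P (Suc i)}"
proof -
  have "{i. i < Suc n \<and> P i} = (if P 0 then {0} else {}) \<union> Suc ` {i. i < n \<and> P (Suc i)}"
    by (auto simp: less_Suc_eq_0_disj)
  then show ?thesis by (auto simp: card_Un_disjoint card_image)
qed

lemma card_correct_from:
  "length bs = length ops \<Longrightarrow> card {i. i < length ops \<and> (\<exists>u v. ops ! i = Query u v \<and>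
     bs ! i = path_between (fold apply_operation (take i ops) E) u v)} = ncorrect E ops bs"
proof (induction ops arbitrary: E bs)
  case (Cons x xs)
  obtain b bs' where bs: "bs = b # bs'" using Cons.prems by (cases bs) auto
  have "card {i. i < length xs \<and> (\<exists>u v. xs ! i = Query u v \<and>
     bs' ! i = path_between (fold apply_operation (take i xs) (apply_operation x E)) u v)}
     = ncorrect (apply_operation x E) xs bs'"
    using Cons.prems bs by (intro Cons.IH) simp
  then show ?case unfolding bs
    by (simp add: card_less_Suc_split) (cases x; simp)
qed simp

lemma card_correct_positions:
  "length bs = length ops \<Longrightarrow> card (correct_positions ops bs) = ncorrect {} ops bs"
  unfolding correct_positions_def graph_after_def by (rule card_correct_from)

fun is_query :: "operation \<Rightarrow> bool" where
  "is_query (Query u v) = True"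
| "is_query _ = False"

definition nqueries :: "operation list \<Rightarrow> nat" where
  "nqueries ops = length (filter is_query ops)"

lemma nqueries_simps [simp]:
  "nqueries [] = 0" "nqueries (x # xs) = of_bool (is_query x) + nqueries xs"
  "nqueries (xs @ ys) = nqueries xs + nqueries ys"
  by (simp_all add: nqueries_def)

lemma card_query_positions: "card (query_positions ops) = nqueries ops"
proof -
  have "is_query x \<longleftrightarrow> (\<exists>u v. x = Query u v)" for x by (cases x) auto
  then show ?thesis unfolding query_positions_def nqueries_def length_filter_conv_card by simp
qed

lemma ncorrect_le: "ncorrect E ops bs \<le> nqueries ops"
proof (induction ops arbitrary: E bs)
  case (Cons x xs)
  from Cons[of "apply_operation x E" "tl bs"] show ?case by (cases x) auto
qed simp

lemma ncorrect_append:
  "length bs = length xs \<Longrightarrow> ncorrect E (xs @ ys) (bs @ bs') = ncorrect E xs bs + ncorrect (fold apply_operation xs E) ys bs'"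
proof (induction xs arbitrary: E bs)
  case (Cons x xs)
  obtain b bs'' where bs: "bs = b # bs''" using Cons.prems by (cases bs) auto
  then show ?case using Cons.IH[of bs''] Cons.prems by (cases x) simp_all
qed simp

primrec mem_after :: "data_structure \<Rightarrow> operation list \<Rightarrow> memory \<Rightarrow> memory" where
  "mem_after D [] m = m"
| "mem_after D (x # xs) m = mem_after D xs (fst (snd (exec (procedure D x) m)))"

lemma length_run_from: "length (fst (run_from D ops m)) = length ops"
  by (induction ops arbitrary: m) (auto split: prod.splits, metis fst_conv)

lemma run_from_append:
  "fst (run_from D (xs @ ys) m) = fst (run_from D xs m) @ fst (run_from D ys (mem_after D xs m))"
  "snd (run_from D (xs @ ys) m) = snd (run_from D xs m) + snd (run_from D ys (mem_after D xs m))"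
  by (induction xs arbitrary: m) (simp_all add: case_prod_beta)

lemma mem_after_append: "mem_after D (xs @ ys) m = mem_after D ys (mem_after D xs m)"
  by (induction xs arbitrary: m) simp_all

lemma exec_tree_of:
  "fst (snd (exec (tree_of (procedure D) ops) m)) = mem_after D ops m"
  "snd (snd (exec (tree_of (procedure D) ops) m)) = snd (run_from D ops m)"
  by (induction ops arbitrary: m) (simp_all add: exec_bind_tree case_prod_beta)

lemma word_memory_exec:
  assumes "word_bounded w t" "word_memory w m"
  shows "word_memory w (fst (snd (exec t m)))"
proof -
  have m: "m = fst \<circ> (\<lambda>a. (m a, 0::nat))" by auto
  have "word_memory w (fst \<circ> post t (\<lambda>a. (m a, 0)) 0)"
    by (rule word_memory_post[OF assms(1)]) (use assms(2) m in metis)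
  then show ?thesis unfolding exec_stamped(2) m[symmetric] .
qed

lemma word_memory_mem_after:
  "(\<And>x. x \<in> set ops \<Longrightarrow> word_bounded w (procedure D x)) \<Longrightarrow> word_memory w m \<Longrightarrow> word_memory w (mem_after D ops m)"
  by (induction ops arbitrary: m) (simp_all add: word_memory_exec)

definition query_ops :: "nat \<Rightarrow> nat \<Rightarrow> (nat \<Rightarrow> nat) \<Rightarrow> (nat \<times> nat) list \<Rightarrow> operation list" where
  "query_ops L p y xs = concat (map (\<lambda>(x, e).
     [cut_op L (cutpoint e (y x)), query_op L p x, link_op L (cutpoint e (y x))]) xs)"

lemma query_ops_simps [simp]:
  "query_ops L p y [] = []"
  "query_ops L p y ((x, e) # xs) =
     [cut_op L (cutpoint e (y x)), query_op L p x, link_op L (cutpoint e (y x))] @ query_ops L p y xs"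
  by (simp_all add: query_ops_def)

definition macro_ops :: "nat \<Rightarrow> nat \<Rightarrow> (nat \<Rightarrow> nat \<Rightarrow> nat) \<Rightarrow> (nat \<Rightarrow> nat) \<Rightarrow> nat list \<Rightarrow> operation list" where
  "macro_ops L \<tau> \<sigma> \<pi> \<delta> = update_ops L (rev_pos L \<tau>) \<pi> @
     query_ops L (rev_pos L \<tau>) (suffix_map L (\<sigma>(rev_pos L \<tau> := \<pi>)) (rev_pos L \<tau>)) (zip [0..<2 ^ L] \<delta>)"

fun run_ops :: "nat \<Rightarrow> nat \<Rightarrow> (nat \<Rightarrow> nat \<Rightarrow> nat) \<Rightarrow> ((nat \<Rightarrow> nat) \<times> nat list) list \<Rightarrow> operation list" where
  "run_ops L \<tau> \<sigma> [] = []"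
| "run_ops L \<tau> \<sigma> ((\<pi>, \<delta>) # r) = macro_ops L \<tau> \<sigma> \<pi> \<delta> @ run_ops L (Suc \<tau>) (\<sigma>(rev_pos L \<tau> := \<pi>)) r"

definition ones :: "nat \<Rightarrow> nat \<Rightarrow> nat" where
  "ones L \<tau> = card {l. l < L \<and> odd (\<tau> div 2 ^ l)}"

text \<open>The crossing level can only be the position of the highest binary digit in which
  \<open>s\<close> and \<open>t\<close> differ.\<close>

lemma crossing_unique: "crossing l s t \<Longrightarrow> crossing l' s t \<Longrightarrow> l = l'"
proof (induction l l' rule: linorder_wlog)
  case (le l l')
  show ?case
  proof (rule ccontr)
    assume "l \<noteq> l'"
    with le have "Suc l \<le> l'" by simp
    then obtain k where l': "l' = Suc l + k" using le_iff_add by blast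
    have "s div 2 ^ l' = t div 2 ^ l'"
      using le(2) unfolding l' power_add crossing_def div_mult2_eq by simp
    with le(3) show False unfolding crossing_def by metis
  qed
qed simp

locale ds_process = process L w "procedure D" for L w and D :: data_structure
begin

text \<open>Lower bound for the product of the prices of one read over all levels: 1 / 2 is the
  \<open>L\<close>-th power of \<open>2 powr (- (1 / L))\<close>, and the expensive factor occurs at
  most once.\<close>

definition probe_cost :: "real \<Rightarrow> real" where
  "probe_cost \<eta> = 2 powr (- (real w / real L)) / (1 + \<eta>) / 2"

lemma probe_cost_bounds: "0 \<le> \<eta> \<Longrightarrow> 0 < probe_cost \<eta>" "0 \<le> \<eta> \<Longrightarrow> probe_cost \<eta> \<le> 1"
proof -
  assume \<eta>: "0 \<le> \<eta>"
  have "2 powr (- (real w / real L)) \<le> (2::real) powr 0" by (intro powr_mono) auto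
  then show "0 < probe_cost \<eta>" "probe_cost \<eta> \<le> 1" unfolding probe_cost_def using \<eta> by auto
qed

lemma prod_level_read:
  assumes \<eta>: "0 \<le> \<eta>"
  shows "probe_cost \<eta> \<le> (\<Prod>l<L. level_read \<eta> l t s)"
proof -
  define u where "u = 2 powr (- (real w / real L)) / (1 + \<eta>)"
  have "2 powr (- (real w / real L)) \<le> (2::real) powr 0" by (intro powr_mono) auto
  then have u: "u \<le> 1" unfolding u_def using \<eta> by simp
  have "u \<le> (\<Prod>l<L. if crossing l s t then u else 1)"
  proof (cases "\<exists>l<L. crossing l s t")
    case True
    then obtain l where l: "l < L" "crossing l s t" by blast
    have "(\<Prod>l<L. if crossing l s t then u else 1) = u * (\<Prod>l\<in>{..<L} - {l}. if crossing l s t then u else 1)"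
      using l by (subst prod.remove[of _ l]) auto
    also have "(\<Prod>l\<in>{..<L} - {l}. if crossing l s t then u else 1) = 1"
      using crossing_unique[OF l(2)] by (intro prod.neutral) auto
    finally show ?thesis by simp
  next
    case False
    then have "(\<Prod>l<L. if crossing l s t then u else 1) = 1" by (intro prod.neutral) auto
    then show ?thesis using u by simp
  qed
  moreover have pow: "(2 powr (- (1 / real L))) ^ L = (1 / 2 :: real)"
  proof -
    have "(2 powr (- (1 / real L))) ^ L = (2::real) powr (- 1)"
      using L by (simp add: powr_realpow[symmetric] powr_powr)
    then show ?thesis by (simp add: powr_minus_divide)
  qed
  moreover from pow have "(\<Prod>l<L. level_read \<eta> l t s) = 1 / 2 * (\<Prod>l<L. if crossing l s t then u else 1)"
    unfolding level_read_def u_def prod.distrib prod_constant card_lessThan by (simp only:)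
  ultimately show ?thesis unfolding probe_cost_def u_def[symmetric] by simp
qed

lemma prod_weight:
  assumes \<eta>: "0 \<le> \<eta>"
  shows "probe_cost \<eta> ^ snd (snd (exec t (fst \<circ> s))) \<le> (\<Prod>l<L. weight (level_read \<eta> l) t s \<tau>)"
proof (induction t arbitrary: s)
  case (Read a k)
  have "probe_cost \<eta> * probe_cost \<eta> ^ snd (snd (exec (k (fst (s a))) (fst \<circ> s)))
      \<le> (\<Prod>l<L. level_read \<eta> l \<tau> (snd (s a))) * (\<Prod>l<L. weight (level_read \<eta> l) (k (fst (s a))) s \<tau>)"
    using probe_cost_bounds[OF \<eta>]
    by (intro mult_mono prod_level_read \<eta> Read prod_nonneg level_read_nonneg) auto
  moreover have "(fst \<circ> s) a = fst (s a)" by simp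
  ultimately show ?case
    by (simp only: exec.simps weight.simps prod.distrib case_prod_beta snd_conv power_Suc)
next
  case (Write a x t)
  have eq: "(fst \<circ> s)(a := x) = fst \<circ> s(a := (x, \<tau>))" by auto
  \<comment> \<open>Writes have no factor in \<open>weight\<close>; charging them as well only
    lowers the left-hand side, so that the exponent can be the number of all probes.\<close>
  have "probe_cost \<eta> ^ Suc (snd (snd (exec t (fst \<circ> s(a := (x, \<tau>)))))) \<le> 
      probe_cost \<eta> ^ snd (snd (exec t (fst \<circ> s(a := (x, \<tau>)))))"
    using probe_cost_bounds[OF \<eta>] by (intro power_decreasing) auto
  also have "\<dots> \<le> (\<Prod>l<L. weight (level_read \<eta> l) t (s(a := (x, \<tau>))) \<tau>)" by (rule Write)
  finally show ?case by (simp only: exec.simps weight.simps eq case_prod_beta snd_conv)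
qed simp

text \<open>A time lies in a right half at those levels where its binary digit is 1, hence the
  exponent.\<close>

lemma prod_level_gain:
  "(\<Prod>l<L. if b then 1 + level_gain \<eta> l \<tau> else 1) = (1 + \<eta>) ^ (ones L \<tau> * of_bool b)"
proof (cases b)
  case True
  have "(\<Prod>l<L. 1 + level_gain \<eta> l \<tau>) = (\<Prod>l\<in>{l. l < L \<and> odd (\<tau> div 2 ^ l)}. 1 + \<eta>)"
    by (intro prod.mono_neutral_cong_right) (auto simp: level_gain_def)
  then show ?thesis using True by (simp add: ones_def)
qed simp

text \<open>All facts go through one induction since they need each other: the answers are judged on
  the graph, the weights are taken along the memory, and relinking restores the graph
  \<open>E\<close> after each query.\<close>

lemma queries_link:
  assumes \<eta>: "0 \<le> \<eta>" and p: "p < 2 ^ L" and \<sigma>: "\<And>p. \<sigma> p \<in> perms"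
  defines "y \<equiv> suffix_map L \<sigma> p" and "E \<equiv> edges L \<sigma> (lower_ends L)"
  shows "set xs \<subseteq> {..<2 ^ L} \<times> {..<L} \<Longrightarrow>
    (1 + \<eta>) ^ (ones L \<tau> * ncorrect E (query_ops L p y xs) (fst (run_from D (query_ops L p y xs) (fst \<circ> s))))
      * probe_cost \<eta> ^ snd (run_from D (query_ops L p y xs) (fst \<circ> s))
      \<le> (\<Prod>l<L. lqweight \<eta> l \<tau> p y xs s)
    \<and> mem_after D (query_ops L p y xs) (fst \<circ> s) = fst \<circ> qpost \<tau> p y xs s
    \<and> fold apply_operation (query_ops L p y xs) E = E \<and> forests E (query_ops L p y xs)
    \<and> nqueries (query_ops L p y xs) = length xs"
proof (induction xs arbitrary: s)
  case Nil
  then show ?case by (simp add: E_def forest_edges)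
next
  case (Cons a xs)
  obtain x e where a: "a = (x, e)" by (cases a)
  have x: "x < 2 ^ L" and e: "e < L" and xs: "set xs \<subseteq> {..<2 ^ L} \<times> {..<L}"
    using Cons.prems unfolding a by auto
  define z where "z = cutpoint e (y x)"
  have "y \<in> perms"
    unfolding y_def using \<sigma> by (auto simp: perms_def intro!: suffix_map_permutes)
  then have "y x < 2 ^ L" using x by (rule permD)
  then have z: "0 < z" "z < 2 ^ L" unfolding z_def using cutpoint_pos cutpoint_less[OF e] by auto
  let ?ops = "query_ops L p y xs"
  let ?m = "fst \<circ> s"
  define t1 where "t1 = procedure D (cut_op L z)"
  define t2 where "t2 = procedure D (query_op L p x)"
  obtain b1 m1 k1 where 1: "exec t1 ?m = (b1, m1, k1)" by (cases "exec t1 ?m") auto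
  obtain b2 m2 k2 where 2: "exec t2 m1 = (b2, m2, k2)" by (cases "exec t2 m1") auto
  obtain b3 m3 k3 where 3: "exec (link_tree z) m2 = (b3, m3, k3)" by (cases "exec (link_tree z) m2") auto
  have q: "exec (query_tree p x z) ?m = (b2, m2, k1 + k2)"
    unfolding query_tree_def exec_bind_tree t1_def[symmetric] t2_def[symmetric] 1 by (simp add: 2)
  define s2 where "s2 = post (query_tree p x z) s \<tau>"
  define s3 where "s3 = post (link_tree z) s2 \<tau>"
  have m2: "m2 = fst \<circ> s2" and b2: "answer (query_tree p x z) s \<tau> = b2"
    unfolding s2_def exec_stamped q by simp_all
  have m3: "m3 = fst \<circ> s3" unfolding s3_def exec_stamped m2[symmetric] 3 by simp
  let ?r = "run_from D ?ops (fst \<circ> s3)"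
  note IH = Cons.IH[OF xs, of s3]
  have ops: "query_ops L p y (a # xs) = cut_op L z # query_op L p x # link_op L z # ?ops"
    unfolding a z_def by simp
  have run: "run_from D (query_ops L p y (a # xs)) ?m = (b1 # b2 # b3 # fst ?r, k1 + (k2 + (k3 + snd ?r)))"
    unfolding ops run_from.simps t1_def[symmetric] t2_def[symmetric] link_tree_def[symmetric] 1 prod.case 2 3
      m3[symmetric] by (simp add: case_prod_beta)
  have mem: "mem_after D (query_ops L p y (a # xs)) ?m = mem_after D ?ops (fst \<circ> s3)"
    unfolding ops mem_after.simps t1_def[symmetric] t2_def[symmetric] link_tree_def[symmetric] 1 2 3 fst_conv snd_conv m3 ..
  have cut: "apply_operation (cut_op L z) E = cut_graph L \<sigma> z"
    and link: "apply_operation (link_op L z) (cut_graph L \<sigma> z) = E"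
    unfolding E_def by (rule cut_link_graph[OF z])+
  have ans: "path_between (cut_graph L \<sigma> z) (vertex L p x) (vertex L (2 ^ L) 0) = (y x < z)"
    unfolding y_def by (rule query_answer[OF permD[OF \<sigma>] p x z])
  have nc: "ncorrect E (query_ops L p y (a # xs)) (fst (run_from D (query_ops L p y (a # xs)) ?m))
      = of_bool (b2 = (y x < z)) + ncorrect E ?ops (fst ?r)"
    unfolding run fst_conv unfolding ops ncorrect.simps cut
    by (simp add: cut_op_def query_op_def link_op_def ans link[unfolded link_op_def, simplified])
  have "(1 + \<eta>) ^ (ones L \<tau> * of_bool (b2 = (y x < z))) * probe_cost \<eta> ^ (k1 + k2) * (probe_cost \<eta> ^ k3 *
       ((1 + \<eta>) ^ (ones L \<tau> * ncorrect E ?ops (fst ?r)) * probe_cost \<eta> ^ snd ?r))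
     \<le> (\<Prod>l<L. if b2 = (y x < z) then 1 + level_gain \<eta> l \<tau> else 1)
       * (\<Prod>l<L. weight (level_read \<eta> l) (query_tree p x z) s \<tau>) * 
       ((\<Prod>l<L. weight (level_read \<eta> l) (link_tree z) s2 \<tau>) *
       (\<Prod>l<L. lqweight \<eta> l \<tau> p y xs s3))"
    (is "?lhs \<le> ?rhs")
  proof (intro mult_mono)
    show "probe_cost \<eta> ^ (k1 + k2) \<le> (\<Prod>l<L. weight (level_read \<eta> l) (query_tree p x z) s \<tau>)"
      using prod_weight[OF \<eta>, of "query_tree p x z" s \<tau>] unfolding q by simp
    show "probe_cost \<eta> ^ k3 \<le> (\<Prod>l<L. weight (level_read \<eta> l) (link_tree z) s2 \<tau>)"
      using prod_weight[OF \<eta>, of "link_tree z" s2 \<tau>] unfolding m2[symmetric] 3 by simp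
    show "(1 + \<eta>) ^ (ones L \<tau> * ncorrect E ?ops (fst ?r)) * probe_cost \<eta> ^ snd ?r
        \<le> (\<Prod>l<L. lqweight \<eta> l \<tau> p y xs s3)"
      using IH by blast
  qed (use \<eta> probe_cost_bounds[OF \<eta>] in \<open>auto simp: prod_level_gain
        intro!: prod_nonneg weight_nonneg level_read_nonneg mult_nonneg_nonneg\<close>)
  also have "?rhs = (\<Prod>l<L. lqweight \<eta> l \<tau> p y (a # xs) s)"
    unfolding a qweight.simps z_def[symmetric] b2 s2_def[symmetric] s3_def[symmetric] prod.distrib
    by (simp only: mult_ac)
  also have "?lhs = (1 + \<eta>) ^ (ones L \<tau> * (of_bool (b2 = (y x < z)) + ncorrect E ?ops (fst ?r)))
      * probe_cost \<eta> ^ (k1 + (k2 + (k3 + snd ?r)))"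
    by (simp only: power_add distrib_left mult_ac)
  finally have "(1 + \<eta>) ^ (ones L \<tau> * ncorrect E (query_ops L p y (a # xs)) (fst (run_from D (query_ops L p y (a # xs)) ?m)))
      * probe_cost \<eta> ^ snd (run_from D (query_ops L p y (a # xs)) ?m)
      \<le> (\<Prod>l<L. lqweight \<eta> l \<tau> p y (a # xs) s)"
    unfolding nc unfolding run snd_conv .
  moreover have "mem_after D (query_ops L p y (a # xs)) ?m = fst \<circ> qpost \<tau> p y (a # xs) s"
    unfolding mem unfolding a qpost.simps z_def[symmetric] s2_def[symmetric] s3_def[symmetric] using IH by blast
  moreover have "fold apply_operation (query_ops L p y (a # xs)) E = E"
    unfolding ops using IH by (simp add: cut link query_op_def)
  moreover have "forests E (query_ops L p y (a # xs))"
    unfolding ops using IH by (simp add: cut link query_op_def) (simp add: E_def cut_graph_def forest_edges)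
  moreover have "nqueries (query_ops L p y (a # xs)) = length (a # xs)"
    unfolding ops using IH by (simp add: cut_op_def link_op_def query_op_def)
  ultimately show ?case by blast
qed

lemma ncorrect_update_ops: "ncorrect E (update_ops L p \<pi>) bs = 0"
  and nqueries_update_ops: "nqueries (update_ops L p \<pi>) = 0"
proof -
  have *: "nqueries (map (\<lambda>x. Delete (f x) (g x)) xs) = 0" "nqueries (map (\<lambda>x. Insert (f x) (g x)) xs) = 0"
    for f g and xs :: "nat list"
    by (induction xs) auto
  show q: "nqueries (update_ops L p \<pi>) = 0" unfolding update_ops_def by (simp add: *)
  show "ncorrect E (update_ops L p \<pi>) bs = 0" using ncorrect_le[of E "update_ops L p \<pi>" bs] q by simp
qed

lemma macro_link:
  assumes \<eta>: "0 \<le> \<eta>" and \<sigma>: "\<And>p. \<sigma> p \<in> perms" and \<pi>: "\<pi> \<in> perms" and \<delta>: "\<delta> \<in> depths"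
    and id: "\<sigma> (column \<tau>) = (\<lambda>x. x)"
  defines "ops \<equiv> macro_ops L \<tau> \<sigma> \<pi> \<delta>" and "E \<equiv> edges L \<sigma> (lower_ends L)"
  shows "(1 + \<eta>) ^ (ones L \<tau> * ncorrect E ops (fst (run_from D ops (fst \<circ> s))))
      * probe_cost \<eta> ^ snd (run_from D ops (fst \<circ> s))
      \<le> (\<Prod>l<L. lmweight \<eta> l \<tau> \<sigma> \<pi> \<delta> s)
    \<and> mem_after D ops (fst \<circ> s) = fst \<circ> mpost \<tau> \<sigma> \<pi> \<delta> s
    \<and> fold apply_operation ops E = edges L (\<sigma>(column \<tau> := \<pi>)) (lower_ends L) \<and> forests E ops
    \<and> nqueries ops = 2 ^ L"
proof -
  let ?p = "column \<tau>"
  let ?\<sigma> = "\<sigma>(?p := \<pi>)"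
  let ?xs = "zip [0..<2 ^ L] \<delta>"
  define U where "U = update_ops L ?p \<pi>"
  define Q where "Q = query_ops L ?p (suffix_map L ?\<sigma> ?p) ?xs"
  define s' where "s' = post (update_tree ?p \<pi>) s \<tau>"
  have ops: "ops = U @ Q" unfolding ops_def macro_ops_def U_def Q_def ..
  have p: "?p < 2 ^ L" by (rule rev_pos_less)
  have \<sigma>': "?\<sigma> p \<in> perms" for p using \<sigma> \<pi> by simp
  have mU: "mem_after D U (fst \<circ> s) = fst \<circ> s'"
    unfolding s'_def exec_stamped update_tree_def exec_tree_of U_def ..
  have cU: "snd (run_from D U (fst \<circ> s)) = snd (snd (exec (update_tree ?p \<pi>) (fst \<circ> s)))"
    unfolding update_tree_def exec_tree_of U_def ..
  note gU = update_ops_graph[where \<sigma>=\<sigma> and \<pi>=\<pi>, OF p id, folded U_def E_def]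
  note q = queries_link[where \<sigma>="?\<sigma>" and \<tau>=\<tau> and s=s', OF \<eta> p \<sigma>' zip_depths(1)[OF \<delta>], folded Q_def]
  have nc: "ncorrect E ops (fst (run_from D ops (fst \<circ> s)))
      = ncorrect (edges L ?\<sigma> (lower_ends L)) Q (fst (run_from D Q (fst \<circ> s')))"
    unfolding ops run_from_append mU
    by (simp add: ncorrect_append length_run_from gU(1)) (simp add: U_def ncorrect_update_ops)
  have T: "snd (run_from D ops (fst \<circ> s)) = snd (snd (exec (update_tree ?p \<pi>) (fst \<circ> s))) + snd (run_from D Q (fst \<circ> s'))"
    unfolding ops run_from_append mU cU ..
  have "probe_cost \<eta> ^ snd (snd (exec (update_tree ?p \<pi>) (fst \<circ> s))) *
      ((1 + \<eta>) ^ (ones L \<tau> * ncorrect E ops (fst (run_from D ops (fst \<circ> s)))) * probe_cost \<eta> ^ snd (run_from D Q (fst \<circ> s')))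
    \<le> (\<Prod>l<L. weight (level_read \<eta> l) (update_tree ?p \<pi>) s \<tau>) *
      (\<Prod>l<L. lqweight \<eta> l \<tau> ?p (suffix_map L ?\<sigma> ?p) ?xs s')"
    unfolding nc using q \<eta> probe_cost_bounds[OF \<eta>]
    by (intro mult_mono prod_weight) (auto intro!: prod_nonneg weight_nonneg level_read_nonneg)
  also have "\<dots> = (\<Prod>l<L. lmweight \<eta> l \<tau> \<sigma> \<pi> \<delta> s)"
    unfolding mweight_def target_def s'_def prod.distrib ..
  finally have "(1 + \<eta>) ^ (ones L \<tau> * ncorrect E ops (fst (run_from D ops (fst \<circ> s))))
      * probe_cost \<eta> ^ snd (run_from D ops (fst \<circ> s))
      \<le> (\<Prod>l<L. lmweight \<eta> l \<tau> \<sigma> \<pi> \<delta> s)"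
    unfolding T power_add by (simp only: mult_ac)
  moreover have "mem_after D ops (fst \<circ> s) = fst \<circ> mpost \<tau> \<sigma> \<pi> \<delta> s"
    unfolding ops mem_after_append mU mpost_def target_def s'_def[symmetric] using q by blast
  moreover have "fold apply_operation ops E = edges L ?\<sigma> (lower_ends L)"
    unfolding ops fold_append comp_apply gU using q by blast
  moreover have "forests E ops"
    unfolding ops by (rule forests_append[OF gU(2)]) (unfold gU(1), use q in blast)
  moreover have "nqueries ops = 2 ^ L"
    unfolding ops nqueries_simps using q zip_depths(2)[OF \<delta>] by (simp only: U_def nqueries_update_ops add_0)
  ultimately show ?thesis by blast
qed

text \<open>\<open>X j\<close> counts the correct answers at a single time. Their total is not
  enough, since an answer at time \<open>\<tau> + j\<close> is rewarded at
  \<open>ones L (\<tau> + j)\<close> levels.\<close>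

lemma run_link:
  assumes \<eta>: "0 \<le> \<eta>"
  shows "(\<And>p. \<sigma> p \<in> perms) \<Longrightarrow> set r \<subseteq> perms \<times> depths \<Longrightarrow> \<tau> + length r \<le> 2 ^ L \<Longrightarrow>
    (\<And>j. j < length r \<Longrightarrow> \<sigma> (column (\<tau> + j)) = (\<lambda>x. x)) \<Longrightarrow>
    \<exists>X. (\<forall>j<length r. X j \<le> 2 ^ L) \<and>
      (\<Sum>j<length r. X j) = ncorrect (edges L \<sigma> (lower_ends L)) (run_ops L \<tau> \<sigma> r) (fst (run_from D (run_ops L \<tau> \<sigma> r) (fst \<circ> s))) \<and>
      (1 + \<eta>) ^ (\<Sum>j<length r. ones L (\<tau> + j) * X j) * probe_cost \<eta> ^ snd (run_from D (run_ops L \<tau> \<sigma> r) (fst \<circ> s))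
        \<le> (\<Prod>l<L. lweight \<eta> l \<tau> \<sigma> r s)
      \<and> forests (edges L \<sigma> (lower_ends L)) (run_ops L \<tau> \<sigma> r)
      \<and> nqueries (run_ops L \<tau> \<sigma> r) = 2 ^ L * length r"
proof (induction r arbitrary: \<tau> \<sigma> s)
  case Nil
  then show ?case by (simp add: forest_edges)
next
  case (Cons a r)
  obtain \<pi> \<delta> where a: "a = (\<pi>, \<delta>)" by (cases a)
  have \<pi>: "\<pi> \<in> perms" and \<delta>: "\<delta> \<in> depths" and r: "set r \<subseteq> perms \<times> depths"
    using Cons.prems(2) unfolding a by auto
  let ?\<sigma> = "\<sigma>(column \<tau> := \<pi>)"
  let ?E = "edges L \<sigma> (lower_ends L)"
  let ?E' = "edges L ?\<sigma> (lower_ends L)"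
  let ?s = "mpost \<tau> \<sigma> \<pi> \<delta> s"
  define M where "M = macro_ops L \<tau> \<sigma> \<pi> \<delta>"
  define R where "R = run_ops L (Suc \<tau>) ?\<sigma> r"
  have ops: "run_ops L \<tau> \<sigma> (a # r) = M @ R" unfolding a run_ops.simps M_def R_def ..
  have id: "\<sigma> (column \<tau>) = (\<lambda>x. x)" using Cons.prems(4)[of 0] by simp
  note m = macro_link[where \<sigma>=\<sigma> and \<tau>=\<tau> and s=s, OF \<eta> Cons.prems(1) \<pi> \<delta> id, folded M_def]
  have \<sigma>': "?\<sigma> p \<in> perms" for p using Cons.prems(1) \<pi> by simp
  have len: "Suc \<tau> + length r \<le> 2 ^ L" using Cons.prems(3) by simp
  \<comment> \<open>Distinct times have distinct columns, so each column still carries the identity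
    when its turn comes.\<close>
  have id': "?\<sigma> (column (Suc \<tau> + j)) = (\<lambda>x. x)" if j: "j < length r" for j
  proof -
    have "column (Suc \<tau> + j) \<noteq> column \<tau>"
      using rev_pos_inj[of "Suc \<tau> + j" L \<tau>] len j by auto
    then show ?thesis using Cons.prems(4)[of "Suc j"] j by simp
  qed
  obtain X where X: "\<forall>j<length r. X j \<le> 2 ^ L"
      "(\<Sum>j<length r. X j) = ncorrect ?E' R (fst (run_from D R (fst \<circ> ?s)))"
      "(1 + \<eta>) ^ (\<Sum>j<length r. ones L (Suc \<tau> + j) * X j) * probe_cost \<eta> ^ snd (run_from D R (fst \<circ> ?s))
        \<le> (\<Prod>l<L. lweight \<eta> l (Suc \<tau>) ?\<sigma> r ?s)"
      "forests ?E' R" "nqueries R = 2 ^ L * length r"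
    using Cons.IH[where \<sigma>="?\<sigma>" and \<tau>="Suc \<tau>" and s="?s", OF \<sigma>' r len id'] unfolding R_def by blast
  define x where "x = ncorrect ?E M (fst (run_from D M (fst \<circ> s)))"
  define X' where "X' j = (if j = 0 then x else X (j - 1))" for j
  have mem: "mem_after D M (fst \<circ> s) = fst \<circ> ?s" using m by blast
  have gM: "fold apply_operation M ?E = ?E'" using m by blast
  have "x \<le> 2 ^ L" unfolding x_def using ncorrect_le[of ?E M] m by metis
  then have X'le: "\<forall>j<length (a # r). X' j \<le> 2 ^ L"
    using X(1) unfolding X'_def by auto
  have sumS: "(\<Sum>j<length (a # r). f j * X' j) = f 0 * x + (\<Sum>j<length r. f (Suc j) * X j)" for f :: "nat \<Rightarrow> nat"
    unfolding list.size add_Suc_right add_0_right sum.lessThan_Suc_shift by (simp add: X'_def)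
  have "(\<Sum>j<length (a # r). X' j) = ncorrect ?E (M @ R) (fst (run_from D (M @ R) (fst \<circ> s)))"
    using sumS[of "\<lambda>_. 1"] X(2) unfolding run_from_append mem
    by (simp add: ncorrect_append length_run_from gM x_def)
  moreover have "(1 + \<eta>) ^ (\<Sum>j<length (a # r). ones L (\<tau> + j) * X' j) * probe_cost \<eta> ^ snd (run_from D (M @ R) (fst \<circ> s))
        \<le> (\<Prod>l<L. lweight \<eta> l \<tau> \<sigma> (a # r) s)"
  proof -
    have "((1 + \<eta>) ^ (ones L \<tau> * x) * probe_cost \<eta> ^ snd (run_from D M (fst \<circ> s))) *
      ((1 + \<eta>) ^ (\<Sum>j<length r. ones L (Suc \<tau> + j) * X j) * probe_cost \<eta> ^ snd (run_from D R (fst \<circ> ?s)))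
      \<le> (\<Prod>l<L. lmweight \<eta> l \<tau> \<sigma> \<pi> \<delta> s) * (\<Prod>l<L. lweight \<eta> l (Suc \<tau>) ?\<sigma> r ?s)"
    proof (rule mult_mono)
      show "(1 + \<eta>) ^ (ones L \<tau> * x) * probe_cost \<eta> ^ snd (run_from D M (fst \<circ> s))
          \<le> (\<Prod>l<L. lmweight \<eta> l \<tau> \<sigma> \<pi> \<delta> s)"
        unfolding x_def using m by blast
    qed (use X(3) \<eta> probe_cost_bounds[OF \<eta>] in \<open>auto intro!: prod_nonneg mweight_nonneg level_read_nonneg level_gain_nonneg\<close>)
    also have "\<dots> = (\<Prod>l<L. lweight \<eta> l \<tau> \<sigma> (a # r) s)"
      unfolding a rweight.simps prod.distrib ..
    finally show ?thesis
      unfolding sumS run_from_append mem power_add by (simp add: mult_ac)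
  qed
  moreover have "forests ?E (M @ R)"
    by (rule forests_append[OF _ X(4)[folded gM]]) (use m in blast)
  moreover have "nqueries (M @ R) = 2 ^ L * length (a # r)"
    using X(5) m by simp
  ultimately show ?case unfolding ops using X'le by blast
qed

end

section \<open>The hard inputs\<close>

lemma sum_lessThan_double:
  fixes f :: "nat \<Rightarrow> real"
  shows "(\<Sum>t<2 * n. f t) = (\<Sum>t<n. f (2 * t) + f (Suc (2 * t)))"
  by (induction n) auto

lemma ones_Suc: "ones (Suc L) t = of_bool (odd t) + ones L (t div 2)"
  unfolding ones_def card_less_Suc_split by (simp add: div_mult2_eq)

text \<open>The second moment of a walk of \<open>L\<close> steps +1 or -1; with the lowest bit
  split off, it follows from \<open>(d + 1)^2 + (d - 1)^2 = 2 * d^2 + 2\<close>.\<close>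

lemma sum_ones_variance: "(\<Sum>t<2 ^ L. (2 * real (ones L t) - real L)\<^sup>2) = 2 ^ L * real L"
proof (induction L)
  case (Suc L)
  have "(2 * real (ones (Suc L) (2 * t)) - real (Suc L))\<^sup>2 + (2 * real (ones (Suc L) (Suc (2 * t))) - real (Suc L))\<^sup>2
      = 2 * (2 * real (ones L t) - real L)\<^sup>2 + 2" for t
    by (simp add: ones_Suc power2_eq_square algebra_simps)
  then have "(\<Sum>t<2 ^ Suc L. (2 * real (ones (Suc L) t) - real (Suc L))\<^sup>2)
      = (\<Sum>t<2 ^ L. 2 * (2 * real (ones L t) - real L)\<^sup>2 + 2)"
    unfolding power_Suc sum_lessThan_double by simp
  also have "\<dots> = 2 * (2 ^ L * real L) + 2 * 2 ^ L"
    unfolding sum.distrib sum_distrib_left[symmetric] Suc.IH by simp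
  finally show ?case by (simp add: algebra_simps)
qed (simp add: ones_def)

text \<open>The correct answers might be concentrated on times with few ones. The variance limits
  the damage to \<open>sqrt L / 2\<close> per query on average, which is small against the advantage
  \<open>L / 2 * \<delta>\<close> when \<open>L * \<delta>\<^sup>2\<close> is large.\<close>

lemma ones_weighted_sum:
  fixes X :: "nat \<Rightarrow> nat"
  assumes L: "0 < L" and X: "\<And>j. j < 2 ^ L \<Longrightarrow> X j \<le> m"
  shows "real L / 2 * real (\<Sum>j<2 ^ L. X j) - sqrt (real L) / 2 * (real m * 2 ^ L)
    \<le> real (\<Sum>j<2 ^ L. ones L j * X j)"
proof -
  define d where "d j = 2 * real (ones L j) - real L" for j
  define r where "r = sqrt (real L)"
  have r: "0 < r" "r * r = real L" using L unfolding r_def by auto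
  have dev: "- d j * real (X j) \<le> real m * (((d j)\<^sup>2 / r + r) / 2)" if "j < 2 ^ L" for j
  proof -
    \<comment> \<open>AM-GM; the choice \<open>r = sqrt L\<close> balances the two terms after
      summation over all times.\<close>
    have "0 \<le> (\<bar>d j\<bar> - r)\<^sup>2" by simp
    then have "2 * \<bar>d j\<bar> * r \<le> (d j)\<^sup>2 + r * r" by (simp add: power2_eq_square algebra_simps)
    then have abs: "\<bar>d j\<bar> \<le> ((d j)\<^sup>2 / r + r) / 2" using r(1) by (simp add: field_simps)
    have "- d j * real (X j) \<le> \<bar>d j\<bar> * real m"
      using X[OF that] by (intro mult_mono) auto
    also have "\<dots> \<le> real m * (((d j)\<^sup>2 / r + r) / 2)"
      using mult_left_mono[OF abs, of "real m"] by (simp add: mult.commute)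
    finally show ?thesis .
  qed
  have "(\<Sum>j<2 ^ L. - d j * real (X j)) \<le> (\<Sum>j<2 ^ L. real m * (((d j)\<^sup>2 / r + r) / 2))"
    by (intro sum_mono dev) auto
  also have "\<dots> = real m * (((\<Sum>j<2 ^ L. (d j)\<^sup>2) / r + 2 ^ L * r) / 2)"
    by (simp add: sum_distrib_left[symmetric] sum_divide_distrib[symmetric] sum.distrib)
  also have "(\<Sum>j<2 ^ L. (d j)\<^sup>2) = 2 ^ L * (r * r)" unfolding d_def sum_ones_variance r ..
  also have "real m * ((2 ^ L * (r * r) / r + 2 ^ L * r) / 2) = real m * 2 ^ L * r" using r(1) by simp
  finally have "(\<Sum>j<2 ^ L. - d j * real (X j)) \<le> real m * 2 ^ L * r" .
  moreover have "(\<Sum>j<2 ^ L. - d j * real (X j)) = real L * real (\<Sum>j<2 ^ L. X j) - 2 * real (\<Sum>j<2 ^ L. ones L j * X j)"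
    unfolding d_def by (simp add: left_diff_distrib sum_subtractf sum_distrib_left mult.assoc)
  ultimately show ?thesis unfolding r_def by (simp add: algebra_simps)
qed

text \<open>The graph starts empty, so the identity grid is built within the operation sequence;
  this takes O(n) insertions.\<close>

definition init_ops :: "nat \<Rightarrow> operation list" where
  "init_ops L = map (\<lambda>u. Insert u (parent L (\<lambda>_ x. x) u)) [0..<vertex L (2 ^ L) (2 ^ L - 1)]"

definition inputs :: "nat \<Rightarrow> ((nat \<Rightarrow> nat) list \<times> nat list list) set" where
  "inputs L = words (2 ^ L) {\<pi>. \<pi> permutes {..<2 ^ L}} \<times> words (2 ^ L) (words (2 ^ L) {..<L})"

definition instance_ops :: "nat \<Rightarrow> (nat \<Rightarrow> nat) list \<times> nat list list \<Rightarrow> operation list" where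
  "instance_ops L \<omega> = init_ops L @ run_ops L 0 (\<lambda>_ x. x) (zip (fst \<omega>) (snd \<omega>))"

lemma init_ops_graph:
  "fold apply_operation (init_ops L) {} = edges L (\<lambda>_ x. x) (lower_ends L)" "forests {} (init_ops L)"
proof -
  have e: "{} = edges L (\<lambda>_ x. x) {}" by (simp add: edges_def)
  show "fold apply_operation (init_ops L) {} = edges L (\<lambda>_ x. x) (lower_ends L)"
    unfolding init_ops_def by (subst e, subst insert_edges[THEN conjunct1]) (simp add: lower_ends_def atLeast0LessThan)
  show "forests {} (init_ops L)"
    unfolding init_ops_def by (subst e) (rule insert_edges[THEN conjunct2])
qed

lemma init_ops_on: "o' \<in> set (init_ops L) \<Longrightarrow> operation_on ((2 ^ L + 1) * 2 ^ L) o'"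
proof -
  assume "o' \<in> set (init_ops L)"
  then obtain u where u: "u < vertex L (2 ^ L) (2 ^ L - 1)" and o': "o' = Insert u (parent L (\<lambda>_ x. x) u)"
    unfolding init_ops_def by auto
  have top: "vertex L (2 ^ L) (2 ^ L - 1) < (2 ^ L + 1) * 2 ^ L" by (rule vertex_less) auto
  have "parent L (\<lambda>_ x. x) u < (2 ^ L + 1) * 2 ^ L"
  proof (cases "u < 2 ^ L * 2 ^ L")
    case True
    then have "u div 2 ^ L < 2 ^ L" by (rule less_mult_imp_div_less)
    then have "vertex L (Suc (u div 2 ^ L)) (u mod 2 ^ L) < (2 ^ L + 1) * 2 ^ L"
      by (intro vertex_less) auto
    then show ?thesis using True unfolding parent_def by simp
  next
    case False
    then have "parent L (\<lambda>_ x. x) u = Suc u" by (simp add: parent_def)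
    then show ?thesis using u top by simp
  qed
  moreover have "u \<noteq> parent L (\<lambda>_ x. x) u" using parent_gt[of u L "\<lambda>_ x. x"] by simp
  ultimately show ?thesis unfolding o' using u top by simp
qed

lemma nqueries_init_ops: "nqueries (init_ops L) = 0"
proof -
  have "nqueries (map (\<lambda>u. Insert u (f u)) us) = 0" for f us by (induction us) auto
  then show ?thesis unfolding init_ops_def .
qed

lemma length_init_ops: "length (init_ops L) \<le> 2 * 4 ^ L"
proof -
  have "(2::nat) ^ L \<le> 4 ^ L" by (intro power_mono) auto
  moreover have "(2::nat) ^ L * 2 ^ L = 4 ^ L" by (simp add: power_mult_distrib[symmetric])
  ultimately show ?thesis unfolding init_ops_def vertex_def by simp
qed

lemma operation_on_mono: "operation_on n x \<Longrightarrow> n \<le> n' \<Longrightarrow> operation_on n' x"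
  by (cases x) auto

context process
begin

lemma query_ops_on:
  "p < 2 ^ L \<Longrightarrow> (\<And>x. x < 2 ^ L \<Longrightarrow> y x < 2 ^ L) \<Longrightarrow> set xs \<subseteq> {..<2 ^ L} \<times> {..<L} \<Longrightarrow>
    o' \<in> set (query_ops L p y xs) \<Longrightarrow> operation_on ((2 ^ L + 1) * 2 ^ L) o'"
proof (induction xs)
  case (Cons a xs)
  obtain x e where a: "a = (x, e)" by (cases a)
  have x: "x < 2 ^ L" and e: "e < L" using Cons.prems(3) unfolding a by auto
  have z: "0 < cutpoint e (y x)" "cutpoint e (y x) < 2 ^ L"
    using cutpoint_pos cutpoint_less[OF e Cons.prems(2)[OF x]] by auto
  have "o' \<in> {cut_op L (cutpoint e (y x)), query_op L p x, link_op L (cutpoint e (y x))} \<or> o' \<in> set (query_ops L p y xs)"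
    using Cons.prems(4) unfolding a by auto
  moreover have "operation_on ((2 ^ L + 1) * 2 ^ L) o'" if "o' \<in> set (query_ops L p y xs)"
    using Cons.prems that by (intro Cons.IH) auto
  ultimately show ?case
    using cut_op_on[OF z] link_op_on[OF z] query_op_on[OF Cons.prems(1) x] by blast
qed simp

lemma run_ops_on:
  "(\<And>p. \<sigma> p \<in> perms) \<Longrightarrow> set r \<subseteq> perms \<times> depths \<Longrightarrow> o' \<in> set (run_ops L \<tau> \<sigma> r) \<Longrightarrow>
    operation_on ((2 ^ L + 1) * 2 ^ L) o'"
proof (induction r arbitrary: \<tau> \<sigma>)
  case (Cons a r)
  obtain \<pi> \<delta> where a: "a = (\<pi>, \<delta>)" by (cases a)
  have \<pi>: "\<pi> \<in> perms" and \<delta>: "\<delta> \<in> depths" and r: "set r \<subseteq> perms \<times> depths"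
    using Cons.prems(2) unfolding a by auto
  have \<sigma>': "(\<sigma>(column \<tau> := \<pi>)) p \<in> perms" for p using Cons.prems(1) \<pi> by simp
  consider "o' \<in> set (update_ops L (column \<tau>) \<pi>)"
    | "o' \<in> set (query_ops L (column \<tau>) (target \<tau> \<sigma> \<pi>) (zip [0..<2 ^ L] \<delta>))"
    | "o' \<in> set (run_ops L (Suc \<tau>) (\<sigma>(column \<tau> := \<pi>)) r)"
    using Cons.prems(3) unfolding a by (auto simp: macro_ops_def target_def)
  then show ?case
  proof cases
    case 1
    show ?thesis by (rule update_ops_on[OF rev_pos_less permD[OF \<pi>] 1])
  next
    case 2
    show ?thesis by (rule query_ops_on[OF rev_pos_less target_less[OF Cons.prems(1) \<pi>] zip_depths(1)[OF \<delta>] 2])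
  next
    case 3
    then show ?thesis by (rule Cons.IH[OF \<sigma>' r])
  qed
qed simp

lemma length_query_ops: "length (query_ops L p y xs) = 3 * length xs"
  by (induction xs) auto

lemma length_run_ops: "set r \<subseteq> perms \<times> depths \<Longrightarrow> length (run_ops L \<tau> \<sigma> r) = 5 * 2 ^ L * length r"
proof (induction r arbitrary: \<tau> \<sigma>)
  case (Cons a r)
  obtain \<pi> \<delta> where a: "a = (\<pi>, \<delta>)" by (cases a)
  have "length \<delta> = 2 ^ L" using Cons.prems unfolding a words_def by auto
  then show ?case using Cons unfolding a
    by (simp add: macro_ops_def update_ops_def length_query_ops)
qed simp

lemma inputs_eq: "inputs L = words (2 ^ L) perms \<times> words (2 ^ L) depths"
  unfolding inputs_def perms_def ..

lemma inputs_zip: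
  assumes "\<omega> \<in> inputs L"
  shows "set (zip (fst \<omega>) (snd \<omega>)) \<subseteq> perms \<times> depths" "length (zip (fst \<omega>) (snd \<omega>)) = 2 ^ L"
proof -
  have "fst \<omega> \<in> words (2 ^ L) perms" "snd \<omega> \<in> words (2 ^ L) depths"
    using assms by (auto simp: inputs_eq)
  note \<omega> = this[THEN wordsD(1)] this[THEN wordsD(2)]
  show "set (zip (fst \<omega>) (snd \<omega>)) \<subseteq> perms \<times> depths" by (rule set_zip_subset[OF \<omega>(1,2)])
  show "length (zip (fst \<omega>) (snd \<omega>)) = 2 ^ L" by (simp add: \<omega>)
qed

lemma id_perms: "(\<lambda>x. x) \<in> perms"
  unfolding perms_def using permutes_id[of "{..<2 ^ L}"] by (simp add: id_def)

end

lemma inputs_finite: "finite (inputs L)"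
  and inputs_nonempty: "0 < L \<Longrightarrow> inputs L \<noteq> {}"
  and card_inputs: "card (inputs L) = (fact (2 ^ L) * L ^ 2 ^ L) ^ 2 ^ L"
proof -
  have f: "finite {\<pi>. \<pi> permutes {..<2 ^ L :: nat}}" by (intro finite_permutations) simp
  show "finite (inputs L)" unfolding inputs_def by (intro finite_cartesian_product finite_words f) simp
  show c: "card (inputs L) = (fact (2 ^ L) * L ^ 2 ^ L) ^ 2 ^ L"
    unfolding inputs_def
    by (simp add: card_cartesian_product card_words f finite_words card_permutations power_mult_distrib)
  show "inputs L \<noteq> {}" if "0 < L"
  proof
    assume "inputs L = {}"
    then have "card (inputs L) = 0" by simp
    then show False using that c by simp
  qed
qed

lemma instance_ops_props:
  assumes L: "0 < L" and \<omega>: "\<omega> \<in> inputs L" and n: "2 * 4 ^ L \<le> n"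
  shows "length (instance_ops L \<omega>) \<le> 4 * n"
    and "\<And>x. x \<in> set (instance_ops L \<omega>) \<Longrightarrow> operation_on n x"
    and "forest_throughout (instance_ops L \<omega>)"
    and "nqueries (instance_ops L \<omega>) = 4 ^ L"
proof -
  \<comment> \<open>The properties of the input do not involve a data structure. A trivial one, with
    words of 0 bits, gives access to \<open>run_link\<close>.\<close>
  interpret ds_process L 0 "\<lparr>initial_memory = \<lambda>_. 0, procedure = \<lambda>_. Return False\<rparr>"
    by unfold_locales (use L in auto)
  let ?r = "zip (fst \<omega>) (snd \<omega>)"
  note r = inputs_zip[OF \<omega>]
  have sq: "(2::nat) ^ L * 2 ^ L = 4 ^ L" by (simp add: power_mult_distrib[symmetric])
  have "length (instance_ops L \<omega>) \<le> 2 * 4 ^ L + 5 * 4 ^ L"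
    unfolding instance_ops_def length_append length_run_ops[OF r(1)] r(2)
    using length_init_ops[of L] sq by simp
  then show "length (instance_ops L \<omega>) \<le> 4 * n" using n by simp
  have N: "(2 ^ L + 1) * 2 ^ L \<le> n"
  proof -
    have "(2::nat) ^ L \<le> 4 ^ L" by (intro power_mono) auto
    then show ?thesis using n sq by (simp add: distrib_right)
  qed
  show "operation_on n x" if "x \<in> set (instance_ops L \<omega>)" for x
    using that init_ops_on run_ops_on[OF id_perms r(1)] unfolding instance_ops_def
    by (auto intro: operation_on_mono[OF _ N])
  obtain X where X: "forests (edges L (\<lambda>_ x. x) (lower_ends L)) (run_ops L 0 (\<lambda>_ x. x) ?r)"
    "nqueries (run_ops L 0 (\<lambda>_ x. x) ?r) = 2 ^ L * length ?r"
    using run_link[of 0 "\<lambda>_ x. x" ?r 0] id_perms r by auto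
  show "nqueries (instance_ops L \<omega>) = 4 ^ L"
    unfolding instance_ops_def nqueries_simps nqueries_init_ops X r sq by simp
  have "forests {} (instance_ops L \<omega>)"
    unfolding instance_ops_def by (rule forests_append[OF init_ops_graph(2)]) (unfold init_ops_graph(1), rule X(1))
  then show "forest_throughout (instance_ops L \<omega>)"
    unfolding forests_def forest_throughout_def graph_after_def .
qed

section \<open>Success probability\<close>

context ds_process
begin

text \<open>A time \<open>t\<close> counts as a right half on \<open>ones L t\<close> of the \<open>L\<close> levels, which is close to \<open>L / 2\<close> for
  most \<open>t\<close>. Hence on average over the levels half of the queries are charged at a level.\<close>

lemma succeeds_weight:
  assumes \<eta>: "0 \<le> \<eta>" and \<omega>: "\<omega> \<in> inputs L"
    and suc: "succeeds n \<epsilon> \<delta> (instance_ops L \<omega>) D"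
    and half: "0 \<le> 1 / 2 + \<delta>"
  defines "m \<equiv> mem_after D (init_ops L) (initial_memory D)"
  shows "exp (ln (1 + \<eta>) * (real L / 2 * ((1 / 2 + \<delta>) * 4 ^ L) - sqrt (real L) / 2 * 4 ^ L)
      + \<epsilon> * real n * log 2 (real n) * ln (probe_cost \<eta>))
    \<le> (\<Prod>l<L. lweight \<eta> l 0 (\<lambda>_ x. x) (zip (fst \<omega>) (snd \<omega>)) (\<lambda>a. (m a, 0)))"
proof -
  let ?r = "zip (fst \<omega>) (snd \<omega>)"
  let ?ops = "run_ops L 0 (\<lambda>_ x. x) ?r"
  let ?s = "\<lambda>a. (m a, 0::nat)"
  let ?E = "edges L (\<lambda>_ x. x) (lower_ends L)"
  have ms: "fst \<circ> ?s = m" by auto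
  note r = inputs_zip[OF \<omega>]
  have sq: "(2::nat) ^ L * 2 ^ L = 4 ^ L" by (simp add: power_mult_distrib[symmetric])
  have sqr: "real (2 ^ L) * 2 ^ L = 4 ^ L" by (simp add: power_mult_distrib[symmetric])
  have "0 + length ?r \<le> 2 ^ L" using r(2) by simp
  from run_link[where \<sigma>="\<lambda>_ x. x" and r="?r" and \<tau>=0 and s="?s", OF \<eta> id_perms r(1) this refl]
  obtain X where X: "\<forall>j<length ?r. X j \<le> 2 ^ L"
     "(\<Sum>j<length ?r. X j) = ncorrect ?E ?ops (fst (run_from D ?ops (fst \<circ> ?s)))"
     "(1 + \<eta>) ^ (\<Sum>j<length ?r. ones L (0 + j) * X j) * probe_cost \<eta> ^ snd (run_from D ?ops (fst \<circ> ?s))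
        \<le> (\<Prod>l<L. lweight \<eta> l 0 (\<lambda>_ x. x) ?r ?s)"
     "nqueries ?ops = 2 ^ L * length ?r"
    by blast
  define T where "T = snd (run_from D ?ops m)"
  define S where "S = (\<Sum>j<2 ^ L. ones L j * X j)"
  define c where "c = ncorrect {} (instance_ops L \<omega>) (fst (run D (instance_ops L \<omega>)))"
  have run: "fst (run D (instance_ops L \<omega>)) = fst (run_from D (init_ops L) (initial_memory D)) @ fst (run_from D ?ops m)"
    "snd (run D (instance_ops L \<omega>)) = snd (run_from D (init_ops L) (initial_memory D)) + T"
    unfolding run_def instance_ops_def run_from_append m_def T_def by simp_all
  have "ncorrect {} (init_ops L) bs = 0" for bs
    using ncorrect_le[of "{}" "init_ops L" bs] nqueries_init_ops by simp
  then have c: "c = (\<Sum>j<2 ^ L. X j)"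
    unfolding c_def run unfolding instance_ops_def
    using X(2)[unfolded r(2)] by (simp add: ncorrect_append length_run_from init_ops_graph r(2) ms)
  have len: "length (fst (run D (instance_ops L \<omega>))) = length (instance_ops L \<omega>)"
    unfolding run_def by (rule length_run_from)
  have nq: "nqueries (instance_ops L \<omega>) = 4 ^ L"
    unfolding instance_ops_def nqueries_simps nqueries_init_ops X(4) r(2) sq by simp
  \<comment> \<open>The probes made while the initial grid is built are dropped from the total, so
    the time bound remains valid for \<open>T\<close>.\<close>
  have "(1 / 2 + \<delta>) * 4 ^ L \<le> real c" and Tle: "real T \<le> \<epsilon> * real n * log 2 (real n)"
    using suc unfolding succeeds_def case_prod_beta card_correct_positions[OF len] card_query_positions nq c_def[symmetric]
      run(2) by simp_all
  then have "real L / 2 * ((1 / 2 + \<delta>) * 4 ^ L) - sqrt (real L) / 2 * 4 ^ L \<le> real L / 2 * real c - sqrt (real L) / 2 * (real (2 ^ L) * 2 ^ L)"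
    unfolding sqr by (intro diff_mono mult_left_mono) simp_all
  also have "\<dots> \<le> real S"
    unfolding c S_def using X(1)[unfolded r(2)] by (intro ones_weighted_sum L) simp
  finally have "ln (1 + \<eta>) * (real L / 2 * ((1 / 2 + \<delta>) * 4 ^ L) - sqrt (real L) / 2 * 4 ^ L) \<le> ln (1 + \<eta>) * real S"
    using \<eta> by (intro mult_left_mono) auto
  moreover have "\<epsilon> * real n * log 2 (real n) * ln (probe_cost \<eta>) \<le> real T * ln (probe_cost \<eta>)"
    using Tle probe_cost_bounds[OF \<eta>] by (intro mult_right_mono_neg) auto
  ultimately have "exp (ln (1 + \<eta>) * (real L / 2 * ((1 / 2 + \<delta>) * 4 ^ L) - sqrt (real L) / 2 * 4 ^ L)
      + \<epsilon> * real n * log 2 (real n) * ln (probe_cost \<eta>)) \<le> exp (real S * ln (1 + \<eta>) + real T * ln (probe_cost \<eta>))"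
    by (simp add: mult.commute add_mono)
  also have "\<dots> = (1 + \<eta>) ^ S * probe_cost \<eta> ^ T"
    using \<eta> probe_cost_bounds[OF \<eta>] by (simp add: exp_add exp_of_nat_mult)
  also have "\<dots> \<le> (\<Prod>l<L. lweight \<eta> l 0 (\<lambda>_ x. x) ?r ?s)"
    using X(3) unfolding ms T_def S_def r(2) by simp
  finally show ?thesis .
qed

text \<open>On success the product of the \<open>L\<close> level weights is at least
  \<open>exp (L * \<theta>)\<close>, so some level alone has weight at least
  \<open>exp \<theta>\<close>. Expectations are thus needed for single levels only, and nothing
  about the joint behaviour of the levels; the union over them costs the factor
  \<open>L\<close>.\<close>

lemma success_count:
  fixes n :: nat and \<epsilon> \<delta> :: real
  assumes \<eta>: "0 \<le> \<eta>" and half: "0 \<le> 1 / 2 + \<delta>" and mem: "word_memory w (initial_memory D)"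
  defines "\<theta> \<equiv> ln (1 + \<eta>) * (1 / 2 * ((1 / 2 + \<delta>) * 4 ^ L) - 4 ^ L / (2 * sqrt (real L)))
      + \<epsilon> * real n * log 2 (real n) * ln (probe_cost \<eta>) / real L"
  shows "real (card {\<omega> \<in> inputs L. succeeds n \<epsilon> \<delta> (instance_ops L \<omega>) D})
    \<le> real (card (inputs L)) * (real L * sqrt ((1 + exp \<eta>) / 2 * exp (1 / real L)) ^ 4 ^ L * exp (- \<theta>))"
proof -
  define m where "m = mem_after D (init_ops L) (initial_memory D)"
  define W where "W l \<omega> = lweight \<eta> l 0 (\<lambda>_ x. x) (zip (fst \<omega>) (snd \<omega>)) (\<lambda>a. (m a, 0))" for l \<omega>
  define G where "G = {\<omega> \<in> inputs L. succeeds n \<epsilon> \<delta> (instance_ops L \<omega>) D}"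
  define V where "V = sqrt ((1 + exp \<eta>) / 2 * exp (1 / real L)) ^ 4 ^ L"
  have W0: "0 \<le> W l \<omega>" for l \<omega>
    unfolding W_def by (intro rweight_nonneg level_read_nonneg level_gain_nonneg \<eta>)
  have fin: "finite G" unfolding G_def using inputs_finite by simp
  have big: "exp \<theta> \<le> (\<Sum>l<L. W l \<omega>)" if "\<omega> \<in> G" for \<omega>
  proof (rule ccontr)
    assume not: "\<not> exp \<theta> \<le> (\<Sum>l<L. W l \<omega>)"
    have "W l \<omega> < exp \<theta>" if "l < L" for l
    proof -
      have "W l \<omega> \<le> (\<Sum>l<L. W l \<omega>)" using that W0 by (intro member_le_sum) auto
      then show ?thesis using not by simp
    qed
    then have "(\<Prod>l<L. W l \<omega>) < (\<Prod>l<L. exp \<theta>)"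
      using W0 L by (intro prod_mono_strict) (auto intro: less_imp_le)
    also have "\<dots> = exp (real L * \<theta>)" by (simp add: exp_of_nat_mult)
    also have "real L * \<theta> = ln (1 + \<eta>) * (real L / 2 * ((1 / 2 + \<delta>) * 4 ^ L) - sqrt (real L) / 2 * 4 ^ L)
      + \<epsilon> * real n * log 2 (real n) * ln (probe_cost \<eta>)"
    proof -
      have "real L / sqrt (real L) = sqrt (real L)" by (rule real_div_sqrt) simp
      moreover have "real L * (4 ^ L / (2 * sqrt (real L))) = real L / sqrt (real L) / 2 * 4 ^ L" by simp
      ultimately have eq: "real L * (4 ^ L / (2 * sqrt (real L))) = sqrt (real L) / 2 * 4 ^ L" by simp
      have "x * (g * (1 / 2 * y - z) + e / x) = g * (x / 2 * y - x * z) + e" if "x \<noteq> 0" for x g y z e :: real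
        using that by (simp add: field_simps)
      then show ?thesis unfolding \<theta>_def eq[symmetric] using L by simp
    qed
    finally show False
      using succeeds_weight[OF \<eta> _ _ half, of \<omega> n \<epsilon>] that unfolding G_def W_def m_def by fastforce
  qed
  have m: "word_memory w (fst \<circ> (\<lambda>a. (m a, 0::nat)))"
  proof -
    have "word_memory w m"
      unfolding m_def using init_ops_on P by (intro word_memory_mem_after mem) blast
    then show ?thesis by (simp add: comp_def)
  qed
  have level: "(\<Sum>\<omega>\<in>inputs L. W l \<omega>) \<le> real (card (inputs L)) * V" if "l < L" for l
  proof -
    have "(\<Sum>\<omega>\<in>inputs L. W l \<omega>) = (\<Sum>ps\<in>words (2 ^ L) perms. \<Sum>ds\<in>words (2 ^ L) depths.
        lweight \<eta> l 0 (\<lambda>_ x. x) (zip ps ds) (\<lambda>a. (m a, 0)))"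
      unfolding inputs_eq W_def sum.cartesian_product by (simp add: case_prod_beta)
    also have "\<dots> \<le> real (card (inputs L)) * V"
      using level_sum[OF \<eta> that id_perms m] unfolding V_def card_inputs by simp
    finally show ?thesis .
  qed
  have "real (card G) * exp \<theta> = (\<Sum>\<omega>\<in>G. exp \<theta>)" by simp
  also have "\<dots> \<le> (\<Sum>\<omega>\<in>G. \<Sum>l<L. W l \<omega>)" by (intro sum_mono big)
  also have "\<dots> \<le> (\<Sum>\<omega>\<in>inputs L. \<Sum>l<L. W l \<omega>)"
    by (intro sum_mono2 inputs_finite sum_nonneg W0) (auto simp: G_def)
  also have "\<dots> = (\<Sum>l<L. \<Sum>\<omega>\<in>inputs L. W l \<omega>)" by (rule sum.swap)
  also have "\<dots> \<le> (\<Sum>l<L. real (card (inputs L)) * V)" by (intro sum_mono level) simp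
  finally have count: "real (card G) * exp \<theta> \<le> real L * (real (card (inputs L)) * V)" by simp
  have "real (card G) = real (card G) * exp \<theta> * exp (- \<theta>)"
    by (simp add: mult.assoc exp_minus_inverse)
  also have "\<dots> \<le> real L * (real (card (inputs L)) * V) * exp (- \<theta>)"
    by (intro mult_right_mono count) simp
  finally show ?thesis unfolding G_def V_def by (simp only: mult_ac)
qed

end

text \<open>To first order in \<eta>, the reward of answers that are right half of the time cancels
  against the moment of a fair guess. The advantage leaves a gain of about
  \<open>\<eta> * \<delta> / 4\<close> against a loss of about \<open>\<eta>\<^sup>2 / 2\<close> per
  query in the exponent, doubled to \<open>\<eta> * \<delta> / 2\<close> by the size of the
  first-order reward 1 / 2 per level; so \<eta> has to be a small multiple of \<delta>, and the
  exponent is of order \<open>\<delta>\<^sup>2\<close>. The factor \<open>L\<close>, the reads and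
  \<open>1 / L\<close> are error terms that the hypotheses keep below this.\<close>

lemma numeric_bound:
  fixes L w n :: nat and \<delta> \<epsilon> b :: real
  assumes L: "0 < L" and n: "n < 8 * 4 ^ L" "1 \<le> n" and \<delta>: "0 < \<delta>" "\<delta> \<le> 1 / 2"
    and L\<delta>: "900 \<le> real L * \<delta>\<^sup>2" and \<epsilon>: "0 \<le> \<epsilon>" "40 * \<epsilon> * (5 * b + 2) \<le> \<delta>\<^sup>2 / 64"
    and b: "0 \<le> b" and w: "real w \<le> b * log 2 (real n)"
  defines "\<eta> \<equiv> \<delta> / 4"
  defines "cost \<equiv> 2 powr (- (real w / real L)) / (1 + \<eta>) / 2"
  defines "\<theta> \<equiv> ln (1 + \<eta>) * (1 / 2 * ((1 / 2 + \<delta>) * 4 ^ L) - 4 ^ L / (2 * sqrt (real L)))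
      + \<epsilon> * real n * log 2 (real n) * ln cost / real L"
  shows "real L * sqrt ((1 + exp \<eta>) / 2 * exp (1 / real L)) ^ 4 ^ L * exp (- \<theta>)
    \<le> 2 powr (- (1 / 512 * \<delta>\<^sup>2 * real n))"
proof -
  let ?V = "sqrt ((1 + exp \<eta>) / 2 * exp (1 / real L))"
  define Q :: real where "Q = 4 ^ L"
  have Q: "0 < Q" unfolding Q_def by simp
  have "real n \<le> real (8 * 4 ^ L)" using n(1) by (simp only: of_nat_le_iff less_imp_le)
  then have nQ: "real n \<le> 8 * Q" unfolding Q_def by simp
  have \<eta>: "0 < \<eta>" "\<eta> \<le> 1 / 8" unfolding \<eta>_def using \<delta> by auto
  have Lr: "1 \<le> real L" using L by simp
  have invL: "1 / real L \<le> \<delta>\<^sup>2 / 900" using L\<delta> Lr by (simp add: field_simps)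
  \<comment> \<open>Here 900 is 30 squared: the loss through uneven numbers of ones becomes at most
    a thirtieth of the advantage.\<close>
  have invs: "1 / sqrt (real L) \<le> \<delta> / 30"
  proof -
    have "sqrt 900 \<le> sqrt (real L * \<delta>\<^sup>2)" using L\<delta> by (rule real_sqrt_le_mono)
    moreover have "sqrt 900 = (30::real)" by (rule real_sqrt_unique) auto
    ultimately have "30 \<le> sqrt (real L) * \<delta>" using \<delta> by (simp add: real_sqrt_mult)
    then show ?thesis using Lr by (simp add: field_simps)
  qed
  have sqV: "?V \<le> exp ((\<eta> / 2 + \<eta>\<^sup>2 / 2 + 1 / real L) / 2)"
  proof -
    have "exp \<eta> \<le> 1 + \<eta> + \<eta>\<^sup>2" using \<eta> by (intro exp_bound) auto
    then have "(1 + exp \<eta>) / 2 \<le> 1 + (\<eta> / 2 + \<eta>\<^sup>2 / 2)" by simp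
    also have "\<dots> \<le> exp (\<eta> / 2 + \<eta>\<^sup>2 / 2)" by (rule exp_ge_add_one_self)
    finally have "(1 + exp \<eta>) / 2 * exp (1 / real L) \<le> exp (\<eta> / 2 + \<eta>\<^sup>2 / 2) * exp (1 / real L)"
      by (intro mult_right_mono) auto
    then have "(1 + exp \<eta>) / 2 * exp (1 / real L) \<le> exp ((\<eta> / 2 + \<eta>\<^sup>2 / 2 + 1 / real L) / 2) ^ 2"
      by (simp add: exp_add[symmetric] exp_double[symmetric] power2_eq_square)
    then show ?thesis by (intro real_le_lsqrt) auto
  qed
  have pV: "?V ^ 4 ^ L \<le> exp (Q * ((\<eta> / 2 + \<eta>\<^sup>2 / 2 + 1 / real L) / 2))"
  proof -
    have "?V ^ 4 ^ L \<le> exp ((\<eta> / 2 + \<eta>\<^sup>2 / 2 + 1 / real L) / 2) ^ 4 ^ L"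
      by (intro power_mono sqV real_sqrt_ge_zero mult_nonneg_nonneg) (auto simp: add_nonneg_nonneg)
    also have "\<dots> = exp (Q * ((\<eta> / 2 + \<eta>\<^sup>2 / 2 + 1 / real L) / 2))"
      unfolding Q_def by (simp add: exp_of_nat_mult[symmetric])
    finally show ?thesis .
  qed
  \<comment> \<open>Absorbs the union over the levels: \<open>L * L \<le> 4 ^ L\<close> and
    \<open>L * \<delta>\<^sup>2 \<ge> 900\<close> give
    \<open>L \<le> 4 ^ L * \<delta>\<^sup>2 / 64\<close>.\<close>
  have LQ: "real L \<le> exp (Q * (\<delta>\<^sup>2 / 64))"
  proof -
    have "L < 2 ^ L" by (rule less_exp)
    then have "real L \<le> real (2 ^ L)" by (simp only: of_nat_le_iff less_imp_le)
    then have "real L \<le> 2 ^ L" by simp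
    then have "real L * real L \<le> 2 ^ L * 2 ^ L" by (intro mult_mono) auto
    then have LL: "real L * real L \<le> Q" unfolding Q_def by (simp add: power_mult_distrib[symmetric])
    have "real L * 14 \<le> real L * (real L * \<delta>\<^sup>2 / 64)" using L\<delta> by (intro mult_left_mono) auto
    also have "\<dots> = (real L * real L) * (\<delta>\<^sup>2 / 64)" by simp
    also have "\<dots> \<le> Q * (\<delta>\<^sup>2 / 64)" by (intro mult_right_mono LL) auto
    finally have "real L \<le> Q * (\<delta>\<^sup>2 / 64)" using Lr by simp
    also have "\<dots> \<le> exp (Q * (\<delta>\<^sup>2 / 64))" using exp_ge_add_one_self[of "Q * (\<delta>\<^sup>2 / 64)"] by linarith
    finally show ?thesis .
  qed
  have logn: "0 \<le> log 2 (real n)" "log 2 (real n) \<le> 5 * real L"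
  proof -
    show "0 \<le> log 2 (real n)" using n by simp
    have "log 2 (real n) \<le> log 2 (8 * 4 ^ L)"
      using n(2) nQ unfolding Q_def by (intro log_mono) auto
    also have "(8::real) * 4 ^ L = 2 ^ (3 + 2 * L)" by (simp add: power_add power_mult)
    also have "log 2 (2 ^ (3 + 2 * L)) = real (3 + 2 * L)" by (subst log_nat_power) auto
    finally show "log 2 (real n) \<le> 5 * real L" using Lr by simp
  qed
  \<comment> \<open>\<open>5 * b\<close> bounds \<open>w / L\<close>, as
    \<open>log 2 n \<le> 5 * L\<close>; the 2 covers the divisors 1 + \<eta> and 2.\<close>
  have cost: "- (5 * b + 2) \<le> ln cost"
  proof -
    have "real w / real L \<le> b * (5 * real L) / real L"
      using w mult_left_mono[OF logn(2) b] by (intro divide_right_mono) auto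
    then have wL: "real w / real L \<le> 5 * b" using Lr by simp
    have "ln cost = - (real w / real L) * ln 2 - ln (1 + \<eta>) - ln 2"
      unfolding cost_def using \<eta>
      by (subst ln_divide_pos, simp, simp, subst ln_divide_pos, simp, simp, simp add: ln_powr)
    moreover have "real w / real L * ln 2 \<le> 5 * b"
    proof -
      have "real w / real L * ln 2 \<le> real w / real L * 1"
        using ln_2_less_1 by (intro mult_left_mono) auto
      then show ?thesis using wL by simp
    qed
    moreover have "ln (1 + \<eta>) \<le> 1" using ln_add_one_self_le_self[of \<eta>] \<eta> by simp
    ultimately show ?thesis using ln_2_less_1 by simp
  qed
  have read: "- (Q * (\<delta>\<^sup>2 / 64)) \<le> \<epsilon> * real n * log 2 (real n) * ln cost / real L"
  proof -
    have "\<epsilon> * real n * log 2 (real n) * (- ln cost) \<le> \<epsilon> * real n * log 2 (real n) * (5 * b + 2)"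
      using cost \<epsilon> logn by (intro mult_left_mono) auto
    \<comment> \<open>The constant 40 is 8 * 5, from \<open>n \<le> 8 * 4 ^ L\<close> and
      \<open>log 2 n \<le> 5 * L\<close>.\<close>
    also have "\<dots> \<le> \<epsilon> * (8 * Q) * (5 * real L) * (5 * b + 2)"
      using \<epsilon> logn nQ b Q by (intro mult_mono mult_nonneg_nonneg) auto
    also have "\<dots> = real L * (Q * (40 * \<epsilon> * (5 * b + 2)))" by simp
    also have "\<dots> \<le> real L * (Q * (\<delta>\<^sup>2 / 64))"
      using \<epsilon> Q by (intro mult_left_mono) auto
    finally show ?thesis using Lr by (simp add: field_simps)
  qed
  have gain: "Q * ((\<eta> - \<eta>\<^sup>2) * (1 / 2 + 29 / 30 * \<delta>) / 2) \<le> ln (1 + \<eta>) * (1 / 2 * ((1 / 2 + \<delta>) * 4 ^ L) - 4 ^ L / (2 * sqrt (real L)))"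
  proof -
    have "1 / 2 + 29 / 30 * \<delta> \<le> 1 / 2 + \<delta> - 1 / sqrt (real L)" using invs by simp
    then have "(\<eta> - \<eta>\<^sup>2) * (1 / 2 + 29 / 30 * \<delta>) \<le> ln (1 + \<eta>) * (1 / 2 + \<delta> - 1 / sqrt (real L))"
      using \<eta> \<delta> ln_one_plus_pos_lower_bound[of \<eta>] by (intro mult_mono) auto
    from mult_left_mono[OF this, of "Q / 2"] Q
    show ?thesis unfolding Q_def by (simp add: field_simps)
  qed
  have expo: "\<delta>\<^sup>2 / 64 + (\<eta> / 2 + \<eta>\<^sup>2 / 2 + 1 / real L) / 2 - (\<eta> - \<eta>\<^sup>2) * (1 / 2 + 29 / 30 * \<delta>) / 2 + \<delta>\<^sup>2 / 64 \<le> - (\<delta>\<^sup>2 / 64)"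
  proof -
    have c3: "\<delta>\<^sup>2 * \<delta> \<le> \<delta>\<^sup>2 * (1 / 2)" using \<delta> by (intro mult_left_mono) auto
    have "(\<eta> / 2 + \<eta>\<^sup>2 / 2 + 1 / real L) / 2 - (\<eta> - \<eta>\<^sup>2) * (1 / 2 + 29 / 30 * \<delta>) / 2
        = \<delta>\<^sup>2 / 32 + 1 / real L / 2 - 29 / 240 * \<delta>\<^sup>2 + 29 / 960 * (\<delta>\<^sup>2 * \<delta>)"
      unfolding \<eta>_def by (simp add: field_simps power2_eq_square)
    moreover have "\<delta>\<^sup>2 / 64 + A - B + \<delta>\<^sup>2 / 64 \<le> - (\<delta>\<^sup>2 / 64)"
      if "A - B = \<delta>\<^sup>2 / 32 + t / 2 - 29 / 240 * \<delta>\<^sup>2 + 29 / 960 * (\<delta>\<^sup>2 * \<delta>)" "t \<le> \<delta>\<^sup>2 / 900" for A B t :: real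
      using that c3 zero_le_power2[of \<delta>] by linarith
    ultimately show ?thesis using invL by blast
  qed
  have "real L * ?V ^ 4 ^ L * exp (- \<theta>)
     \<le> exp (Q * (\<delta>\<^sup>2 / 64)) * exp (Q * ((\<eta> / 2 + \<eta>\<^sup>2 / 2 + 1 / real L) / 2))
       * exp (- (Q * ((\<eta> - \<eta>\<^sup>2) * (1 / 2 + 29 / 30 * \<delta>) / 2)) + Q * (\<delta>\<^sup>2 / 64))"
  proof (intro mult_mono LQ pV)
    have "- x \<le> - a + b" if "a + - b \<le> x" for a b x :: real using that by simp
    from this[OF add_mono[OF gain read]]
    show "exp (- \<theta>) \<le> exp (- (Q * ((\<eta> - \<eta>\<^sup>2) * (1 / 2 + 29 / 30 * \<delta>) / 2)) + Q * (\<delta>\<^sup>2 / 64))"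
      unfolding \<theta>_def by (simp only: exp_le_cancel_iff)
  qed (auto intro!: mult_nonneg_nonneg zero_le_power simp: add_nonneg_nonneg)
  also have "\<dots> = exp (Q * (\<delta>\<^sup>2 / 64 + (\<eta> / 2 + \<eta>\<^sup>2 / 2 + 1 / real L) / 2 - (\<eta> - \<eta>\<^sup>2) * (1 / 2 + 29 / 30 * \<delta>) / 2 + \<delta>\<^sup>2 / 64))"
    by (simp add: exp_add[symmetric] algebra_simps)
  also have "\<dots> \<le> exp (Q * (- (\<delta>\<^sup>2 / 64)))"
    using Q expo by (simp only: exp_le_cancel_iff mult_le_cancel_left_pos)
  \<comment> \<open>The constant 512 is 64 * 8, since \<open>n \<le> 8 * 4 ^ L\<close>.\<close>
  also have "\<dots> \<le> exp (- (1 / 512 * \<delta>\<^sup>2 * real n) * ln 2)"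
  proof -
    have "1 / 512 * \<delta>\<^sup>2 * real n * ln 2 \<le> 1 / 512 * \<delta>\<^sup>2 * (8 * Q) * 1"
      using nQ Q ln_2_less_1 by (intro mult_mono mult_nonneg_nonneg) auto
    then show ?thesis by simp
  qed
  also have "\<dots> = 2 powr (- (1 / 512 * \<delta>\<^sup>2 * real n))" by (simp add: powr_def)
  finally show ?thesis .
qed

text \<open>The grid has \<open>2 ^ L + 1\<close> columns of \<open>2 ^ L\<close> vertices for \<open>L = grid_exp n\<close>; for \<open>n < 8\<close> the
  input is the empty sequence.\<close>

definition grid_exp :: "nat \<Rightarrow> nat" where
  "grid_exp n = (LEAST L. n < 8 * 4 ^ L)"

definition hard_input :: "nat \<Rightarrow> operation list pmf" where
  "hard_input n = (if grid_exp n = 0 then return_pmf []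
     else map_pmf (instance_ops (grid_exp n)) (pmf_of_set (inputs (grid_exp n))))"

lemma grid_exp_upper: "n < 8 * 4 ^ grid_exp n"
  unfolding grid_exp_def
proof (rule LeastI)
  have "n < 2 ^ n" by (rule less_exp)
  also have "(2::nat) ^ n \<le> 4 ^ n" by (intro power_mono) auto
  finally show "n < 8 * 4 ^ n" by simp
qed

lemma grid_exp_lower: "0 < grid_exp n \<Longrightarrow> 2 * 4 ^ grid_exp n \<le> n"
proof -
  assume d: "0 < grid_exp n"
  then have "\<not> n < 8 * 4 ^ (grid_exp n - 1)" unfolding grid_exp_def by (intro not_less_Least) simp
  moreover obtain k where "grid_exp n = Suc k" using d gr0_implies_Suc by blast
  ultimately show ?thesis by simp
qed

lemma grid_exp_large: "8 * 4 ^ L \<le> n \<Longrightarrow> L < grid_exp n"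
proof (rule ccontr)
  assume n: "8 * 4 ^ L \<le> n" and "\<not> L < grid_exp n"
  then have "(4::nat) ^ grid_exp n \<le> 4 ^ L" by (intro power_increasing) auto
  then show False using grid_exp_upper[of n] n by linarith
qed

lemma hard_input_support:
  assumes "ops \<in> set_pmf (hard_input n)"
  shows "length ops \<le> 4 * n \<and> (\<forall>x\<in>set ops. operation_on n x) \<and> forest_throughout ops"
proof (cases "grid_exp n = 0")
  case True
  moreover have "is_forest {}" using forest_edges[of 0 "\<lambda>_ x. x" "{}"] by (simp add: edges_def)
  ultimately show ?thesis
    using assms by (simp add: hard_input_def forest_throughout_def graph_after_def)
next
  case False
  then have d: "0 < grid_exp n" by simp
  obtain \<omega> where "\<omega> \<in> inputs (grid_exp n)" "ops = instance_ops (grid_exp n) \<omega>"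
    using assms False by (auto simp: hard_input_def set_pmf_of_set[OF inputs_nonempty[OF d] inputs_finite])
  then show ?thesis using instance_ops_props[OF d _ grid_exp_lower[OF d]] by blast
qed

lemma deterministic_bound:
  fixes \<delta> \<epsilon> b :: real
  assumes d: "0 < grid_exp n" and D: "cell_probe_ds n w D"
    and \<delta>: "0 < \<delta>" and L\<delta>: "900 \<le> real (grid_exp n) * \<delta>\<^sup>2"
    and \<epsilon>: "0 \<le> \<epsilon>" "40 * \<epsilon> * (5 * b + 2) \<le> \<delta>\<^sup>2 / 64"
    and b: "0 \<le> b" and w: "real w \<le> b * log 2 (real n)"
  shows "measure (measure_pmf (hard_input n)) {ops. succeeds n \<epsilon> \<delta> ops D} \<le> 2 powr (- (1 / 512 * \<delta>\<^sup>2 * real n))"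
proof -
  let ?L = "grid_exp n"
  let ?G = "{\<omega> \<in> inputs ?L. succeeds n \<epsilon> \<delta> (instance_ops ?L \<omega>) D}"
  have c: "0 < card (inputs ?L)"
    using inputs_finite inputs_nonempty[OF d] by (simp add: card_gt_0_iff)
  have "inputs ?L \<inter> instance_ops ?L -` {ops. succeeds n \<epsilon> \<delta> ops D} = ?G" by auto
  then have prob_eq: "measure (measure_pmf (hard_input n)) {ops. succeeds n \<epsilon> \<delta> ops D} = real (card ?G) / real (card (inputs ?L))"
    unfolding hard_input_def using d
    by (simp add: measure_pmf_of_set[OF inputs_nonempty[OF d] inputs_finite])
  show ?thesis
  proof (cases "\<delta> \<le> 1 / 2")
    \<comment> \<open>More than all of the queries, of which there is at least one, would have to be
      answered correctly.\<close>
    case False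
    have empty: "?G = {}"
    proof (rule ccontr)
      assume "?G \<noteq> {}"
      then obtain \<omega> where \<omega>: "\<omega> \<in> inputs ?L" "succeeds n \<epsilon> \<delta> (instance_ops ?L \<omega>) D" by blast
      let ?ops = "instance_ops ?L \<omega>"
      have nq: "nqueries ?ops = 4 ^ ?L" by (rule instance_ops_props(4)[OF d \<omega>(1) grid_exp_lower[OF d]])
      have len: "length (fst (run D ?ops)) = length ?ops" unfolding run_def by (rule length_run_from)
      have "real (ncorrect {} ?ops (fst (run D ?ops))) \<le> 4 ^ ?L"
        using ncorrect_le[of "{}" ?ops "fst (run D ?ops)"] unfolding nq
        by (metis of_nat_le_iff of_nat_numeral of_nat_power)
      moreover have "(1 / 2 + \<delta>) * 4 ^ ?L \<le> real (ncorrect {} ?ops (fst (run D ?ops)))"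
        using \<omega>(2) unfolding succeeds_def case_prod_beta card_correct_positions[OF len] card_query_positions nq by simp
      moreover have "1 * 4 ^ ?L < (1 / 2 + \<delta>) * 4 ^ ?L" using False by (intro mult_strict_right_mono) auto
      ultimately show False by linarith
    qed
    show ?thesis unfolding prob_eq empty by simp
  next
    case True
    interpret ds_process ?L w D
    proof unfold_locales
      show "0 < ?L" by (rule d)
      have "(2 ^ ?L + 1) * 2 ^ ?L \<le> n"
      proof -
        have "(2::nat) ^ ?L \<le> 4 ^ ?L" by (intro power_mono) auto
        moreover have "(2::nat) ^ ?L * 2 ^ ?L = 4 ^ ?L" by (simp add: power_mult_distrib[symmetric])
        ultimately show ?thesis using grid_exp_lower[OF d] by (simp add: distrib_right)
      qed
      then show "word_bounded w (procedure D x)" if "operation_on ((2 ^ ?L + 1) * 2 ^ ?L) x" for x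
        using D operation_on_mono[OF that] unfolding cell_probe_ds_def by blast
    qed
    have mem: "word_memory w (initial_memory D)"
      using D unfolding cell_probe_ds_def word_memory_def by blast
    have n1: "1 \<le> n" using grid_exp_lower[OF d] by (metis One_nat_def Suc_leI gr0I le_zero_eq mult_is_0 power_not_zero zero_neq_numeral)
    have "real (card ?G) \<le> real (card (inputs ?L)) * 2 powr (- (1 / 512 * \<delta>\<^sup>2 * real n))"
    proof (rule order_trans[OF success_count])
      show "0 \<le> \<delta> / 4" "0 \<le> 1 / 2 + \<delta>" using \<delta> by auto
      show "word_memory w (initial_memory D)" by (rule mem)
      show "real (card (inputs ?L)) * (real ?L * sqrt ((1 + exp (\<delta> / 4)) / 2 * exp (1 / real ?L)) ^ 4 ^ ?L *
          exp (- (ln (1 + \<delta> / 4) * (1 / 2 * ((1 / 2 + \<delta>) * 4 ^ ?L) - 4 ^ ?L / (2 * sqrt (real ?L)))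
          + \<epsilon> * real n * log 2 (real n) * ln (probe_cost (\<delta> / 4)) / real ?L)))
        \<le> real (card (inputs ?L)) * 2 powr (- (1 / 512 * \<delta>\<^sup>2 * real n))"
        unfolding probe_cost_def
        by (rule mult_left_mono[OF numeric_bound[OF d grid_exp_upper n1 \<delta> True L\<delta> \<epsilon> b w]]) simp
    qed
    then show ?thesis unfolding prob_eq using c by (simp add: divide_le_eq mult.commute)
  qed
qed

text \<open>The easy direction of Yao's principle: input and randomness are independent, so a bound
  for every fixed data structure survives integration over \<open>R\<close>.\<close>

lemma success_prob_le:
  assumes R: "randomized_ds n w R" and B: "0 \<le> B"
    and D: "\<And>D. cell_probe_ds n w D \<Longrightarrow> measure (measure_pmf I) {ops. succeeds n \<epsilon> \<delta> ops D} \<le> B"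
  shows "success_prob n \<epsilon> \<delta> I R \<le> B"
proof -
  interpret R: prob_space R using R by (simp add: randomized_ds_def)
  interpret pair_prob_space "measure_pmf I" R by unfold_locales
  let ?A = "{(ops, D). D \<in> space R \<and> succeeds n \<epsilon> \<delta> ops D}"
  have "emeasure (measure_pmf I \<Otimes>\<^sub>M R) ?A = (\<integral>\<^sup>+D. emeasure (measure_pmf I) ((\<lambda>ops. (ops, D)) -` ?A) \<partial>R)"
    by (rule emeasure_pair_measure_alt2[OF success_event_measurable[OF R]])
  also have "\<dots> \<le> (\<integral>\<^sup>+D. ennreal B \<partial>R)"
  proof (rule nn_integral_mono)
    fix D' assume D': "D' \<in> space R"
    then have "cell_probe_ds n w D'" using R by (simp add: randomized_ds_def)
    from D[OF this] have "emeasure (measure_pmf I) {ops. succeeds n \<epsilon> \<delta> ops D'} \<le> ennreal B"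
      by (simp add: measure_pmf.emeasure_eq_measure ennreal_leI)
    then show "emeasure (measure_pmf I) ((\<lambda>ops. (ops, D')) -` ?A) \<le> ennreal B"
      using D' by (simp add: vimage_def)
  qed
  also have "\<dots> = ennreal B" by (simp add: R.emeasure_space_1)
  finally show ?thesis
    unfolding success_prob_def using B by (simp add: emeasure_eq_measure)
qed

text \<open>With \<open>\<epsilon> \<ge> c / log 2 n\<close>, the quantity
  \<open>log 2 (1 / \<epsilon>)\<close> is at most the logarithm of a multiple of \<open>L\<close>,
  hence \<open>o(L)\<close>. This turns the hypothesis on \<delta> into
  \<open>L * \<delta>\<^sup>2 \<ge> 900\<close>.\<close>

lemma eventually_log_small:
  fixes C c :: real
  assumes "0 < C" "0 < c"
  shows "\<exists>L0. \<forall>L\<ge>L0. 900 * log 2 (5 * real L / c) \<le> C * real L"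
proof -
  have "\<forall>\<^sub>F L in sequentially. 900 * log 2 (5 * real L / c) \<le> C * real L"
    using assms by real_asymp
  then show ?thesis unfolding eventually_sequentially .
qed

theorem theorem3:
  "\<exists>(I :: nat \<Rightarrow> operation list pmf) (K :: nat).
     (\<forall>n. \<forall>ops\<in>set_pmf (I n).
        length ops \<le> K * n \<and> (\<forall>x\<in>set ops. operation_on n x) \<and> forest_throughout ops) \<and>
     (\<forall>(a :: real) (b :: real) (c :: real). 0 < a \<and> 0 < b \<and> 0 < c \<longrightarrow>
       (\<exists>(C :: real) (\<kappa> :: real) (N :: nat). 0 < C \<and> 0 < \<kappa> \<and>
         (\<forall>n\<ge>N. \<forall>(w :: nat) (R :: data_structure measure) (\<epsilon> :: real) (\<delta> :: real).
            a * log 2 (real n) \<le> real w \<and> real w \<le> b * log 2 (real n) \<and>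
            randomized_ds n w R \<and>
            c / log 2 (real n) \<le> \<epsilon> \<and> \<epsilon> < 1 \<and>
            0 < \<delta> \<and> C / log 2 (1 / \<epsilon>) \<le> \<delta>\<^sup>2 \<longrightarrow>
            success_prob n \<epsilon> \<delta> (I n) R \<le> 2 powr (- (\<kappa> * \<delta>\<^sup>2 * real n)))))"
proof (intro exI[of _ hard_input] exI[of _ "4::nat"] conjI allI ballI impI)
  fix n ops assume "ops \<in> set_pmf (hard_input n)"
  from hard_input_support[OF this]
  show "length ops \<le> 4 * n" "\<And>x. x \<in> set ops \<Longrightarrow> operation_on n x" "forest_throughout ops" by auto
next
  fix a b c :: real assume "0 < a \<and> 0 < b \<and> 0 < c"
  then have b: "0 < b" and c: "0 < c" by auto
  \<comment> \<open>5120 is 2 * 40 * 64: the 2 is from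
    \<open>\<epsilon> \<le> 2 / log 2 (1 / \<epsilon>)\<close>, and 40 and 64 are those of
    \<open>numeric_bound\<close>.\<close>
  define C where "C = 5120 * (5 * b + 2)"
  have C: "0 < C" unfolding C_def using b by simp
  obtain L0 where L0: "\<And>L. L0 \<le> L \<Longrightarrow> 900 * log 2 (5 * real L / c) \<le> C * real L"
    using eventually_log_small[OF C c] by blast
  have main: "success_prob n \<epsilon> \<delta> (hard_input n) R \<le> 2 powr (- (1 / 512 * \<delta>\<^sup>2 * real n))"
    if n: "8 * 4 ^ L0 \<le> n" and w: "real w \<le> b * log 2 (real n)" and R: "randomized_ds n w R"
      and \<epsilon>: "c / log 2 (real n) \<le> \<epsilon>" "\<epsilon> < 1" and \<delta>: "0 < \<delta>" "C / log 2 (1 / \<epsilon>) \<le> \<delta>\<^sup>2"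
    for n w R \<epsilon> \<delta>
  proof (rule success_prob_le[OF R])
    fix D assume D: "cell_probe_ds n w D"
    let ?L = "grid_exp n"
    have d: "L0 < ?L" by (rule grid_exp_large[OF n])
    have n1: "8 \<le> n" using n one_le_power[of "4::nat" L0] by linarith
    have ln_pos: "0 < log 2 (real n)" using n1 by simp
    have \<epsilon>0: "0 < \<epsilon>" using \<epsilon>(1) c ln_pos by (meson divide_pos_pos less_le_trans)
    define l where "l = log 2 (1 / \<epsilon>)"
    have l: "0 < l" unfolding l_def using \<epsilon>0 \<epsilon>(2) by simp
    \<comment> \<open>To control the reads, \<open>\<epsilon> = O(\<delta>\<^sup>2)\<close> is
      enough, so the crude \<open>ln x \<le> x - 1\<close> suffices.\<close>
    have "\<epsilon> \<le> 2 / l"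
    proof -
      have "1 / 2 \<le> ln (2::real)" using exp_half_le2 by (subst ln_ge_iff) auto
      then have "l * (1 / 2) \<le> l * ln 2" using l by (intro mult_left_mono) auto
      also have "\<dots> \<le> 1 / \<epsilon> - 1"
        unfolding l_def log_def using ln_le_minus_one[of "1 / \<epsilon>"] \<epsilon>0 by simp
      finally have "l \<le> 2 / \<epsilon>" by simp
      then show ?thesis using \<epsilon>0 l by (simp add: field_simps)
    qed
    then have "5120 * (5 * b + 2) * \<epsilon> \<le> 5120 * (5 * b + 2) * (2 / l)"
      using b by (intro mult_left_mono) auto
    also have "\<dots> = 2 * (C / l)" by (simp add: C_def)
    also have "\<dots> \<le> 2 * \<delta>\<^sup>2" using \<delta>(2) unfolding l_def[symmetric] by (intro mult_left_mono) auto
    finally have read: "40 * \<epsilon> * (5 * b + 2) \<le> \<delta>\<^sup>2 / 64" by (simp add: algebra_simps)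
    have "log 2 (real n) \<le> log 2 (2 ^ (3 + 2 * ?L))"
    proof (rule log_mono)
      have "real n \<le> real (8 * 4 ^ ?L)" using grid_exp_upper[of n] by (simp only: of_nat_le_iff less_imp_le)
      then show "real n \<le> 2 ^ (3 + 2 * ?L)" by (simp add: power_add power_mult)
    qed (use n1 in auto)
    also have "\<dots> = real (3 + 2 * ?L)" by (subst log_nat_power) auto
    also have "\<dots> \<le> 5 * real ?L" using d by simp
    finally have logn: "log 2 (real n) \<le> 5 * real ?L" .
    have "1 / \<epsilon> \<le> log 2 (real n) / c" using \<epsilon>(1) \<epsilon>0 c ln_pos by (simp add: field_simps)
    also have "\<dots> \<le> 5 * real ?L / c" using logn c by (intro divide_right_mono) auto
    finally have "l \<le> log 2 (5 * real ?L / c)" unfolding l_def using \<epsilon>0 by (intro log_mono) auto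
    then have "900 * l \<le> C * real ?L" using L0[of ?L] d by simp
    then have "900 \<le> real ?L * (C / l)" using l by (simp add: field_simps)
    also have "\<dots> \<le> real ?L * \<delta>\<^sup>2" using \<delta>(2) unfolding l_def[symmetric] by (intro mult_left_mono) auto
    finally have level: "900 \<le> real ?L * \<delta>\<^sup>2" .
    show "measure (measure_pmf (hard_input n)) {ops. succeeds n \<epsilon> \<delta> ops D} \<le> 2 powr (- (1 / 512 * \<delta>\<^sup>2 * real n))"
    proof (rule deterministic_bound[OF _ D \<delta>(1)])
      show "0 < ?L" using d by simp
      show "0 \<le> \<epsilon>" using \<epsilon>0 by simp
      show "0 \<le> b" using b by simp
      show "real w \<le> b * log 2 (real n)" by (rule w)
      show "40 * \<epsilon> * (5 * b + 2) \<le> \<delta>\<^sup>2 / 64" by (rule read)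
      show "900 \<le> real ?L * \<delta>\<^sup>2" by (rule level)
    qed
  qed simp
  show "\<exists>(C :: real) (\<kappa> :: real) (N :: nat). 0 < C \<and> 0 < \<kappa> \<and>
         (\<forall>n\<ge>N. \<forall>(w :: nat) (R :: data_structure measure) (\<epsilon> :: real) (\<delta> :: real).
            a * log 2 (real n) \<le> real w \<and> real w \<le> b * log 2 (real n) \<and>
            randomized_ds n w R \<and>
            c / log 2 (real n) \<le> \<epsilon> \<and> \<epsilon> < 1 \<and>
            0 < \<delta> \<and> C / log 2 (1 / \<epsilon>) \<le> \<delta>\<^sup>2 \<longrightarrow>
            success_prob n \<epsilon> \<delta> (hard_input n) R \<le> 2 powr (- (\<kappa> * \<delta>\<^sup>2 * real n)))"
    by (intro exI[of _ C] exI[of _ "1 / 512"] exI[of _ "8 * 4 ^ L0"] conjI allI impI C main) auto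
qed

end
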